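(* Let $\{x_n^{\mathrm{flat}}(t),\ n\in\mathbb{Z},\ t\ge 0\}$ be the system of one-sided reflected Brownian motions with deterministic periodic initial condition $x_n^{\mathrm{flat}}(0)=n$ for all $n\in\mathbb{Z}$. Then for every $a>0$, $$\lim_{t\to\infty} t^{-1}\log \mathbb{P}\left(x_t^{\mathrm{flat}}(t)\ge 2t+at\right)=-r^{\mathrm{flat}}(a)$$ (the limit exists, $t$ running through the positive integers), where $$r^{\mathrm{flat}}(a)=\max_{z\in(-\infty,-1)}\left\{\big(\varphi(z)-z\big)\left(\frac{z+\varphi(z)}{2}+1+a\right)\right\},$$ and the maximum is attained at $z=z_a$, the unique solution $z_a\in(-\infty,-1)$ of $$(z_a+1)(\varphi(z_a)+1)+a=0.$$
   Context: Dynamics. Let $\{B_n,\ n\in\mathbb{Z}\}$ be independent standard Brownian motions started at $0$. For a (possibly random, independent of the $B_n$) initial condition $(x_n(0))_{n\in\mathbb{Z}}$ with $x_n(0)\ge x_{n-1}(0)$, the system of one-sided reflected Brownian motions is the one in which $x_n$ is driven by $B_n$ and is reflected off $x_{n-1}$ in the positive direction (Skorokhod reflection), so that $x_n(t)\ge x_{n-1}(t)$ for all $t$ and $x_{n-1}$ is not influenced by $x_n$. Explicitly, $$x_n(t)=\sup_{k\le n}\Big\{x_k(0)+Y_{k,n}(t)\Big\},\qquad Y_{k,n}(t)=\sup_{0=s_{k-1}\le s_k\le\dots\le s_{n-1}\le s_n=t}\ \sum_{i=k}^{n}\big(B_i(s_i)-B_i(s_{i-1})\big),$$ which is almost surely finite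 and well defined for the initial condition considered. The function $\varphi$ is $\varphi(z)=L_0(ze^z)$, where $L_0$ is the principal branch of the Lambert W function (the principal solution $w$ of $we^w=\cdot$). In particular, for $z\in(-\infty,-1)$, $\varphi(z)$ is the unique element of $(-1,0)$ with $\varphi(z)e^{\varphi(z)}=ze^z$. *)

theory Defs
  imports "HOL-Probability.Probability"
begin

text \<open>Path continuity and the start at \<open>0\<close> are required for every \<open>\<omega>\<close>, not only almost surely, so
  that the events built from suprema over uncountable sets of times are measurable without
  completeness of \<open>M\<close>.\<close>

definition standard_BM :: "'a measure \<Rightarrow> (real \<Rightarrow> 'a \<Rightarrow> real) \<Rightarrow> bool" where
  "standard_BM M W \<longleftrightarrow>
     prob_space M \<and>
     (\<forall>t\<ge>0. W t \<in> borel_measurable M) \<and>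
     (\<forall>\<omega>\<in>space M. W 0 \<omega> = 0) \<and>
     (\<forall>\<omega>\<in>space M. continuous_on {0..} (\<lambda>t. W t \<omega>)) \<and>
     (\<forall>s t. 0 \<le> s \<and> s < t \<longrightarrow>
        distributed M lborel (\<lambda>\<omega>. W t \<omega> - W s \<omega>) (normal_density 0 (sqrt (t - s)))) \<and>
     (\<forall>(m::nat) u. 0 \<le> u 0 \<and> mono u \<longrightarrow>
        prob_space.indep_vars M (\<lambda>_. borel) (\<lambda>i \<omega>. W (u (Suc i)) \<omega> - W (u i) \<omega>) {..<m})"

text \<open>Independence of the family means independence of the whole paths, as random elements of the
  product space over the time set \<open>{0..}\<close>.\<close>

definition indep_standard_BMs :: "'a measure \<Rightarrow> (int \<Rightarrow> real \<Rightarrow> 'a \<Rightarrow> real) \<Rightarrow> bool" where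
  "indep_standard_BMs M B \<longleftrightarrow>
     (\<forall>n. standard_BM M (B n)) \<and>
     prob_space.indep_vars M (\<lambda>_. PiM {0..} (\<lambda>_. borel)) (\<lambda>n \<omega>. \<lambda>t\<in>{0..}. B n t \<omega>) UNIV"

definition time_splits :: "int \<Rightarrow> int \<Rightarrow> real \<Rightarrow> (int \<Rightarrow> real) set" where
  "time_splits k n t = {s. s (k - 1) = 0 \<and> s n = t \<and> (\<forall>i\<in>{k..n}. s (i - 1) \<le> s i)}"

text \<open>The suprema are taken in the extended reals: the supremum over \<open>k \<le> n\<close> is finite only almost
  surely, and a supremum in type \<open>real\<close> would be an unspecified value on the exceptional set.
  Here \<open>b i\<close> is the realised path of the \<open>i\<close>-th driving motion.\<close>

definition last_passage :: "(int \<Rightarrow> real \<Rightarrow> real) \<Rightarrow> int \<Rightarrow> int \<Rightarrow> real \<Rightarrow> ereal" where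
  "last_passage b k n t =
     (SUP s\<in>time_splits k n t. ereal (\<Sum>i=k..n. b i (s i) - b i (s (i - 1))))"

definition reflected_system ::
    "(int \<Rightarrow> real) \<Rightarrow> (int \<Rightarrow> real \<Rightarrow> real) \<Rightarrow> int \<Rightarrow> real \<Rightarrow> ereal" where
  "reflected_system x0 b n t = (SUP k\<in>{..n}. ereal (x0 k) + last_passage b k n t)"

definition x_flat :: "(int \<Rightarrow> real \<Rightarrow> 'a \<Rightarrow> real) \<Rightarrow> int \<Rightarrow> real \<Rightarrow> 'a \<Rightarrow> ereal" where
  "x_flat B n t \<omega> = reflected_system (\<lambda>k. real_of_int k) (\<lambda>i s. B i s \<omega>) n t"

text \<open>Real principal branch of the Lambert W function, meaningful on \<open>[-1/e, \<infinity>)\<close>.\<close>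

definition lambert_W0 :: "real \<Rightarrow> real" where
  "lambert_W0 y = (THE w. w \<ge> -1 \<and> w * exp w = y)"

definition phi :: "real \<Rightarrow> real" where
  "phi z = lambert_W0 (z * exp z)"

definition flat_objective :: "real \<Rightarrow> real \<Rightarrow> real" where
  "flat_objective a z = (phi z - z) * ((z + phi z) / 2 + 1 + a)"

text \<open>Written as a supremum, since \<open>Max\<close> is only for finite sets; that it is attained has to be
  stated separately.\<close>

definition r_flat :: "real \<Rightarrow> real" where
  "r_flat a = (SUP z\<in>{..<-1}. flat_objective a z)"

end

theory Submission
  imports Defs
begin

text \<open>
  The flat tail is a union over starting labels, so only the single last passage times are needed,
  up to subexponential factors. Their exponential moments come from a sub-invariance property:
  on ordered configurations \<open>x\<^sub>0 \<le> \<dots> \<le> x\<^sub>n\<close> the measure with density \<open>exp (- u x\<^sub>n)\<close> is mapped by one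
  time step of the discretised reflected system below its multiple by the moment generating function
  of a step at \<open>u\<close>, in the order of functions increasing in \<open>x\<^sub>1, \<dots>, x\<^sub>n\<close>. Testing with
  \<open>exp (\<theta> x\<^sub>n)\<close>, \<open>\<theta> = u - v\<close>, bounds the moment of a passage through \<open>d + 1\<close> labels by
  \<open>(u / v) ^ d * exp (t (u\<^sup>2 - v\<^sup>2) / 2)\<close>, uniformly in the time mesh.

  The same computation with steps bounded by \<open>e / 2\<close> and an enforced gap \<open>e\<close> gives the opposite
  inequality, because an overshoot never exceeds \<open>e\<close>. It bounds from below a sum of moments over
  all labels, weighted by \<open>(v / u) ^ d\<close>, plus the contribution of paths that use the bottom label; by
  Cauchy-Schwarz the latter is negligible once the number of labels is a large multiple of \<open>t\<close>.
  For \<open>u / v = exp \<theta>\<close> these are the weights of the flat initial condition, so the flat moments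
  grow at the rate \<open>\<theta>\<^sup>2 / 2 + \<theta>\<^sup>2 / (exp \<theta> - 1)\<close>. The large deviation limit then follows by exponential
  tilting, with \<open>z = - u\<close> and \<open>phi z = - v\<close>.
\<close>


section \<open>The rate function\<close>

text \<open>For given \<theta> the requirement u - v = \<theta> leaves one free parameter. The
  moment bound grows like (u / v) ^ d, while a start d labels back costs exp (- \<theta> d). The
  choice u / v = exp \<theta> cancels the two, so one bound serves every label; it forces v =
  \<theta> / (exp \<theta> - 1), and u exp (- u) = v exp (- v) is the relation behind
  \<open>phi\<close>. The reverse inequality is proved only for the sum over labels, but a sum of
  linearly many terms loses no exponential rate. Two obstacles shape the proof. The overshoot of
  Gaussian steps is unbounded, so steps are cut off at e / 2; the gap e then costs at most exp
  (\<theta> n e) over n labels, kept small by fixing e before the time mesh is refined. And the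
  exponential measure is infinite, since the bottom label ranges over the whole line. A window on
  its final position makes the integrals finite and leaves a factor exp (v S), with S the total
  displacement of that label. Passages starting above the bottom label are independent of S, so the
  factor splits off; passages from the bottom label itself are those left to Cauchy-Schwarz.\<close>

definition small_root :: "real \<Rightarrow> real" where "small_root \<theta> = \<theta> / (exp \<theta> - 1)"
definition flat_cgf :: "real \<Rightarrow> real" where "flat_cgf \<theta> = \<theta>\<^sup>2 / 2 + \<theta> * small_root \<theta>"

text \<open>The derivative (1 + z) exp z vanishes on this range only at the endpoint -1, and
  positivity on the open interval is enough. Injectivity on [-1, \<infinity>) is what makes the
  principal branch well defined.\<close>

lemma x_exp_x_strict_mono:
  fixes x y :: real assumes "-1 \<le> x" "x < y" shows "x * exp x < y * exp y"
proof (rule DERIV_pos_imp_increasing_open[OF assms(2)])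
  show "continuous_on {x..y} (\<lambda>x. x * exp x)" by (intro continuous_intros)
  fix z assume z: "x < z" "z < y"
  have "((\<lambda>x. x * exp x) has_real_derivative (1 + z) * exp z) (at z)"
    by (auto intro!: derivative_eq_intros simp: algebra_simps)
  moreover have "(1 + z) * exp z > 0" using z assms by simp
  ultimately show "\<exists>l. DERIV (\<lambda>x. x * exp x) z :> l \<and> l > 0" by blast
qed

lemma lambert_W0_unique:
  assumes "w \<ge> -1" "w * exp w = y" shows "lambert_W0 y = w"
  unfolding lambert_W0_def
proof (rule the_equality)
  fix w' assume "w' \<ge> -1 \<and> w' * exp w' = y"
  then show "w' = w" using assms x_exp_x_strict_mono[of w w'] x_exp_x_strict_mono[of w' w]
    by (cases w w' rule: linorder_cases) auto
qed (use assms in simp)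

lemma exp_gt_one_plus: "x \<noteq> 0 \<Longrightarrow> 1 + x < exp (x::real)"
  using exp_minus_ge[of "-x"] exp_ge_add_one_self[of x] exp_minus_greater[of "-x"] by auto

lemma small_root_pos: "\<theta> > 0 \<Longrightarrow> small_root \<theta> > 0"
  by (simp add: small_root_def)

lemma small_root_less_1: "\<theta> > 0 \<Longrightarrow> small_root \<theta> < 1"
  using exp_gt_one_plus[of \<theta>] by (simp add: small_root_def field_simps)

lemma small_root_eq: "\<theta> > 0 \<Longrightarrow> small_root \<theta> * exp \<theta> = small_root \<theta> + \<theta>"
  by (simp add: small_root_def field_simps)

text \<open>Places z = - (v + \<theta>) to the left of -1. It is 1 - \<theta> < exp (- \<theta>)
  multiplied by exp \<theta>.\<close>

lemma small_root_plus_gt_1: assumes "\<theta> > 0" shows "small_root \<theta> + \<theta> > 1"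
proof -
  have "1 - \<theta> < exp (-\<theta>)" using exp_gt_one_plus[of "-\<theta>"] assms by simp
  then have "(1 - \<theta>) * exp \<theta> < exp (-\<theta>) * exp \<theta>" by (intro mult_strict_right_mono) auto
  then have "(1 - \<theta>) * exp \<theta> < 1" by (simp add: exp_minus)
  then show ?thesis using assms by (simp add: small_root_def field_simps)
qed

lemma phi_small_root:
  assumes "\<theta> > 0" shows "phi (- (small_root \<theta> + \<theta>)) = - small_root \<theta>"
  unfolding phi_def
proof (rule lambert_W0_unique)
  show "- 1 \<le> - small_root \<theta>" using small_root_less_1[OF assms] by simp
  have "(small_root \<theta> + \<theta>) * exp (- (small_root \<theta> + \<theta>)) = small_root \<theta> * exp \<theta> * exp (- (small_root \<theta> + \<theta>))"
    using small_root_eq[OF assms] by simp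
  also have "\<dots> = small_root \<theta> * exp (- small_root \<theta>)" by (simp add: mult.assoc flip: exp_add)
  finally show "- small_root \<theta> * exp (- small_root \<theta>) = - (small_root \<theta> + \<theta>) * exp (- (small_root \<theta> + \<theta>))"
    by (simp only: minus_mult_left[symmetric])
qed

text \<open>On the left of -1 the function x exp x lies strictly between its minimum, at -1, and 0,
  so each value is taken again at some w in [-1, 0]. The parameter \<theta> is the distance w - z of
  the two preimages.\<close>

lemma ex_small_root:
  assumes "z < -1" obtains \<theta> where "\<theta> > 0" "z = - (small_root \<theta> + \<theta>)"
proof -
  define f where "f w = w * exp w" for w :: real
  have neg: "f z < 0" unfolding f_def using assms by (simp add: mult_less_0_iff)
  have "f (-1) < f z"
  proof -
    have "f z > f (-1)"
    proof (rule DERIV_neg_imp_decreasing_open[OF assms])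
      show "continuous_on {z..-1} f" unfolding f_def by (intro continuous_intros)
      fix x assume x: "z < x" "x < -1"
      have "(f has_real_derivative (1 + x) * exp x) (at x)" unfolding f_def
        by (auto intro!: derivative_eq_intros simp: algebra_simps)
      moreover have "(1 + x) * exp x < 0" using x by (simp add: mult_less_0_iff)
      ultimately show "\<exists>l. DERIV f x :> l \<and> l < 0" by blast
    qed
    then show ?thesis .
  qed
  moreover have "f 0 = 0" by (simp add: f_def)
  moreover have "continuous_on {-1..0} f" unfolding f_def by (intro continuous_intros)
  ultimately obtain w where w: "-1 \<le> w" "w \<le> 0" "f w = f z"
    using IVT'[of f "-1" "f z" 0] neg by auto
  have w0: "w \<noteq> 0" using w(3) neg by (auto simp: f_def)
  define \<theta> where "\<theta> = w - z"
  have th: "\<theta> > 0" using w assms by (simp add: \<theta>_def)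
  have "w * exp w = z * exp z" using w(3) by (simp add: f_def)
  then have "w * exp \<theta> = z" by (simp add: \<theta>_def exp_diff field_simps)
  then have "w * (exp \<theta> - 1) = - \<theta>" by (simp add: \<theta>_def algebra_simps)
  then have "small_root \<theta> = - w" using th by (simp add: small_root_def field_simps)
  then show ?thesis using that[OF th] by (simp add: \<theta>_def)
qed

text \<open>With \<theta> = phi z - z as the variable, the maximisation over z becomes the Legendre
  transform of \<open>flat_cgf\<close> at 1 + a.\<close>

lemma flat_objective_small_root:
  assumes "\<theta> > 0"
  shows "flat_objective a (- (small_root \<theta> + \<theta>)) = \<theta> * (1 + a) - flat_cgf \<theta>"
  using phi_small_root[OF assms] by (simp add: flat_objective_def flat_cgf_def field_simps power2_eq_square)

text \<open>This is the derivative of \<open>flat_cgf\<close> minus 1, and also - (z + 1) (phi z +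
  1) at z = - (v + \<theta>). The equation for z_a is thus the stationarity condition of the
  Legendre transform.\<close>

definition flat_speed :: "real \<Rightarrow> real" where "flat_speed \<theta> = (small_root \<theta> + \<theta> - 1) * (1 - small_root \<theta>)"

lemma small_root_DERIV:
  assumes "\<theta> > 0"
  shows "(small_root has_real_derivative small_root \<theta> * (1 - (small_root \<theta> + \<theta>)) / \<theta>) (at \<theta>)"
proof -
  have e: "exp \<theta> - 1 > 0" using assms by simp
  have "((\<lambda>\<theta>. \<theta> / (exp \<theta> - 1)) has_real_derivative
      (1 * (exp \<theta> - 1) - \<theta> * exp \<theta>) / ((exp \<theta> - 1) * (exp \<theta> - 1))) (at \<theta>)"
    using e by (auto intro!: derivative_eq_intros simp: power2_eq_square)
  moreover have "(1 * (exp \<theta> - 1) - \<theta> * exp \<theta>) / ((exp \<theta> - 1) * (exp \<theta> - 1))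
      = small_root \<theta> * (1 - (small_root \<theta> + \<theta>)) / \<theta>"
  proof -
    define E where "E = exp \<theta> - 1"
    have E: "E > 0" "exp \<theta> = E + 1" using e by (simp_all add: E_def)
    show ?thesis using E(1) assms unfolding small_root_def E(2) by (simp add: field_simps)
  qed
  ultimately show ?thesis unfolding small_root_def[abs_def] by simp
qed

text \<open>With v the small root and u = v + \<theta>, both factors u - 1 and 1 - v are positive
  and increasing: v' = v (1 - u) / \<theta> < 0 and u' = u (1 - v) / \<theta> > 0.\<close>

lemma flat_speed_DERIV:
  assumes "\<theta> > 0" shows "\<exists>l>0. (flat_speed has_real_derivative l) (at \<theta>)"
proof -
  let ?v = "small_root \<theta>" and ?d = "small_root \<theta> * (1 - (small_root \<theta> + \<theta>)) / \<theta>"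
  have "(flat_speed has_real_derivative (?d + 1) * (1 - ?v) + (?v + \<theta> - 1) * (- ?d)) (at \<theta>)"
    unfolding flat_speed_def[abs_def]
    by (rule derivative_eq_intros small_root_DERIV[OF assms] refl)+ simp
  moreover have "?d + 1 = (?v + \<theta>) * (1 - ?v) / \<theta>" using assms by (simp add: field_simps)
  moreover have "\<dots> > 0" using assms small_root_less_1[OF assms] small_root_pos[OF assms] by (intro divide_pos_pos mult_pos_pos) auto
  moreover have "?d < 0" using assms small_root_pos[OF assms] small_root_plus_gt_1[OF assms]
    by (intro divide_neg_pos mult_pos_neg) auto
  ultimately show ?thesis
    using small_root_less_1[OF assms] small_root_plus_gt_1[OF assms]
    by (metis add_pos_pos diff_gt_0_iff_gt mult_pos_pos neg_0_less_iff_less)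
qed

lemma flat_speed_cont: "continuous_on {0<..} flat_speed"
  by (intro continuous_at_imp_continuous_on ballI) (metis DERIV_isCont flat_speed_DERIV greaterThan_iff)

lemma flat_speed_strict_mono: assumes "0 < x" "x < y" shows "flat_speed x < flat_speed y"
proof (rule DERIV_pos_imp_increasing_open[OF assms(2)])
  show "continuous_on {x..y} flat_speed" by (rule continuous_on_subset[OF flat_speed_cont]) (use assms in auto)
  fix z assume "x < z" "z < y"
  then show "\<exists>l. DERIV flat_speed z :> l \<and> l > 0" using flat_speed_DERIV[of z] assms by auto
qed

lemma ex_flat_speed: assumes "a > 0" obtains \<theta> where "\<theta> > 0" "flat_speed \<theta> = a"
proof -
  have lo: "flat_speed a < a"
  proof -
    have "flat_speed a < a * 1" unfolding flat_speed_def
      using small_root_less_1[OF assms] small_root_pos[OF assms] small_root_plus_gt_1[OF assms] assms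
      by (intro mult_strict_mono') auto
    then show ?thesis by simp
  qed
  \<comment> \<open>Since v is at most 2 / (2 + h), the speed at h is at least (h - 1) h / (2 + h),
    which exceeds a for this h.\<close>
  define h where "h = a + 4"
  have h: "h > 0" using assms by (simp add: h_def)
  have "exp h \<ge> 1 + h + h\<^sup>2 / 2" using exp_lower_Taylor_quadratic[of h] h by simp
  then have "exp h - 1 \<ge> h * (1 + h / 2)" by (simp add: power2_eq_square algebra_simps)
  then have "small_root h \<le> h / (h * (1 + h / 2))" unfolding small_root_def using h
    by (intro divide_left_mono mult_pos_pos) (auto intro: add_pos_pos)
  also have "\<dots> = 2 / (2 + h)" using h by (simp add: divide_simps) 
  finally have "1 - small_root h \<ge> 1 - 2 / (2 + h)" by simp
  then have v: "1 - small_root h \<ge> h / (2 + h)" using h by (simp add: field_simps)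
  have "(h - 1) * (h / (2 + h)) \<le> flat_speed h" unfolding flat_speed_def
    using v small_root_pos[OF h] h assms by (intro mult_mono) (auto simp: h_def)
  moreover have "a \<le> (h - 1) * (h / (2 + h))" using assms
    by (simp add: h_def field_simps power2_eq_square)
  ultimately have hi: "a \<le> flat_speed h" by simp
  have "\<exists>x\<ge>a. x \<le> h \<and> flat_speed x = a"
  proof (rule IVT')
    show "continuous_on {a..h} flat_speed" by (rule continuous_on_subset[OF flat_speed_cont]) (use assms in auto)
  qed (use lo hi assms in \<open>auto simp: h_def\<close>)
  then obtain x where "x \<ge> a" "flat_speed x = a" by blast
  with assms show ?thesis by (intro that[of x]) auto
qed

text \<open>The derivative in x is \<open>flat_speed \<theta> - flat_speed x\<close>, which changes
  sign exactly at \<theta>. The strictness is what makes the tilted moments concentrate in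
  \<open>flat_tail_lower\<close>.\<close>

lemma objective_strict_max:
  assumes "\<theta> > 0" "\<theta>' > 0" "\<theta>' \<noteq> \<theta>"
  shows "\<theta>' * (1 + flat_speed \<theta>) - flat_cgf \<theta>' < \<theta> * (1 + flat_speed \<theta>) - flat_cgf \<theta>"
proof -
  define f where "f x = x * (1 + flat_speed \<theta>) - flat_cgf x" for x
  have D: "(f has_real_derivative flat_speed \<theta> - flat_speed x) (at x)" if "x > 0" for x
  proof -
    have g: "((\<lambda>x. x * small_root x) has_real_derivative 1 * small_root x + small_root x * (1 - (small_root x + x)) / x * x) (at x)"
      by (rule DERIV_mult[OF DERIV_ident small_root_DERIV[OF that]])
    have "((\<lambda>x. x * (1 + flat_speed \<theta>) - x\<^sup>2 / 2) has_real_derivative (1 + flat_speed \<theta>) - x) (at x)"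
      by (auto intro!: derivative_eq_intros)
    from DERIV_diff[OF this g]
    have "(f has_real_derivative (1 + flat_speed \<theta>) - x - (1 * small_root x + small_root x * (1 - (small_root x + x)) / x * x)) (at x)"
      unfolding f_def[abs_def] flat_cgf_def[abs_def] by (simp add: algebra_simps)
    moreover have "(1 + flat_speed \<theta>) - x - (1 * small_root x + small_root x * (1 - (small_root x + x)) / x * x) = flat_speed \<theta> - flat_speed x"
      using that by (simp add: flat_speed_def field_simps)
    ultimately show ?thesis by (simp only:)
  qed
  have C: "continuous_on {0<..} f"
    by (intro continuous_at_imp_continuous_on ballI) (metis DERIV_isCont D greaterThan_iff)
  have "f \<theta>' < f \<theta>"
  proof (cases "\<theta>' < \<theta>")
    case True
    show ?thesis
    proof (rule DERIV_pos_imp_increasing_open[OF True])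
      show "continuous_on {\<theta>'..\<theta>} f" by (rule continuous_on_subset[OF C]) (use assms in auto)
      fix x assume x: "\<theta>' < x" "x < \<theta>"
      then show "\<exists>l. DERIV f x :> l \<and> l > 0"
        using D[of x] flat_speed_strict_mono[of x \<theta>] assms by auto
    qed
  next
    case False
    then have l: "\<theta> < \<theta>'" using assms by auto
    show ?thesis
    proof (rule DERIV_neg_imp_decreasing_open[OF l])
      show "continuous_on {\<theta>..\<theta>'} f" by (rule continuous_on_subset[OF C]) (use assms in auto)
      fix x assume x: "\<theta> < x" "x < \<theta>'"
      then show "\<exists>l. DERIV f x :> l \<and> l < 0"
        using D[of x] flat_speed_strict_mono[of \<theta> x] assms by auto
    qed
  qed
  then show ?thesis by (simp add: f_def)
qed

text \<open>By \<open>ex_small_root\<close> every z < -1 comes from some parameter x > 0, so the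
  maximum and the critical point can both be found in the variable x.\<close>

lemma flat_rate_eq:
  assumes "\<theta> > 0" "flat_speed \<theta> = a"
  shows "r_flat a = \<theta> * (1 + a) - flat_cgf \<theta>"
    and "\<exists>za\<in>{..<-1}.
            (za + 1) * (phi za + 1) + a = 0 \<and>
            (\<forall>z\<in>{..<-1}. (z + 1) * (phi z + 1) + a = 0 \<longrightarrow> z = za) \<and>
            r_flat a = flat_objective a za \<and>
            (\<forall>z\<in>{..<-1}. flat_objective a z \<le> flat_objective a za)"
proof -
  let ?z = "- (small_root \<theta> + \<theta>)"
  have z: "?z \<in> {..<-1}" using small_root_plus_gt_1[OF assms(1)] by simp
  have crit: "(- (small_root x + x) + 1) * (phi (- (small_root x + x)) + 1) = - flat_speed x" if "x > 0" for x
    using phi_small_root[OF that] by (simp add: flat_speed_def algebra_simps)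
  have max: "flat_objective a z \<le> flat_objective a ?z" if zz: "z \<in> {..<-1}" for z
  proof -
    obtain x where x: "x > 0" "z = - (small_root x + x)" using ex_small_root[of z] zz by auto
    then show ?thesis
      using objective_strict_max[of \<theta> x] assms flat_objective_small_root[of x a] flat_objective_small_root[of \<theta> a]
      by (cases "x = \<theta>") auto
  qed
  have r: "r_flat a = flat_objective a ?z" unfolding r_flat_def
    by (rule cSup_eq_maximum) (use z max in auto)
  then show "r_flat a = \<theta> * (1 + a) - flat_cgf \<theta>" using flat_objective_small_root[OF assms(1)] by simp
  have uniq: "z = ?z" if zz: "z \<in> {..<-1}" and "(z + 1) * (phi z + 1) + a = 0" for z
  proof -
    obtain x where x: "x > 0" "z = - (small_root x + x)" using ex_small_root[of z] zz by auto
    then have "flat_speed x = flat_speed \<theta>" using \<open>(z + 1) * (phi z + 1) + a = 0\<close> crit[of x] assms by simp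
    then have "x = \<theta>" using flat_speed_strict_mono[of x \<theta>] flat_speed_strict_mono[of \<theta> x] x assms
      by (cases x \<theta> rule: linorder_cases) auto
    then show ?thesis using x by simp
  qed
  show "\<exists>za\<in>{..<-1}.
            (za + 1) * (phi za + 1) + a = 0 \<and>
            (\<forall>z\<in>{..<-1}. (z + 1) * (phi z + 1) + a = 0 \<longrightarrow> z = za) \<and>
            r_flat a = flat_objective a za \<and>
            (\<forall>z\<in>{..<-1}. flat_objective a z \<le> flat_objective a za)"
    using crit[OF assms(1)] assms(2) uniq r max by (intro bexI[OF _ z] conjI ballI impI) simp_all
qed

section \<open>Sub-invariance of the exponential measure\<close>

abbreviation state_space :: "(nat \<Rightarrow> real) measure" where "state_space \<equiv> PiM UNIV (\<lambda>_. borel)"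

text \<open>When labels move in increasing order, \<open>y (i - 1)\<close> is already the new
  position of the label below. The parameter e is the enforced gap; e = 0 is ordinary
  reflection.\<close>

definition reflect_at :: "real \<Rightarrow> nat \<Rightarrow> (nat \<Rightarrow> real) \<Rightarrow> real \<Rightarrow> nat \<Rightarrow> real" where
  "reflect_at e i y w = y(i := if i = 0 then y 0 + w else max (y (i - 1) + e) (y i + w))"

text \<open>An expectation over independent steps when p has mass 1. Allowing other masses admits
  truncated densities.\<close>

primrec sweep :: "(real \<Rightarrow> ennreal) \<Rightarrow> real \<Rightarrow> nat list \<Rightarrow> ((nat \<Rightarrow> real) \<Rightarrow> ennreal) \<Rightarrow> (nat \<Rightarrow> real) \<Rightarrow> ennreal" where
  "sweep p e [] \<phi> y = \<phi> y"
| "sweep p e (i # is) \<phi> y = (\<integral>\<^sup>+w. p w * sweep p e is \<phi> (reflect_at e i y w) \<partial>lborel)"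

text \<open>The recursion peels off the lowest free coordinate because the comparison climbs the
  labels from below.\<close>

primrec ord_int :: "real \<Rightarrow> nat \<Rightarrow> nat \<Rightarrow> ((nat \<Rightarrow> real) \<Rightarrow> ennreal) \<Rightarrow> (nat \<Rightarrow> real) \<Rightarrow> ennreal" where
  "ord_int u 0 k \<phi> y = ennreal (exp (- u * y k)) * \<phi> y"
| "ord_int u (Suc m) k \<phi> y = (\<integral>\<^sup>+z. indicator {y k..} z * ord_int u m (Suc k) \<phi> (y(Suc k := z)) \<partial>lborel)"

text \<open>Coordinate \<open>0\<close> is held fixed, so that test functions may contain a compact window in it.\<close>
definition incr_off_0 :: "((nat \<Rightarrow> real) \<Rightarrow> ennreal) \<Rightarrow> bool" where
  "incr_off_0 \<phi> \<longleftrightarrow> (\<forall>y y'. y 0 = y' 0 \<longrightarrow> (\<forall>i. y i \<le> y' i) \<longrightarrow> \<phi> y \<le> \<phi> y')"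

lemma measurable_reflect_at [measurable]:
  assumes [measurable]: "f \<in> measurable M state_space" "g \<in> borel_measurable M"
  shows "(\<lambda>x. reflect_at e i (f x) (g x)) \<in> measurable M state_space"
  unfolding reflect_at_def
  by (rule measurable_fun_upd[where J=UNIV]) (auto intro: assms)

lemma measurable_state_upd [measurable]:
  assumes [measurable]: "f \<in> measurable M state_space" "g \<in> borel_measurable M"
  shows "(\<lambda>x. (f x)(i := g x)) \<in> measurable M state_space"
  by (rule measurable_fun_upd[where J=UNIV]) (auto intro: assms)

lemma measurable_coord [measurable]:
  assumes [measurable]: "f \<in> measurable M state_space" shows "(\<lambda>x. f x i) \<in> borel_measurable M"
  by (rule measurable_compose[OF assms]) simp

lemma measurable_const_state [measurable]: "(\<lambda>_. y) \<in> measurable M state_space"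
  by (rule measurable_const) (simp add: space_PiM)

lemma measurable_const_state_upd [measurable]:
  "g \<in> borel_measurable M \<Longrightarrow> (\<lambda>x. y(i := g x)) \<in> measurable M state_space"
  by (rule measurable_state_upd[OF measurable_const_state])

lemma pred_atLeast [measurable]:
  fixes f g :: "_ \<Rightarrow> real"
  assumes [measurable]: "f \<in> borel_measurable M" "g \<in> borel_measurable M"
  shows "Measurable.pred M (\<lambda>x. g x \<in> {f x..})" "Measurable.pred M (\<lambda>x. g x \<in> {..f x})" by simp_all

lemma borel_measurable_sweep:
  assumes [measurable]: "p \<in> borel_measurable borel" "\<phi> \<in> borel_measurable state_space"
  shows "sweep p e is \<phi> \<in> borel_measurable state_space"
proof (induction "is")
  case (Cons i "is")
  note Cons[measurable]
  show ?case unfolding sweep.simps by measurable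
qed simp

lemma borel_measurable_ord_int:
  assumes [measurable]: "\<phi> \<in> borel_measurable state_space"
  shows "ord_int u m k \<phi> \<in> borel_measurable state_space"
proof (induction m arbitrary: k)
  case 0
  show ?case unfolding ord_int.simps by measurable
next
  case (Suc m)
  note Suc[measurable]
  show ?case unfolding ord_int.simps by measurable
qed

text \<open>A reflected position is a maximum of increasing functions, and two configurations with
  equal coordinate 0 keep it equal because the step is the same.\<close>

lemma incr_off_0_sweep: assumes "incr_off_0 \<phi>" shows "incr_off_0 (sweep p e is \<phi>)"
proof (induction "is")
  case Nil then show ?case using assms by (simp add: incr_off_0_def)
next
  case (Cons i "is")
  show ?case unfolding incr_off_0_def
  proof safe
    fix y y' :: "nat \<Rightarrow> real" assume y: "y 0 = y' 0" "\<forall>i. y i \<le> y' i"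
    have "reflect_at e i y w j \<le> reflect_at e i y' w j" "reflect_at e i y w 0 = reflect_at e i y' w 0" for w j
      using y by (auto simp: reflect_at_def max_def intro: add_mono order_trans)
         (smt (verit))+
    then show "sweep p e (i # is) \<phi> y \<le> sweep p e (i # is) \<phi> y'"
      using Cons unfolding incr_off_0_def sweep.simps
      by (intro nn_integral_mono mult_left_mono) auto
  qed
qed

text \<open>The integral sees only ordered configurations above level k. This is how the ordering
  required by \<open>chain_ge_path_max\<close> becomes available.\<close>

lemma ord_int_mono:
  assumes "\<And>y'. \<lbrakk>\<And>i. i \<le> k \<Longrightarrow> y' i = y i; \<And>i. k \<le> i \<Longrightarrow> i < k + m \<Longrightarrow> y' i \<le> y' (Suc i)\<rbrakk> \<Longrightarrow> f y' \<le> g y'"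
  shows "ord_int u m k f y \<le> ord_int u m k g y"
  using assms
proof (induction m arbitrary: k y)
  case 0
  then show ?case by (simp add: mult_left_mono)
next
  case (Suc m)
  show ?case unfolding ord_int.simps
  proof (intro nn_integral_mono)
    fix z
    show "indicator {y k..} z * ord_int u m (Suc k) f (y(Suc k := z)) \<le> indicator {y k..} z * ord_int u m (Suc k) g (y(Suc k := z))"
    proof (cases "y k \<le> z")
      case True
      have "ord_int u m (Suc k) f (y(Suc k := z)) \<le> ord_int u m (Suc k) g (y(Suc k := z))"
      proof (rule Suc.IH)
        fix y' assume *: "\<And>i. i \<le> Suc k \<Longrightarrow> y' i = (y(Suc k := z)) i"
            "\<And>i. Suc k \<le> i \<Longrightarrow> i < Suc k + m \<Longrightarrow> y' i \<le> y' (Suc i)"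
        show "f y' \<le> g y'"
        proof (rule Suc.prems)
          fix i assume "k \<le> i" "i < k + Suc m"
          then show "y' i \<le> y' (Suc i)" using True *(1)[of k] *(1)[of "Suc k"] *(2)[of i]
            by (cases "i = k") auto
        qed (use *(1) in auto)
      qed
      then show ?thesis by (simp add: mult_left_mono)
    qed simp
  qed
qed

text \<open>Changing y k would change the domain of integration or the weight. With y k fixed, the
  lower coordinates act only through f.\<close>

lemma ord_int_incr:
  assumes "incr_off_0 f" "0 < k" "y 0 = y' 0" "y k = y' k" "\<And>i. y i \<le> y' i"
  shows "ord_int u m k f y \<le> ord_int u m k f y'"
  using assms(2-)
proof (induction m arbitrary: k y y')
  case 0
  then show ?case using assms(1) by (auto simp: incr_off_0_def intro!: mult_left_mono)
next
  case (Suc m)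
  have "ord_int u m (Suc k) f (y(Suc k := z)) \<le> ord_int u m (Suc k) f (y'(Suc k := z))" for z
    by (rule Suc.IH) (use Suc.prems in auto)
  then show ?case using Suc.prems by (auto intro!: nn_integral_mono mult_left_mono)
qed

text \<open>Moving a label j < k changes neither the lower limit y k nor the integrated coordinates,
  so Tonelli exchanges the two integrals.\<close>

lemma ord_int_reflect_at:
  assumes [measurable]: "p \<in> borel_measurable borel" "G \<in> borel_measurable state_space" and "j < k"
  shows "ord_int u m k (\<lambda>y. \<integral>\<^sup>+w. p w * G (reflect_at e j y w) \<partial>lborel) y
       = (\<integral>\<^sup>+w. p w * ord_int u m k G (reflect_at e j y w) \<partial>lborel)"
  using assms(3)
proof (induction m arbitrary: k y)
  case 0
  have "reflect_at e j y w k = y k" for w using 0 by (simp add: reflect_at_def)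
  then have "ord_int u 0 k (\<lambda>y. \<integral>\<^sup>+w. p w * G (reflect_at e j y w) \<partial>lborel) y
     = (\<integral>\<^sup>+w. ennreal (exp (- u * y k)) * (p w * G (reflect_at e j y w)) \<partial>lborel)"
    by (subst nn_integral_cmult) simp_all
  then show ?case using \<open>\<And>w. reflect_at e j y w k = y k\<close> by (simp add: mult.left_commute)
next
  case (Suc m)
  note borel_measurable_ord_int[measurable]
  have up: "reflect_at e j (y(Suc k := z)) w = (reflect_at e j y w)(Suc k := z)" for z w
    using Suc.prems by (auto simp: reflect_at_def fun_eq_iff)
  have k: "reflect_at e j y w k = y k" for w using Suc.prems by (simp add: reflect_at_def)
  have "ord_int u (Suc m) k (\<lambda>y. \<integral>\<^sup>+w. p w * G (reflect_at e j y w) \<partial>lborel) y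
     = (\<integral>\<^sup>+z. indicator {y k..} z * (\<integral>\<^sup>+w. p w * ord_int u m (Suc k) G ((reflect_at e j y w)(Suc k := z)) \<partial>lborel) \<partial>lborel)"
    using Suc.prems by (simp only: ord_int.simps Suc.IH up less_SucI)
  also have "\<dots> = (\<integral>\<^sup>+z. \<integral>\<^sup>+w. indicator {y k..} z * (p w * ord_int u m (Suc k) G ((reflect_at e j y w)(Suc k := z))) \<partial>lborel \<partial>lborel)"
    by (subst nn_integral_cmult) simp_all
  also have "\<dots> = (\<integral>\<^sup>+w. \<integral>\<^sup>+z. indicator {y k..} z * (p w * ord_int u m (Suc k) G ((reflect_at e j y w)(Suc k := z))) \<partial>lborel \<partial>lborel)"
    by (rule lborel_pair.Fubini') simp
  also have "\<dots> = (\<integral>\<^sup>+w. p w * ord_int u (Suc m) k G (reflect_at e j y w) \<partial>lborel)"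
  proof (rule nn_integral_cong)
    fix w
    have "(\<integral>\<^sup>+z. indicator {y k..} z * (p w * ord_int u m (Suc k) G ((reflect_at e j y w)(Suc k := z))) \<partial>lborel)
      = (\<integral>\<^sup>+z. p w * (indicator {y k..} z * ord_int u m (Suc k) G ((reflect_at e j y w)(Suc k := z))) \<partial>lborel)"
      by (simp only: mult.left_commute)
    also have "\<dots> = p w * (\<integral>\<^sup>+z. indicator {y k..} z * ord_int u m (Suc k) G ((reflect_at e j y w)(Suc k := z)) \<partial>lborel)"
      by (rule nn_integral_cmult) simp
    finally show "(\<integral>\<^sup>+z. indicator {y k..} z * (p w * ord_int u m (Suc k) G ((reflect_at e j y w)(Suc k := z))) \<partial>lborel)
      = p w * ord_int u (Suc m) k G (reflect_at e j y w)" by (simp only: ord_int.simps k)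
  qed
  finally show ?case .
qed

section \<open>The local comparison and its propagation along the labels\<close>

definition cone_int :: "real \<Rightarrow> nat \<Rightarrow> ((nat \<Rightarrow> real) \<Rightarrow> ennreal) \<Rightarrow> ennreal" where
  "cone_int u n \<phi> = (\<integral>\<^sup>+x. ord_int u n 0 \<phi> ((\<lambda>_. 0)(0 := x)) \<partial>lborel)"

definition mgf :: "(real \<Rightarrow> ennreal) \<Rightarrow> real \<Rightarrow> ennreal" where
  "mgf p u = (\<integral>\<^sup>+w. p w * ennreal (exp (u * w)) \<partial>lborel)"

text \<open>The relation \<open>R\<close> is \<open>\<le>\<close> or \<open>\<ge>\<close>, so that both bounds share one induction.\<close>
locale sweep_kernel =
  fixes R :: "ennreal \<Rightarrow> ennreal \<Rightarrow> bool" and p :: "real \<Rightarrow> ennreal" and e :: real and c :: ennreal and u :: real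
  assumes p [measurable]: "p \<in> borel_measurable borel"
    and R: "R = (\<le>) \<or> R = (\<lambda>x y. y \<le> x)"
    and loc: "\<And>\<psi> b x. mono \<psi> \<Longrightarrow> \<psi> \<in> borel_measurable borel \<Longrightarrow>
        R ((\<integral>\<^sup>+w. p w * indicator {b - x..} w \<partial>lborel) * (\<integral>\<^sup>+w. p w * \<psi> (max (b + e) (x + w)) \<partial>lborel))
          (c * (\<integral>\<^sup>+w. p w * (indicator {b..} (x + w) * \<psi> (x + w)) \<partial>lborel))"
begin

text \<open>In \<open>loc\<close>, x is the old position of a label and b the new position of the
  label below. The left side reflects the step at b and the right side restricts it to stay above b;
  the tail mass at b - x is the normalisation that turns restricting into conditioning.\<close>

definition tail_mass :: "real \<Rightarrow> ennreal" where "tail_mass s = (\<integral>\<^sup>+w. p w * indicator {s..} w \<partial>lborel)"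

lemma tail_mass_measurable [measurable]: "tail_mass \<in> borel_measurable borel"
proof -
  have "tail_mass = (\<lambda>s. \<integral>\<^sup>+w. p w * indicator {x. snd x \<ge> fst x} (s, w) \<partial>lborel)"
    unfolding tail_mass_def by (auto simp: fun_eq_iff indicator_def intro!: nn_integral_cong)
  also have "\<dots> \<in> borel_measurable borel" by measurable
  finally show ?thesis .
qed

lemma R_nn_integral: "(\<And>x. R (f x) (g x)) \<Longrightarrow> R (\<integral>\<^sup>+x. f x \<partial>M) (\<integral>\<^sup>+x. g x \<partial>M)"
  using R by (auto intro: nn_integral_mono)
lemma R_mult: "R a b \<Longrightarrow> R (k * a) (k * b)"
  using R by (auto intro: mult_left_mono)
lemma R_trans: "R a b \<Longrightarrow> R b d \<Longrightarrow> R a d"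
  using R by (auto intro: order_trans)

lemma shift:
  fixes w :: real
  assumes [measurable]: "f \<in> borel_measurable borel"
  shows "(\<integral>\<^sup>+x. f x \<partial>lborel) = (\<integral>\<^sup>+x. f (x - w) \<partial>lborel)"
  by (subst nn_integral_real_affine[of f 1 "-w"]) simp_all

text \<open>After label \<open>k\<close> has moved, its old position survives only through the constraint that it lay
  below the old position \<open>x\<close> of label \<open>k + 1\<close>, which contributes the weight \<open>tail_mass (y k - x)\<close>. With
  this weight, reflecting label \<open>k + 1\<close> at \<open>y k\<close> compares with conditioning its step to stay above
  \<open>y k\<close>, pointwise in \<open>x\<close>; the conditioned chain preserves the measure exactly.\<close>
lemma ord_int_sweep:
  assumes [measurable]: "\<phi> \<in> borel_measurable state_space" and inc: "incr_off_0 \<phi>"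
  shows "R (\<integral>\<^sup>+x. tail_mass (y k - x) * ord_int u m (Suc k) (sweep p e [Suc k..<Suc (Suc k) + m] \<phi>) (y(Suc k := x)) \<partial>lborel)
          (c ^ Suc m * mgf p u * ord_int u (Suc m) k \<phi> y)"
proof (induction m arbitrary: k y)
  case 0
  define \<psi> where "\<psi> z = \<phi> (y(Suc k := z))" for z
  have [measurable]: "\<psi> \<in> borel_measurable borel" unfolding \<psi>_def by measurable
  have mono: "mono \<psi>" using inc by (auto simp: incr_off_0_def mono_def \<psi>_def)
  have "(\<integral>\<^sup>+x. tail_mass (y k - x) * ord_int u 0 (Suc k) (sweep p e [Suc k..<Suc (Suc k) + 0] \<phi>) (y(Suc k := x)) \<partial>lborel)
      = (\<integral>\<^sup>+x. ennreal (exp (- u * x)) * (tail_mass (y k - x) * (\<integral>\<^sup>+w. p w * \<psi> (max (y k + e) (x + w)) \<partial>lborel)) \<partial>lborel)"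
    by (simp add: upt_rec reflect_at_def \<psi>_def mult.left_commute)
  moreover have "R \<dots> (\<integral>\<^sup>+x. ennreal (exp (- u * x)) * (c * (\<integral>\<^sup>+w. p w * (indicator {y k..} (x + w) * \<psi> (x + w)) \<partial>lborel)) \<partial>lborel)"
    unfolding tail_mass_def by (intro R_nn_integral R_mult loc mono) measurable
  moreover have "\<dots> = (\<integral>\<^sup>+x. c * (\<integral>\<^sup>+w. ennreal (exp (- u * x)) * (p w * (indicator {y k..} (x + w) * \<psi> (x + w))) \<partial>lborel) \<partial>lborel)"
    by (subst nn_integral_cmult) (simp_all add: mult.left_commute)
  moreover have "\<dots> = c * (\<integral>\<^sup>+x. \<integral>\<^sup>+w. ennreal (exp (- u * x)) * (p w * (indicator {y k..} (x + w) * \<psi> (x + w))) \<partial>lborel \<partial>lborel)"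
    by (subst nn_integral_cmult) simp_all
  moreover have "\<dots> = c * (\<integral>\<^sup>+w. \<integral>\<^sup>+x. ennreal (exp (- u * x)) * (p w * (indicator {y k..} (x + w) * \<psi> (x + w))) \<partial>lborel \<partial>lborel)"
    by (subst lborel_pair.Fubini') simp_all
  \<comment> \<open>In the new position x + w the exponential weight releases exp (u w), which
    integrates to \<open>mgf p u\<close>. This happens once per sweep, at the top label.\<close>
  moreover have "(\<integral>\<^sup>+x. ennreal (exp (- u * x)) * (p w * (indicator {y k..} (x + w) * \<psi> (x + w))) \<partial>lborel)
      = p w * ennreal (exp (u * w)) * (\<integral>\<^sup>+x. indicator {y k..} x * (ennreal (exp (- u * x)) * \<psi> x) \<partial>lborel)" for w
  proof -
    have "(\<integral>\<^sup>+x. ennreal (exp (- u * x)) * (p w * (indicator {y k..} (x + w) * \<psi> (x + w))) \<partial>lborel)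
       = (\<integral>\<^sup>+x. ennreal (exp (- u * (x - w))) * (p w * (indicator {y k..} x * \<psi> x)) \<partial>lborel)"
      by (subst shift[of _ w]) simp_all
    also have "\<dots> = (\<integral>\<^sup>+x. p w * ennreal (exp (u * w)) * (indicator {y k..} x * (ennreal (exp (- u * x)) * \<psi> x)) \<partial>lborel)"
    proof (rule nn_integral_cong)
      fix x
      have "ennreal (exp (- u * (x - w))) = ennreal (exp (u * w)) * ennreal (exp (- u * x))"
        by (simp add: algebra_simps flip: ennreal_mult exp_add)
      then show "ennreal (exp (- u * (x - w))) * (p w * (indicator {y k..} x * \<psi> x))
        = p w * ennreal (exp (u * w)) * (indicator {y k..} x * (ennreal (exp (- u * x)) * \<psi> x))"
        by (simp only: mult.left_commute mult.assoc)
    qed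
    also have "\<dots> = p w * ennreal (exp (u * w)) * (\<integral>\<^sup>+x. indicator {y k..} x * (ennreal (exp (- u * x)) * \<psi> x) \<partial>lborel)"
      by (rule nn_integral_cmult) simp
    finally show ?thesis .
  qed
  ultimately have "R (\<integral>\<^sup>+x. tail_mass (y k - x) * ord_int u 0 (Suc k) (sweep p e [Suc k..<Suc (Suc k) + 0] \<phi>) (y(Suc k := x)) \<partial>lborel)
     (c * (\<integral>\<^sup>+w. p w * ennreal (exp (u * w)) * (\<integral>\<^sup>+x. indicator {y k..} x * (ennreal (exp (- u * x)) * \<psi> x) \<partial>lborel) \<partial>lborel))"
    by simp
  moreover have "(\<integral>\<^sup>+w. p w * ennreal (exp (u * w)) * (\<integral>\<^sup>+x. indicator {y k..} x * (ennreal (exp (- u * x)) * \<psi> x) \<partial>lborel) \<partial>lborel)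
     = mgf p u * ord_int u (Suc 0) k \<phi> y"
    unfolding mgf_def by (subst nn_integral_multc) (simp_all add: \<psi>_def)
  ultimately show ?case by (simp only: power_Suc0_right mult.assoc One_nat_def)
next
  case (Suc m)
  note borel_measurable_ord_int[measurable] borel_measurable_sweep[measurable]
  define G where "G = sweep p e [Suc (Suc k)..<Suc (Suc (Suc k)) + m] \<phi>"
  have [measurable]: "G \<in> borel_measurable state_space" unfolding G_def by measurable
  have incG: "incr_off_0 G" unfolding G_def by (rule incr_off_0_sweep[OF inc])
  \<comment> \<open>All labels above, as a function of the new position z of label k + 1 and the old
    position x2 of label k + 2. Monotonicity in z is what the local comparison uses.\<close>
  define H where "H z x2 = ord_int u m (Suc (Suc k)) G (y(Suc k := z, Suc (Suc k) := x2))" for z x2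
  have [measurable]: "case_prod H \<in> borel_measurable (borel \<Otimes>\<^sub>M borel)" unfolding H_def by measurable
  have mono: "mono (\<lambda>z. H z x2)" for x2
    unfolding H_def mono_def by (auto intro!: ord_int_incr incG)
  let ?b = "y k"
  let ?Q = "\<lambda>x x2. \<integral>\<^sup>+w. p w * H (max (?b + e) (x + w)) x2 \<partial>lborel"
  have up: "[Suc k..<Suc (Suc k) + Suc m] = Suc k # [Suc (Suc k)..<Suc (Suc (Suc k)) + m]"
    by (simp add: upt_rec)
  have "(\<integral>\<^sup>+x. tail_mass (?b - x) * ord_int u (Suc m) (Suc k) (sweep p e [Suc k..<Suc (Suc k) + Suc m] \<phi>) (y(Suc k := x)) \<partial>lborel)
     = (\<integral>\<^sup>+x. tail_mass (?b - x) * (\<integral>\<^sup>+x2. indicator {x..} x2 * ?Q x x2 \<partial>lborel) \<partial>lborel)"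
  proof -
    have "ord_int u m (Suc (Suc k)) (sweep p e [Suc k..<Suc (Suc k) + Suc m] \<phi>) (y(Suc k := x, Suc (Suc k) := x2)) = ?Q x x2" for x x2
      unfolding up sweep.simps(2)[abs_def] G_def[symmetric]
      by (subst ord_int_reflect_at) (simp_all add: reflect_at_def H_def fun_upd_twist)
    then show ?thesis by simp
  qed
  also have "\<dots> = (\<integral>\<^sup>+x. \<integral>\<^sup>+x2. indicator {..x2} x * (tail_mass (?b - x) * ?Q x x2) \<partial>lborel \<partial>lborel)"
    by (intro nn_integral_cong, subst nn_integral_cmult[symmetric])
       (auto intro!: nn_integral_cong simp: indicator_def)
  also have "\<dots> = (\<integral>\<^sup>+x2. \<integral>\<^sup>+x. indicator {..x2} x * (tail_mass (?b - x) * ?Q x x2) \<partial>lborel \<partial>lborel)"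
    by (rule lborel_pair.Fubini') measurable
  finally have eq1: "(\<integral>\<^sup>+x. tail_mass (?b - x) * ord_int u (Suc m) (Suc k) (sweep p e [Suc k..<Suc (Suc k) + Suc m] \<phi>) (y(Suc k := x)) \<partial>lborel)
     = (\<integral>\<^sup>+x2. \<integral>\<^sup>+x. indicator {..x2} x * (tail_mass (?b - x) * ?Q x x2) \<partial>lborel \<partial>lborel)" .
  have R1: "R (\<integral>\<^sup>+x2. \<integral>\<^sup>+x. indicator {..x2} x * (tail_mass (?b - x) * ?Q x x2) \<partial>lborel \<partial>lborel)
     (\<integral>\<^sup>+x2. \<integral>\<^sup>+x. indicator {..x2} x * (c * (\<integral>\<^sup>+w. p w * (indicator {?b..} (x + w) * H (x + w) x2) \<partial>lborel)) \<partial>lborel \<partial>lborel)"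
    unfolding tail_mass_def by (intro R_nn_integral R_mult loc mono) measurable
  \<comment> \<open>In the new position z = x + w the old constraint x \<le> x2 reads w \<ge> z -
    x2. Integrating out w therefore reproduces the tail weight, one label higher.\<close>
  have inner: "(\<integral>\<^sup>+x. indicator {..x2} x * (c * (\<integral>\<^sup>+w. p w * (indicator {?b..} (x + w) * H (x + w) x2) \<partial>lborel)) \<partial>lborel)
     = c * (\<integral>\<^sup>+z. indicator {?b..} z * (tail_mass (z - x2) * H z x2) \<partial>lborel)" for x2
  proof -
    have "(\<integral>\<^sup>+x. indicator {..x2} x * (c * (\<integral>\<^sup>+w. p w * (indicator {?b..} (x + w) * H (x + w) x2) \<partial>lborel)) \<partial>lborel)
       = (\<integral>\<^sup>+x. c * (\<integral>\<^sup>+w. indicator {..x2} x * (p w * (indicator {?b..} (x + w) * H (x + w) x2)) \<partial>lborel) \<partial>lborel)"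
      by (intro nn_integral_cong, subst nn_integral_cmult) (simp_all add: mult.left_commute)
    also have "\<dots> = c * (\<integral>\<^sup>+x. (\<integral>\<^sup>+w. indicator {..x2} x * (p w * (indicator {?b..} (x + w) * H (x + w) x2)) \<partial>lborel) \<partial>lborel)"
      by (rule nn_integral_cmult) measurable
    also have "(\<integral>\<^sup>+x. (\<integral>\<^sup>+w. indicator {..x2} x * (p w * (indicator {?b..} (x + w) * H (x + w) x2)) \<partial>lborel) \<partial>lborel)
      = (\<integral>\<^sup>+w. (\<integral>\<^sup>+x. indicator {..x2} x * (p w * (indicator {?b..} (x + w) * H (x + w) x2)) \<partial>lborel) \<partial>lborel)"
      by (rule lborel_pair.Fubini'[symmetric]) measurable
    also have "\<dots> = (\<integral>\<^sup>+w. (\<integral>\<^sup>+z. indicator {..x2} (z - w) * (p w * (indicator {?b..} z * H z x2)) \<partial>lborel) \<partial>lborel)"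
    proof (rule nn_integral_cong)
      fix w
      show "(\<integral>\<^sup>+x. indicator {..x2} x * (p w * (indicator {?b..} (x + w) * H (x + w) x2)) \<partial>lborel)
         = (\<integral>\<^sup>+z. indicator {..x2} (z - w) * (p w * (indicator {?b..} z * H z x2)) \<partial>lborel)"
        by (subst shift[of _ w]) simp_all
    qed
    also have "\<dots> = (\<integral>\<^sup>+z. (\<integral>\<^sup>+w. indicator {..x2} (z - w) * (p w * (indicator {?b..} z * H z x2)) \<partial>lborel) \<partial>lborel)"
      by (rule lborel_pair.Fubini'[symmetric]) measurable
    also have "\<dots> = (\<integral>\<^sup>+z. indicator {?b..} z * (tail_mass (z - x2) * H z x2) \<partial>lborel)"
    proof (rule nn_integral_cong)
      fix z
      have "(\<integral>\<^sup>+w. indicator {..x2} (z - w) * (p w * (indicator {?b..} z * H z x2)) \<partial>lborel)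
        = (\<integral>\<^sup>+w. (p w * indicator {z - x2..} w) * (indicator {?b..} z * H z x2) \<partial>lborel)"
        by (intro nn_integral_cong) (auto simp: indicator_def)
      also have "\<dots> = tail_mass (z - x2) * (indicator {?b..} z * H z x2)"
        unfolding tail_mass_def by (rule nn_integral_multc) simp
      finally show "(\<integral>\<^sup>+w. indicator {..x2} (z - w) * (p w * (indicator {?b..} z * H z x2)) \<partial>lborel)
          = indicator {?b..} z * (tail_mass (z - x2) * H z x2)" by (simp add: mult.left_commute)
    qed
    finally show ?thesis .
  qed
  have "(\<integral>\<^sup>+x2. c * (\<integral>\<^sup>+z. indicator {?b..} z * (tail_mass (z - x2) * H z x2) \<partial>lborel) \<partial>lborel)
     = c * (\<integral>\<^sup>+x2. \<integral>\<^sup>+z. indicator {?b..} z * (tail_mass (z - x2) * H z x2) \<partial>lborel \<partial>lborel)"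
    by (rule nn_integral_cmult) measurable
  also have "(\<integral>\<^sup>+x2. \<integral>\<^sup>+z. indicator {?b..} z * (tail_mass (z - x2) * H z x2) \<partial>lborel \<partial>lborel)
      = (\<integral>\<^sup>+z. \<integral>\<^sup>+x2. indicator {?b..} z * (tail_mass (z - x2) * H z x2) \<partial>lborel \<partial>lborel)"
    by (rule lborel_pair.Fubini') measurable
  also have "\<dots> = (\<integral>\<^sup>+z. indicator {?b..} z * (\<integral>\<^sup>+x2. tail_mass (z - x2) * H z x2 \<partial>lborel) \<partial>lborel)"
  proof (rule nn_integral_cong)
    fix z
    have [measurable]: "H z \<in> borel_measurable borel" unfolding H_def by measurable
    show "(\<integral>\<^sup>+x2. indicator {?b..} z * (tail_mass (z - x2) * H z x2) \<partial>lborel)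
       = indicator {?b..} z * (\<integral>\<^sup>+x2. tail_mass (z - x2) * H z x2 \<partial>lborel)"
    proof (rule nn_integral_cmult)
      have "(\<lambda>x2. tail_mass (z - x2)) \<in> borel_measurable borel"
        by (rule measurable_compose[OF _ tail_mass_measurable]) simp
      then show "(\<lambda>x2. tail_mass (z - x2) * H z x2) \<in> borel_measurable lborel"
        using \<open>H z \<in> borel_measurable borel\<close> by simp
    qed
  qed
  finally have eq2: "(\<integral>\<^sup>+x2. c * (\<integral>\<^sup>+z. indicator {?b..} z * (tail_mass (z - x2) * H z x2) \<partial>lborel) \<partial>lborel)
     = c * (\<integral>\<^sup>+z. indicator {?b..} z * (\<integral>\<^sup>+x2. tail_mass (z - x2) * H z x2 \<partial>lborel) \<partial>lborel)" .
  have "R (\<integral>\<^sup>+x2. tail_mass (z - x2) * H z x2 \<partial>lborel)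
        (c ^ Suc m * mgf p u * ord_int u (Suc m) (Suc k) \<phi> (y(Suc k := z)))" for z
    using Suc[of "y(Suc k := z)" "Suc k"] unfolding H_def G_def fun_upd_same .
  then have "R (c * (\<integral>\<^sup>+z. indicator {?b..} z * (\<integral>\<^sup>+x2. tail_mass (z - x2) * H z x2 \<partial>lborel) \<partial>lborel))
     (c * (\<integral>\<^sup>+z. indicator {?b..} z * (c ^ Suc m * mgf p u * ord_int u (Suc m) (Suc k) \<phi> (y(Suc k := z))) \<partial>lborel))"
    by (intro R_mult R_nn_integral)
  moreover have "(\<integral>\<^sup>+z. indicator {?b..} z * (c ^ Suc m * mgf p u * ord_int u (Suc m) (Suc k) \<phi> (y(Suc k := z))) \<partial>lborel)
     = (\<integral>\<^sup>+z. (c ^ Suc m * mgf p u) * (indicator {?b..} z * ord_int u (Suc m) (Suc k) \<phi> (y(Suc k := z))) \<partial>lborel)"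
    by (simp only: mult.left_commute mult.assoc)
  moreover have "\<dots> = (c ^ Suc m * mgf p u) * ord_int u (Suc (Suc m)) k \<phi> y"
    unfolding ord_int.simps(2)[of u "Suc m"]
  proof (rule nn_integral_cmult)
    have "ord_int u (Suc m) (Suc k) \<phi> \<in> borel_measurable state_space" by (rule borel_measurable_ord_int) fact
    then have "(\<lambda>z. ord_int u (Suc m) (Suc k) \<phi> (y(Suc k := z))) \<in> borel_measurable borel"
      by (rule measurable_compose[rotated]) measurable
    then show "(\<lambda>z. indicator {?b..} z * ord_int u (Suc m) (Suc k) \<phi> (y(Suc k := z))) \<in> borel_measurable lborel"
      by simp
  qed
  ultimately have "R (c * (\<integral>\<^sup>+z. indicator {?b..} z * (\<integral>\<^sup>+x2. tail_mass (z - x2) * H z x2 \<partial>lborel) \<partial>lborel))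
      (c ^ Suc (Suc m) * mgf p u * ord_int u (Suc (Suc m)) k \<phi> y)"
    by (simp only: power_Suc mult.assoc)
  then show ?case
    unfolding eq1 by (rule R_trans[OF R1[unfolded inner eq2]])
qed

text \<open>Label 0 is never reflected, so translating its position is exact and creates the first
  tail weight, from which \<open>ord_int_sweep\<close> continues. The factor c arises once for each
  of the labels 1 to n.\<close>

lemma cone_int_sweep:
  assumes [measurable]: "\<phi> \<in> borel_measurable state_space" and inc: "incr_off_0 \<phi>" and n: "n > 0"
  shows "R (cone_int u n (sweep p e [0..<Suc n] \<phi>)) (c ^ n * mgf p u * cone_int u n \<phi>)"
proof -
  obtain m where m: "n = Suc m" using n by (cases n) auto
  note borel_measurable_ord_int[measurable] borel_measurable_sweep[measurable]
  define y :: "nat \<Rightarrow> real" where "y = (\<lambda>_. 0)"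
  define G where "G = sweep p e [Suc 0..<Suc (Suc 0) + m] \<phi>"
  have [measurable]: "G \<in> borel_measurable state_space" unfolding G_def by measurable
  define H where "H z x2 = ord_int u m (Suc 0) G (y(0 := z, Suc 0 := x2))" for z x2
  have [measurable]: "case_prod H \<in> borel_measurable (borel \<Otimes>\<^sub>M borel)" unfolding H_def by measurable
  have up: "[0..<Suc n] = 0 # [Suc 0..<Suc (Suc 0) + m]"
    by (simp add: m upt_rec)
  have "ord_int u m (Suc 0) (sweep p e [0..<Suc n] \<phi>) (y(0 := x, Suc 0 := x2)) = (\<integral>\<^sup>+w. p w * H (x + w) x2 \<partial>lborel)" for x x2
    unfolding up sweep.simps(2)[abs_def] G_def[symmetric]
    by (subst ord_int_reflect_at) (simp_all add: reflect_at_def H_def fun_upd_twist)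
  then have "cone_int u n (sweep p e [0..<Suc n] \<phi>)
     = (\<integral>\<^sup>+x. \<integral>\<^sup>+x2. indicator {x..} x2 * (\<integral>\<^sup>+w. p w * H (x + w) x2 \<partial>lborel) \<partial>lborel \<partial>lborel)"
    unfolding cone_int_def m ord_int.simps(2) y_def by simp
  also have "\<dots> = (\<integral>\<^sup>+x2. \<integral>\<^sup>+x. indicator {x..} x2 * (\<integral>\<^sup>+w. p w * H (x + w) x2 \<partial>lborel) \<partial>lborel \<partial>lborel)"
    by (rule lborel_pair.Fubini') measurable
  also have "\<dots> = (\<integral>\<^sup>+x2. \<integral>\<^sup>+b. tail_mass (b - x2) * H b x2 \<partial>lborel \<partial>lborel)"
  proof (rule nn_integral_cong)
    fix x2
    have Hm[measurable]: "(\<lambda>z. H z x2) \<in> borel_measurable borel" unfolding H_def by measurable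
    have "(\<integral>\<^sup>+x. indicator {x..} x2 * (\<integral>\<^sup>+w. p w * H (x + w) x2 \<partial>lborel) \<partial>lborel)
       = (\<integral>\<^sup>+x. \<integral>\<^sup>+w. indicator {..x2} x * (p w * H (x + w) x2) \<partial>lborel \<partial>lborel)"
      by (intro nn_integral_cong, subst nn_integral_cmult) (simp_all add: indicator_def)
    also have "\<dots> = (\<integral>\<^sup>+w. \<integral>\<^sup>+x. indicator {..x2} x * (p w * H (x + w) x2) \<partial>lborel \<partial>lborel)"
      by (rule lborel_pair.Fubini') simp
    also have "\<dots> = (\<integral>\<^sup>+w. \<integral>\<^sup>+b. indicator {..x2} (b - w) * (p w * H b x2) \<partial>lborel \<partial>lborel)"
    proof (rule nn_integral_cong)
      fix w
      show "(\<integral>\<^sup>+x. indicator {..x2} x * (p w * H (x + w) x2) \<partial>lborel)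
         = (\<integral>\<^sup>+b. indicator {..x2} (b - w) * (p w * H b x2) \<partial>lborel)"
        by (subst shift[of _ w]) simp_all
    qed
    also have "\<dots> = (\<integral>\<^sup>+b. \<integral>\<^sup>+w. indicator {..x2} (b - w) * (p w * H b x2) \<partial>lborel \<partial>lborel)"
      by (rule lborel_pair.Fubini') simp
    also have "\<dots> = (\<integral>\<^sup>+b. tail_mass (b - x2) * H b x2 \<partial>lborel)"
    proof (rule nn_integral_cong)
      fix b
      have "(\<integral>\<^sup>+w. indicator {..x2} (b - w) * (p w * H b x2) \<partial>lborel)
        = (\<integral>\<^sup>+w. (p w * indicator {b - x2..} w) * H b x2 \<partial>lborel)"
        by (intro nn_integral_cong) (auto simp: indicator_def)
      also have "\<dots> = tail_mass (b - x2) * H b x2"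
        unfolding tail_mass_def by (rule nn_integral_multc) simp
      finally show "(\<integral>\<^sup>+w. indicator {..x2} (b - w) * (p w * H b x2) \<partial>lborel) = tail_mass (b - x2) * H b x2" .
    qed
    finally show "(\<integral>\<^sup>+x. indicator {x..} x2 * (\<integral>\<^sup>+w. p w * H (x + w) x2 \<partial>lborel) \<partial>lborel)
       = (\<integral>\<^sup>+b. tail_mass (b - x2) * H b x2 \<partial>lborel)" .
  qed
  also have "\<dots> = (\<integral>\<^sup>+b. \<integral>\<^sup>+x2. tail_mass (b - x2) * H b x2 \<partial>lborel \<partial>lborel)"
    by (rule lborel_pair.Fubini') measurable
  finally have eq: "cone_int u n (sweep p e [0..<Suc n] \<phi>) = (\<integral>\<^sup>+b. \<integral>\<^sup>+x2. tail_mass (b - x2) * H b x2 \<partial>lborel \<partial>lborel)" .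
  have "R (\<integral>\<^sup>+x2. tail_mass (b - x2) * H b x2 \<partial>lborel) (c ^ n * mgf p u * ord_int u n 0 \<phi> (y(0 := b)))" for b
    using ord_int_sweep[of \<phi> "y(0 := b)" 0 m, OF _ inc] assms(1)
    unfolding H_def G_def m fun_upd_same by blast
  then have "R (\<integral>\<^sup>+b. \<integral>\<^sup>+x2. tail_mass (b - x2) * H b x2 \<partial>lborel \<partial>lborel)
      (\<integral>\<^sup>+b. c ^ n * mgf p u * ord_int u n 0 \<phi> (y(0 := b)) \<partial>lborel)"
    by (rule R_nn_integral)
  moreover have "(\<integral>\<^sup>+b. c ^ n * mgf p u * ord_int u n 0 \<phi> (y(0 := b)) \<partial>lborel) = c ^ n * mgf p u * cone_int u n \<phi>"
    unfolding cone_int_def y_def[symmetric]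
  proof (rule nn_integral_cmult)
    have "ord_int u n 0 \<phi> \<in> borel_measurable state_space" by (rule borel_measurable_ord_int) fact
    then have "(\<lambda>z. ord_int u n 0 \<phi> (y(0 := z))) \<in> borel_measurable borel"
      by (rule measurable_compose[rotated]) measurable
    then show "(\<lambda>z. ord_int u n 0 \<phi> (y(0 := z))) \<in> borel_measurable lborel" by simp
  qed
  ultimately show ?thesis unfolding eq by simp
qed

lemma sweep_append: "sweep p e (xs @ ys) \<phi> = sweep p e xs (sweep p e ys \<phi>)"
  by (induction xs) (auto simp: fun_eq_iff)

text \<open>The first sweep is compared with the remaining sweeps as its test function, which stays
  increasing by \<open>incr_off_0_sweep\<close>.\<close>

lemma cone_int_sweeps:
  assumes "\<phi> \<in> borel_measurable state_space" "incr_off_0 \<phi>" "n > 0"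
  shows "R (cone_int u n (sweep p e (concat (replicate N [0..<Suc n])) \<phi>)) ((c ^ n * mgf p u) ^ N * cone_int u n \<phi>)"
  using assms(1,2)
proof (induction N)
  case 0
  then show ?case using R by auto
next
  case (Suc N)
  let ?L = "concat (replicate N [0..<Suc n])"
  have 1: "R (cone_int u n (sweep p e [0..<Suc n] (sweep p e ?L \<phi>))) (c ^ n * mgf p u * cone_int u n (sweep p e ?L \<phi>))"
    by (intro cone_int_sweep borel_measurable_sweep incr_off_0_sweep p Suc.prems assms(3))
  have 2: "R (c ^ n * mgf p u * cone_int u n (sweep p e ?L \<phi>)) (c ^ n * mgf p u * ((c ^ n * mgf p u) ^ N * cone_int u n \<phi>))"
    by (intro R_mult Suc.IH Suc.prems)
  have "concat (replicate (Suc N) [0..<Suc n]) = [0..<Suc n] @ ?L" by simp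
  then show ?case using R_trans[OF 1 2] by (simp only: sweep_append power_Suc mult.assoc)
qed

end

text \<open>Reflection moves the mass B of the forbidden steps to b. The claim A (B \<psi>(b) + D)
  \<le> (A + B) D follows from A \<psi>(b) \<le> D, which holds because \<psi> is smallest at b
  among the allowed positions.\<close>

lemma sweep_kernel_le:
  assumes [measurable]: "p \<in> borel_measurable borel"
  shows "sweep_kernel (\<le>) p 0 (\<integral>\<^sup>+w. p w \<partial>lborel)"
proof
  fix \<psi> :: "real \<Rightarrow> ennreal" and b x :: real
  assume mono: "mono \<psi>" and [measurable]: "\<psi> \<in> borel_measurable borel"
  define A where "A = (\<integral>\<^sup>+w. p w * indicator {b - x..} w \<partial>lborel)"
  define B where "B = (\<integral>\<^sup>+w. p w * indicator {..<b - x} w \<partial>lborel)"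
  define D where "D = (\<integral>\<^sup>+w. p w * (indicator {b..} (x + w) * \<psi> (x + w)) \<partial>lborel)"
  have AB: "(\<integral>\<^sup>+w. p w \<partial>lborel) = A + B" unfolding A_def B_def
    by (subst nn_integral_add[symmetric]) (auto intro!: nn_integral_cong simp: indicator_def)
  have "(\<integral>\<^sup>+w. p w * \<psi> (max (b + 0) (x + w)) \<partial>lborel)
      = (\<integral>\<^sup>+w. p w * indicator {..<b - x} w * \<psi> b + p w * (indicator {b..} (x + w) * \<psi> (x + w)) \<partial>lborel)"
    by (intro nn_integral_cong) (auto simp: indicator_def max_def)
  also have "\<dots> = B * \<psi> b + D" unfolding B_def D_def
    by (subst nn_integral_add) (simp_all add: nn_integral_multc)
  finally have L: "(\<integral>\<^sup>+w. p w * \<psi> (max (b + 0) (x + w)) \<partial>lborel) = B * \<psi> b + D" .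
  have "A * \<psi> b = (\<integral>\<^sup>+w. p w * indicator {b - x..} w * \<psi> b \<partial>lborel)"
    unfolding A_def by (simp add: nn_integral_multc)
  also have "\<dots> \<le> D" unfolding D_def
    by (intro nn_integral_mono) (auto simp: indicator_def intro!: mult_left_mono monoD[OF mono])
  finally have "B * (A * \<psi> b) \<le> B * D" by (rule mult_left_mono) simp
  then show "(\<integral>\<^sup>+w. p w * indicator {b - x..} w \<partial>lborel) * (\<integral>\<^sup>+w. p w * \<psi> (max (b + 0) (x + w)) \<partial>lborel)
          \<le> (\<integral>\<^sup>+w. p w \<partial>lborel) * (\<integral>\<^sup>+w. p w * (indicator {b..} (x + w) * \<psi> (x + w)) \<partial>lborel)"
    unfolding L AB A_def[symmetric] D_def[symmetric]
    by (simp add: distrib_left distrib_right add.commute add_left_mono mult.left_commute)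
qed (use assms in auto)

text \<open>The extra gap \<open>e\<close> dominates every overshoot, because one step is at most \<open>e / 2\<close>.\<close>
lemma sweep_kernel_ge:
  assumes [measurable]: "p \<in> borel_measurable borel" and supp: "\<And>w. \<bar>w\<bar> > e / 2 \<Longrightarrow> p w = 0"
  shows "sweep_kernel (\<lambda>x y. y \<le> x) p e (\<integral>\<^sup>+w. p w \<partial>lborel)"
proof
  fix \<psi> :: "real \<Rightarrow> ennreal" and b x :: real
  assume mono: "mono \<psi>" and [measurable]: "\<psi> \<in> borel_measurable borel"
  define A where "A = (\<integral>\<^sup>+w. p w * indicator {b - x..} w \<partial>lborel)"
  define D where "D = (\<integral>\<^sup>+w. p w * (indicator {b..} (x + w) * \<psi> (x + w)) \<partial>lborel)"
  show "(\<integral>\<^sup>+w. p w \<partial>lborel) * (\<integral>\<^sup>+w. p w * (indicator {b..} (x + w) * \<psi> (x + w)) \<partial>lborel)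
     \<le> (\<integral>\<^sup>+w. p w * indicator {b - x..} w \<partial>lborel) * (\<integral>\<^sup>+w. p w * \<psi> (max (b + e) (x + w)) \<partial>lborel)"
  \<comment> \<open>Up to this threshold every step lands at or below b + e; beyond it no step falls
    below b.\<close>
  proof (cases "x \<le> b + e / 2")
    case True
    have "D \<le> (\<integral>\<^sup>+w. p w * indicator {b - x..} w * \<psi> (b + e) \<partial>lborel)" unfolding D_def
    proof (intro nn_integral_mono)
      fix w
      show "p w * (indicator {b..} (x + w) * \<psi> (x + w)) \<le> p w * indicator {b - x..} w * \<psi> (b + e)"
        using supp[of w] True
        by (cases "\<bar>w\<bar> > e / 2") (auto simp: indicator_def intro!: mult_left_mono monoD[OF mono])
    qed
    also have "\<dots> = A * \<psi> (b + e)" unfolding A_def by (simp add: nn_integral_multc)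
    finally have "(\<integral>\<^sup>+w. p w \<partial>lborel) * D \<le> (\<integral>\<^sup>+w. p w \<partial>lborel) * (A * \<psi> (b + e))"
      by (rule mult_left_mono) simp
    also have "\<dots> = A * (\<integral>\<^sup>+w. p w * \<psi> (b + e) \<partial>lborel)"
      by (simp add: nn_integral_multc mult.left_commute)
    also have "\<dots> \<le> A * (\<integral>\<^sup>+w. p w * \<psi> (max (b + e) (x + w)) \<partial>lborel)"
      by (intro mult_left_mono nn_integral_mono monoD[OF mono]) auto
    finally show ?thesis unfolding D_def A_def .
  next
    case False
    have "A = (\<integral>\<^sup>+w. p w \<partial>lborel)" unfolding A_def
    proof (intro nn_integral_cong)
      fix w show "p w * indicator {b - x..} w = p w"
        using supp[of w] False by (cases "\<bar>w\<bar> > e / 2") (auto simp: indicator_def)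
    qed
    moreover have "D \<le> (\<integral>\<^sup>+w. p w * \<psi> (max (b + e) (x + w)) \<partial>lborel)"
      unfolding D_def
      by (intro nn_integral_mono) (auto simp: indicator_def intro!: mult_left_mono monoD[OF mono])
    ultimately show ?thesis unfolding D_def A_def by (intro mult_mono) auto
  qed
qed (use assms in auto)

section \<open>The reflected chain as a last passage problem\<close>

primrec run :: "real \<Rightarrow> (nat \<times> nat) list \<Rightarrow> (nat \<times> nat \<Rightarrow> real) \<Rightarrow> (nat \<Rightarrow> real) \<Rightarrow> nat \<Rightarrow> real" where
  "run e [] \<omega> y = y"
| "run e (l # us) \<omega> y = run e us \<omega> (reflect_at e (fst l) y (\<omega> l))"

lemma run_append: "run e (us @ vs) \<omega> y = run e vs \<omega> (run e us \<omega> y)"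
  by (induction us arbitrary: y) auto

lemma run_cong: "(\<And>l. l \<in> set us \<Longrightarrow> \<omega> l = \<omega>' l) \<Longrightarrow> run e us \<omega> y = run e us \<omega>' y"
  by (induction us arbitrary: y) auto

lemma measurable_run:
  assumes "set us \<subseteq> J" "f \<in> measurable M state_space" "g \<in> measurable M (PiM J (\<lambda>_. borel))"
  shows "(\<lambda>x. run e us (g x) (f x)) \<in> measurable M state_space"
  using assms(1,2)
proof (induction us arbitrary: f)
  case (Cons l us)
  have "(\<lambda>x. g x l) \<in> borel_measurable M"
    by (rule measurable_compose[OF assms(3) measurable_component_singleton]) (use Cons.prems in auto)
  then show ?case unfolding run.simps using Cons.prems
    by (intro Cons.IH measurable_reflect_at) auto
qed simp

text \<open>Distinctness gives each move its own coordinate of the noise, so the first coordinate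
  can be integrated separately from the rest of the run.\<close>

lemma run_integral:
  assumes [measurable]: "p \<in> borel_measurable borel" "\<phi> \<in> borel_measurable state_space"
    and prob: "prob_space (density lborel p)" and "distinct us"
  shows "(\<integral>\<^sup>+\<omega>. \<phi> (run e us \<omega> y) \<partial>(PiM (set us) (\<lambda>_. density lborel p))) = sweep p e (map fst us) \<phi> y"
  using \<open>distinct us\<close>
proof (induction us arbitrary: y)
  case Nil
  show ?case by (simp add: PiM_empty nn_integral_count_space_finite)
next
  case (Cons l us)
  interpret product_sigma_finite "\<lambda>_::nat \<times> nat. density lborel p"
    by (rule product_sigma_finite.intro) (rule prob_space_imp_sigma_finite[OF prob])
  have s: "sets (density lborel p) = sets borel" by simp
  have PM: "measurable (PiM J (\<lambda>_. density lborel p)) N = measurable (PiM J (\<lambda>_. borel)) N" for J :: "(nat \<times> nat) set" and N :: "'b measure"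
    by (intro measurable_cong_sets sets_PiM_cong) auto
  have "(\<integral>\<^sup>+\<omega>. \<phi> (run e (l # us) \<omega> y) \<partial>(PiM (set (l # us)) (\<lambda>_. density lborel p)))
      = (\<integral>\<^sup>+w. (\<integral>\<^sup>+\<omega>. \<phi> (run e (l # us) (fun_upd \<omega> l w) y) \<partial>(PiM (set us) (\<lambda>_. density lborel p))) \<partial>(density lborel p))"
    unfolding list.set
  proof (rule product_nn_integral_insert_rev)
    show "(\<lambda>\<omega>. \<phi> (run e (l # us) \<omega> y)) \<in> borel_measurable (PiM (insert l (set us)) (\<lambda>_. density lborel p))"
      unfolding PM
      by (rule measurable_compose[OF measurable_run[of _ "insert l (set us)"]]) auto
  qed (use Cons.prems in auto)
  also have "\<dots> = (\<integral>\<^sup>+w. sweep p e (map fst us) \<phi> (reflect_at e (fst l) y w) \<partial>(density lborel p))"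
  proof (rule nn_integral_cong)
    fix w
    have "run e us (fun_upd \<omega> l w) y' = run e us \<omega> y'" for \<omega> y'
      by (rule run_cong) (use Cons.prems in auto)
    then show "(\<integral>\<^sup>+\<omega>. \<phi> (run e (l # us) (fun_upd \<omega> l w) y) \<partial>(PiM (set us) (\<lambda>_. density lborel p))) = sweep p e (map fst us) \<phi> (reflect_at e (fst l) y w)"
      using Cons by simp
  qed
  also have "\<dots> = (\<integral>\<^sup>+w. p w * sweep p e (map fst us) \<phi> (reflect_at e (fst l) y w) \<partial>lborel)"
  proof (rule nn_integral_density)
    show "(\<lambda>w. sweep p e (map fst us) \<phi> (reflect_at e (fst l) y w)) \<in> borel_measurable lborel"
      by (rule measurable_compose[OF _ borel_measurable_sweep[OF assms(1,2)]]) simp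
  qed simp
  finally show ?case by simp
qed

text \<open>Serves to return from truncated steps, for which the reverse comparison holds, to
  Gaussian ones.\<close>

lemma sweep_mono_kernel:
  assumes "\<And>w. p w \<le> q w"
  shows "sweep p e is \<phi> y \<le> sweep q e is \<phi> y"
  by (induction "is" arbitrary: y) (auto intro!: nn_integral_mono mult_mono assms)

section \<open>Discrete last passage values and the reflected chain\<close>

definition row_sum :: "(nat \<times> nat \<Rightarrow> real) \<Rightarrow> nat \<Rightarrow> nat \<Rightarrow> nat \<Rightarrow> real" where
  "row_sum \<omega> i a b = (\<Sum>l\<in>{a..<b}. \<omega> (i, l))"

text \<open>The last passage value through labels \<open>j, \<dots>, j + d\<close> up to step \<open>\<tau>\<close>; \<open>\<omega> (i, l)\<close> is the step of
  label \<open>i\<close> in time slot \<open>l\<close>.\<close>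
primrec path_max :: "(nat \<times> nat \<Rightarrow> real) \<Rightarrow> nat \<Rightarrow> nat \<Rightarrow> nat \<Rightarrow> real" where
  "path_max \<omega> j 0 \<tau> = row_sum \<omega> j 0 \<tau>"
| "path_max \<omega> j (Suc d) \<tau> = Max ((\<lambda>\<sigma>. path_max \<omega> j d \<sigma> + row_sum \<omega> (j + Suc d) \<sigma> \<tau>) ` {..\<tau>})"

lemma row_sum_Suc: "a \<le> b \<Longrightarrow> row_sum \<omega> i a (Suc b) = row_sum \<omega> i a b + \<omega> (i, b)"
  by (simp add: row_sum_def)

lemma path_max_ge: "\<sigma> \<le> \<tau> \<Longrightarrow> path_max \<omega> j d \<sigma> + row_sum \<omega> (j + Suc d) \<sigma> \<tau> \<le> path_max \<omega> j (Suc d) \<tau>"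
  by (simp add: Max_ge)

lemma path_max_le: "(\<And>\<sigma>. \<sigma> \<le> \<tau> \<Longrightarrow> path_max \<omega> j d \<sigma> + row_sum \<omega> (j + Suc d) \<sigma> \<tau> \<le> B) \<Longrightarrow> path_max \<omega> j (Suc d) \<tau> \<le> B"
  by (simp add: Max_le_iff)

declare path_max.simps(2)[simp del]

lemma path_max_attained: "\<exists>\<sigma>\<le>\<tau>. path_max \<omega> j (Suc d) \<tau> = path_max \<omega> j d \<sigma> + row_sum \<omega> (j + Suc d) \<sigma> \<tau>"
proof -
  have "path_max \<omega> j (Suc d) \<tau> \<in> (\<lambda>\<sigma>. path_max \<omega> j d \<sigma> + row_sum \<omega> (j + Suc d) \<sigma> \<tau>) ` {..\<tau>}"
    unfolding path_max.simps by (rule Max_in) auto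
  then show ?thesis by auto
qed

lemma path_max_Suc_label: "path_max \<omega> j d \<tau> \<le> path_max \<omega> j (Suc d) \<tau>"
  using path_max_ge[of \<tau> \<tau> \<omega> j d] by (simp add: row_sum_def)

lemma path_max_Suc_time: "path_max \<omega> j d \<tau> + \<omega> (j + d, \<tau>) \<le> path_max \<omega> j d (Suc \<tau>)"
proof (cases d)
  case (Suc d')
  obtain \<sigma> where s: "\<sigma> \<le> \<tau>" "path_max \<omega> j d \<tau> = path_max \<omega> j d' \<sigma> + row_sum \<omega> (j + d) \<sigma> \<tau>"
    using path_max_attained[of \<tau> \<omega> j d'] Suc by auto
  then show ?thesis using path_max_ge[of \<sigma> "Suc \<tau>" \<omega> j d'] Suc by (simp add: row_sum_Suc)
qed (simp add: row_sum_Suc)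

lemma path_max_cong:
  assumes "\<And>i l. j \<le> i \<Longrightarrow> i \<le> j + d \<Longrightarrow> l < \<tau> \<Longrightarrow> \<omega> (i, l) = \<omega>' (i, l)"
  shows "path_max \<omega> j d \<tau> = path_max \<omega>' j d \<tau>"
  using assms
proof (induction d arbitrary: \<tau>)
  case 0 then show ?case by (simp add: row_sum_def)
next
  case (Suc d)
  have "path_max \<omega> j d \<sigma> + row_sum \<omega> (j + Suc d) \<sigma> \<tau> = path_max \<omega>' j d \<sigma> + row_sum \<omega>' (j + Suc d) \<sigma> \<tau>" if "\<sigma> \<le> \<tau>" for \<sigma>
    using Suc.IH[of \<sigma>] Suc.prems that by (auto simp: row_sum_def intro!: arg_cong2[where f="(+)"] sum.cong)
  then show ?case unfolding path_max.simps by (intro arg_cong[where f=Max] image_cong) auto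
qed

lemma borel_measurable_path_max:
  assumes "\<And>i l. j \<le> i \<Longrightarrow> i \<le> j + d \<Longrightarrow> l < \<tau> \<Longrightarrow> (\<lambda>x. X x (i, l)) \<in> borel_measurable M"
  shows "(\<lambda>x. path_max (X x) j d \<tau>) \<in> borel_measurable M"
  using assms
proof (induction d arbitrary: \<tau>)
  case 0 then show ?case unfolding path_max.simps row_sum_def by (intro borel_measurable_sum) auto
next
  case (Suc d)
  show ?case unfolding path_max.simps
  proof (rule borel_measurable_Max)
    fix \<sigma> assume "\<sigma> \<in> {..\<tau>}"
    with Suc.prems show "(\<lambda>x. path_max (X x) j d \<sigma> + row_sum (X x) (j + Suc d) \<sigma> \<tau>) \<in> borel_measurable M"
      unfolding row_sum_def by (intro borel_measurable_add Suc.IH borel_measurable_sum) auto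
  qed auto
qed

fun chain :: "real \<Rightarrow> (nat \<times> nat \<Rightarrow> real) \<Rightarrow> (nat \<Rightarrow> real) \<Rightarrow> nat \<Rightarrow> nat \<Rightarrow> real" where
  "chain e \<omega> y i 0 = y i"
| "chain e \<omega> y 0 (Suc \<tau>) = chain e \<omega> y 0 \<tau> + \<omega> (0, \<tau>)"
| "chain e \<omega> y (Suc i) (Suc \<tau>) = max (chain e \<omega> y i (Suc \<tau>) + e) (chain e \<omega> y (Suc i) \<tau> + \<omega> (Suc i, \<tau>))"

definition schedule :: "nat \<Rightarrow> nat \<Rightarrow> (nat \<times> nat) list" where
  "schedule n N = concat (map (\<lambda>\<tau>. map (\<lambda>i. (i, \<tau>)) [0..<Suc n]) [0..<N])"

lemma set_schedule: "set (schedule n N) = {..n} \<times> {..<N}"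
  by (auto simp: schedule_def atLeast0LessThan simp del: upt_Suc)

lemma distinct_schedule: "distinct (schedule n N)"
proof (induction N)
  case (Suc N)
  have "schedule n (Suc N) = schedule n N @ map (\<lambda>i. (i, N)) [0..<Suc n]" by (simp add: schedule_def)
  then show ?case using Suc set_schedule[of n N] by (auto simp: distinct_map inj_on_def simp del: upt_Suc)
qed (simp add: schedule_def)

lemma map_fst_schedule: "map fst (schedule n N) = concat (replicate N [0..<Suc n])"
proof (induction N)
  case (Suc N)
  have "schedule n (Suc N) = schedule n N @ map (\<lambda>i. (i, N)) [0..<Suc n]" by (simp add: schedule_def)
  moreover have "concat (replicate (Suc N) xs) = concat (replicate N xs) @ xs" for xs :: "nat list"
    by (induction N) auto
  ultimately show ?case using Suc by (simp add: comp_def del: upt_Suc replicate.simps)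
qed (simp add: schedule_def)

text \<open>The invariant in the middle of a row: labels below k are already at the new time, the
  others still at the old one.\<close>

lemma run_row:
  assumes "\<And>i. i \<le> n \<Longrightarrow> y' i = chain e \<omega> y i \<tau>" "k \<le> Suc n"
  shows "run e (map (\<lambda>i. (i, \<tau>)) [0..<k]) \<omega> y' i = (if i < k then chain e \<omega> y i (Suc \<tau>) else y' i)"
  using assms(2)
proof (induction k arbitrary: i)
  case (Suc k)
  define z where "z = run e (map (\<lambda>i. (i, \<tau>)) [0..<k]) \<omega> y'"
  have IH: "z i = (if i < k then chain e \<omega> y i (Suc \<tau>) else y' i)" for i
    using Suc by (simp add: z_def)
  have "run e (map (\<lambda>i. (i, \<tau>)) [0..<Suc k]) \<omega> y' = reflect_at e k z (\<omega> (k, \<tau>))"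
    by (simp add: run_append z_def)
  then show ?case using Suc.prems assms(1)[of k]
    by (cases k) (auto simp: reflect_at_def IH)
qed simp

lemma run_schedule:
  assumes "i \<le> n" shows "run e (schedule n N) \<omega> y i = chain e \<omega> y i N"
  using assms
proof (induction N arbitrary: i)
  case 0 then show ?case by (simp add: schedule_def)
next
  case (Suc N)
  have "schedule n (Suc N) = schedule n N @ map (\<lambda>i. (i, N)) [0..<Suc n]" by (simp add: schedule_def)
  then show ?case using run_row[of n "run e (schedule n N) \<omega> y" e \<omega> y N "Suc n" i] Suc
    by (simp add: run_append del: upt_Suc)
qed

lemma chain_0: "chain e \<omega> y 0 \<tau> = y 0 + row_sum \<omega> 0 0 \<tau>"
  by (induction \<tau>) (auto simp: row_sum_def)

lemma chain_row:
  assumes "\<sigma> \<le> \<tau>" shows "chain e \<omega> y i \<sigma> + row_sum \<omega> i \<sigma> \<tau> \<le> chain e \<omega> y i \<tau>"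
  using assms
proof (induction \<tau> rule: dec_induct)
  case base then show ?case by (simp add: row_sum_def)
next
  case (step \<tau>)
  then show ?case by (cases i) (auto simp: row_sum_Suc)
qed

text \<open>The chain collects all steps along a label and stays ordered, so it dominates a path
  that changes to the next label at any time. The initial order covers a change at time 0.\<close>

lemma chain_ge_path_max:
  assumes "\<And>i. i < j + d \<Longrightarrow> y i \<le> y (Suc i)"
  shows "y j + path_max \<omega> j d \<tau> \<le> chain 0 \<omega> y (j + d) \<tau>"
  using assms
proof (induction d arbitrary: \<tau>)
  case 0 then show ?case using chain_row[of 0 \<tau> 0 \<omega> y j] by simp
next
  case (Suc d)
  have "path_max \<omega> j (Suc d) \<tau> \<le> chain 0 \<omega> y (j + Suc d) \<tau> - y j"
  proof (rule path_max_le)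
    fix \<sigma> assume s: "\<sigma> \<le> \<tau>"
    have "chain 0 \<omega> y (j + d) \<sigma> \<le> chain 0 \<omega> y (j + Suc d) \<sigma>" using Suc.prems by (cases \<sigma>) auto
    then show "path_max \<omega> j d \<sigma> + row_sum \<omega> (j + Suc d) \<sigma> \<tau> \<le> chain 0 \<omega> y (j + Suc d) \<tau> - y j"
      using Suc.IH[of \<sigma>] Suc.prems chain_row[OF s, of 0 \<omega> y "j + Suc d"] by simp
  qed
  then show ?case by simp
qed

text \<open>Trace the value back: a reflected value comes from the label below at the cost e, an
  unreflected one from the previous slot. The trace stops at the label where time 0 is reached; on
  label 0 the remainder is a plain sum.\<close>

lemma chain_le_path_max: "\<exists>j\<le>i. chain e \<omega> y i \<tau> \<le> y j + real (i - j) * e + path_max \<omega> j (i - j) \<tau>"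
proof (induction e \<omega> y i \<tau> rule: chain.induct)
  case (1 e \<omega> y i)
  then show ?case by (intro exI[of _ i]) (simp add: row_sum_def)
next
  case (2 e \<omega> y \<tau>)
  then show ?case unfolding chain_0 by (intro exI[of _ 0]) simp
next
  case (3 e \<omega> y i \<tau>)
  show ?case
  proof (cases "chain e \<omega> y i (Suc \<tau>) + e \<ge> chain e \<omega> y (Suc i) \<tau> + \<omega> (Suc i, \<tau>)")
    case True
    obtain j where j: "j \<le> i" "chain e \<omega> y i (Suc \<tau>) \<le> y j + real (i - j) * e + path_max \<omega> j (i - j) (Suc \<tau>)"
      using 3(1) by blast
    then show ?thesis using True path_max_Suc_label[of \<omega> j "i - j" "Suc \<tau>"]
      by (intro exI[of _ j]) (auto simp: Suc_diff_le algebra_simps )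
  next
    case False
    obtain j where j: "j \<le> Suc i" "chain e \<omega> y (Suc i) \<tau> \<le> y j + real (Suc i - j) * e + path_max \<omega> j (Suc i - j) \<tau>"
      using 3(2) by blast
    then show ?thesis using False path_max_Suc_time[of \<omega> j "Suc i - j" \<tau>]
      by (intro exI[of _ j]) (auto )
  qed
qed

section \<open>Closed forms of exponential integrals over the cone\<close>

lemma nn_integral_exp_tail:
  assumes "a > 0"
  shows "(\<integral>\<^sup>+z. indicator {b..} z * ennreal (exp (- a * z)) \<partial>lborel) = ennreal (exp (- a * b) / a)"
proof -
  have "(\<integral>\<^sup>+z. ennreal (exp (- a * z)) * indicator {b..} z \<partial>lborel) = ennreal (0 - (- (exp (- a * b) / a)))"
  proof (rule nn_integral_FTC_atLeast)
    have "((\<lambda>x. exp (- a * x)) \<longlongrightarrow> 0) at_top"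
      by (rule filterlim_compose[OF exp_at_bot],
          rule filterlim_tendsto_neg_mult_at_bot[OF tendsto_const _ filterlim_ident]) (use assms in simp)
    from tendsto_minus[OF tendsto_divide[OF this tendsto_const[of a]]]
    show "((\<lambda>x. - (exp (- a * x) / a)) \<longlongrightarrow> 0) at_top" using assms by simp
  qed (use assms in \<open>auto intro!: derivative_eq_intros\<close>)
  then show ?thesis by (simp add: mult.commute)
qed

lemma ord_int_cong:
  assumes "\<And>y'. \<lbrakk>\<And>i. i \<le> k \<Longrightarrow> y' i = y i; \<And>i. k \<le> i \<Longrightarrow> i < k + m \<Longrightarrow> y' i \<le> y' (Suc i)\<rbrakk> \<Longrightarrow> f y' = g y'"
  shows "ord_int u m k f y = ord_int u m k g y"
  by (intro antisym ord_int_mono) (auto simp: assms)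

lemma ord_int_const:
  assumes "u > 0" shows "ord_int u m k (\<lambda>_. C) y = C * ennreal (exp (- u * y k) / u ^ m)"
proof (induction m arbitrary: k y)
  case 0 then show ?case by (simp add: mult.commute)
next
  case (Suc m)
  have "ord_int u (Suc m) k (\<lambda>_. C) y = (\<integral>\<^sup>+z. C * ennreal (1 / u ^ m) * (indicator {y k..} z * ennreal (exp (- u * z))) \<partial>lborel)"
    unfolding ord_int.simps Suc fun_upd_same
  proof (rule nn_integral_cong)
    fix z
    have "ennreal (exp (- u * z) / u ^ m) = ennreal (1 / u ^ m) * ennreal (exp (- u * z))"
      using assms by (subst ennreal_mult[symmetric]) auto
    then show "indicator {y k..} z * (C * ennreal (exp (- u * z) / u ^ m)) = C * ennreal (1 / u ^ m) * (indicator {y k..} z * ennreal (exp (- u * z)))"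
      by (simp only: mult.assoc mult.left_commute)
  qed
  also have "\<dots> = C * ennreal (1 / u ^ m) * ennreal (exp (- u * y k) / u)"
    unfolding nn_integral_exp_tail[OF assms, symmetric] by (rule nn_integral_cmult) simp
  also have "\<dots> = C * ennreal (exp (- u * y k) / u ^ Suc m)"
    using assms by (simp add: mult.assoc mult.commute flip: ennreal_mult)
  finally show ?case .
qed

text \<open>The m labels above k + d integrate at rate u. The factor exp (\<theta> y) at label k + d
  lowers the rate to v for the d labels from there down to k + 1.\<close>

lemma ord_int_exp:
  assumes "u > 0" "v > 0" "\<theta> = u - v"
  shows "ord_int u (d + m) k (\<lambda>y. C * ennreal (exp (\<theta> * y (k + d)))) y = C * ennreal (exp (- v * y k) / (v ^ d * u ^ m))"
proof (induction d arbitrary: k y)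
  case 0
  have "ord_int u (0 + m) k (\<lambda>y. C * ennreal (exp (\<theta> * y (k + 0)))) y = ord_int u m k (\<lambda>_. C * ennreal (exp (\<theta> * y k))) y"
    unfolding add_0 add_0_right by (rule ord_int_cong) auto
  also have "\<dots> = C * (ennreal (exp (\<theta> * y k)) * ennreal (exp (- u * y k) / u ^ m))"
    unfolding ord_int_const[OF assms(1)] by (simp add: mult.assoc)
  also have "ennreal (exp (\<theta> * y k)) * ennreal (exp (- u * y k) / u ^ m) = ennreal (exp (- v * y k) / (v ^ 0 * u ^ m))"
    using assms by (simp add: flip: ennreal_mult exp_add) (simp add: algebra_simps)
  finally show ?case .
next
  case (Suc d)
  have "ord_int u (Suc d + m) k (\<lambda>y. C * ennreal (exp (\<theta> * y (k + Suc d)))) y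
     = (\<integral>\<^sup>+z. C * ennreal (1 / (v ^ d * u ^ m)) * (indicator {y k..} z * ennreal (exp (- v * z))) \<partial>lborel)"
    unfolding ord_int.simps add_Suc using Suc[of "Suc k"] unfolding add_Suc add_Suc_right
  proof (intro nn_integral_cong)
    fix z assume IH: "\<And>y. ord_int u (d + m) (Suc k) (\<lambda>y. C * ennreal (exp (\<theta> * y (Suc (k + d))))) y =
             C * ennreal (exp (- v * y (Suc k)) / (v ^ d * u ^ m))"
    have "ennreal (exp (- v * z) / (v ^ d * u ^ m)) = ennreal (1 / (v ^ d * u ^ m)) * ennreal (exp (- v * z))"
      using assms by (subst ennreal_mult[symmetric]) auto
    then show "indicator {y k..} z * ord_int u (d + m) (Suc k) (\<lambda>y. C * ennreal (exp (\<theta> * y (Suc (k + d))))) (y(Suc k := z))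
        = C * ennreal (1 / (v ^ d * u ^ m)) * (indicator {y k..} z * ennreal (exp (- v * z)))"
      unfolding IH fun_upd_same by (simp only: mult.assoc mult.left_commute)
  qed
  also have "\<dots> = C * ennreal (1 / (v ^ d * u ^ m)) * ennreal (exp (- v * y k) / v)"
    unfolding nn_integral_exp_tail[OF assms(2), symmetric] by (rule nn_integral_cmult) simp
  also have "\<dots> = C * ennreal (exp (- v * y k) / (v ^ Suc d * u ^ m))"
    using assms by (simp add: mult.assoc mult.commute mult.left_commute flip: ennreal_mult)
  finally show ?case .
qed

section \<open>Exponential moments of Gaussian last passage times\<close>

definition gauss :: "real \<Rightarrow> real \<Rightarrow> ennreal" where "gauss \<sigma> x = ennreal (normal_density 0 \<sigma> x)"

lemma gauss_measurable [measurable]: "gauss \<sigma> \<in> borel_measurable borel"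
  unfolding gauss_def[abs_def] by measurable

lemma prob_space_gauss: "\<sigma> > 0 \<Longrightarrow> prob_space (density lborel (gauss \<sigma>))"
  using prob_space_normal_density[of \<sigma> 0] by (simp add: gauss_def[abs_def])

lemma nn_integral_gauss: "\<sigma> > 0 \<Longrightarrow> (\<integral>\<^sup>+x. gauss \<sigma> x \<partial>lborel) = 1"
  unfolding gauss_def by (subst nn_integral_eq_integral) auto

text \<open>Completing the square: the tilted density is again normal, with mean u
  \<sigma>^2.\<close>

lemma mgf_gauss:
  assumes "\<sigma> > 0" shows "mgf (gauss \<sigma>) u = ennreal (exp (u\<^sup>2 * \<sigma>\<^sup>2 / 2))"
proof -
  have "normal_density 0 \<sigma> w * exp (u * w) = exp (u\<^sup>2 * \<sigma>\<^sup>2 / 2) * normal_density (u * \<sigma>\<^sup>2) \<sigma> w" for w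
  proof -
    have "- (w - 0)\<^sup>2 / (2 * \<sigma>\<^sup>2) + u * w = u\<^sup>2 * \<sigma>\<^sup>2 / 2 + - (w - u * \<sigma>\<^sup>2)\<^sup>2 / (2 * \<sigma>\<^sup>2)"
      using assms by (simp add: field_simps power2_eq_square)
    then have "exp (- (w - 0)\<^sup>2 / (2 * \<sigma>\<^sup>2)) * exp (u * w) = exp (u\<^sup>2 * \<sigma>\<^sup>2 / 2) * exp (- (w - u * \<sigma>\<^sup>2)\<^sup>2 / (2 * \<sigma>\<^sup>2))"
      by (simp only: exp_add[symmetric])
    then show ?thesis unfolding normal_density_def by (simp add: ac_simps)
  qed
  then have "mgf (gauss \<sigma>) u = (\<integral>\<^sup>+w. ennreal (exp (u\<^sup>2 * \<sigma>\<^sup>2 / 2)) * ennreal (normal_density (u * \<sigma>\<^sup>2) \<sigma> w) \<partial>lborel)"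
    unfolding mgf_def gauss_def by (simp flip: ennreal_mult)
  also have "\<dots> = ennreal (exp (u\<^sup>2 * \<sigma>\<^sup>2 / 2)) * (\<integral>\<^sup>+w. ennreal (normal_density (u * \<sigma>\<^sup>2) \<sigma> w) \<partial>lborel)"
    by (rule nn_integral_cmult) simp
  also have "(\<integral>\<^sup>+w. ennreal (normal_density (u * \<sigma>\<^sup>2) \<sigma> w) \<partial>lborel) = 1"
    using assms by (subst nn_integral_eq_integral) auto
  finally show ?thesis by simp
qed

lemma ord_int_sum:
  assumes "finite A" "\<And>j. j \<in> A \<Longrightarrow> f j \<in> borel_measurable state_space"
  shows "ord_int u m k (\<lambda>y. \<Sum>j\<in>A. f j y) y = (\<Sum>j\<in>A. ord_int u m k (f j) y)"
proof (induction m arbitrary: k y)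
  case 0 then show ?case by (simp add: sum_distrib_left)
next
  case (Suc m)
  have "(\<lambda>z. indicator {y k..} z * ord_int u m (Suc k) (f j) (y(Suc k := z))) \<in> borel_measurable lborel" if "j \<in> A" for j
  proof -
    have "ord_int u m (Suc k) (f j) \<in> borel_measurable state_space" by (rule borel_measurable_ord_int) (use assms that in auto)
    then have "(\<lambda>z. ord_int u m (Suc k) (f j) (y(Suc k := z))) \<in> borel_measurable borel"
      by (rule measurable_compose[rotated]) measurable
    then show ?thesis by simp
  qed
  then have "(\<integral>\<^sup>+z. (\<Sum>j\<in>A. indicator {y k..} z * ord_int u m (Suc k) (f j) (y(Suc k := z))) \<partial>lborel)
     = (\<Sum>j\<in>A. \<integral>\<^sup>+z. indicator {y k..} z * ord_int u m (Suc k) (f j) (y(Suc k := z)) \<partial>lborel)"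
    by (rule nn_integral_sum)
  then show ?case by (simp only: ord_int.simps Suc sum_distrib_left)
qed

lemma cone_int_sum:
  assumes "finite A" "\<And>j. j \<in> A \<Longrightarrow> f j \<in> borel_measurable state_space"
  shows "cone_int u n (\<lambda>y. \<Sum>j\<in>A. f j y) = (\<Sum>j\<in>A. cone_int u n (f j))"
proof -
  have "(\<lambda>x. ord_int u n 0 (f j) ((\<lambda>_. 0)(0 := x))) \<in> borel_measurable lborel" if "j \<in> A" for j
  proof -
    have "ord_int u n 0 (f j) \<in> borel_measurable state_space" by (rule borel_measurable_ord_int) (use assms that in auto)
    then have "(\<lambda>z. ord_int u n 0 (f j) ((\<lambda>_. 0)(0 := z))) \<in> borel_measurable borel"
      by (rule measurable_compose[rotated]) measurable
    then show ?thesis by simp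
  qed
  then have "(\<integral>\<^sup>+x. (\<Sum>j\<in>A. ord_int u n 0 (f j) ((\<lambda>_. 0)(0 := x))) \<partial>lborel) = (\<Sum>j\<in>A. cone_int u n (f j))"
    unfolding cone_int_def by (rule nn_integral_sum)
  moreover have "cone_int u n (\<lambda>y. \<Sum>j\<in>A. f j y) = (\<integral>\<^sup>+x. (\<Sum>j\<in>A. ord_int u n 0 (f j) ((\<lambda>_. 0)(0 := x))) \<partial>lborel)"
    unfolding cone_int_def by (rule nn_integral_cong, rule ord_int_sum) (use assms in auto)
  ultimately show ?thesis by simp
qed

lemma ord_int_cmult:
  assumes [measurable]: "f \<in> borel_measurable state_space"
  shows "ord_int u m k (\<lambda>y. C * f y) y = C * ord_int u m k f y"
proof (induction m arbitrary: k y)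
  case 0 then show ?case by (simp add: mult.left_commute)
next
  case (Suc m)
  have "ord_int u m (Suc k) f \<in> borel_measurable state_space" by (rule borel_measurable_ord_int) fact
  then have "(\<lambda>z. ord_int u m (Suc k) f (y(Suc k := z))) \<in> borel_measurable borel"
    by (rule measurable_compose[rotated]) measurable
  then have "(\<lambda>z. indicator {y k..} z * ord_int u m (Suc k) f (y(Suc k := z))) \<in> borel_measurable lborel" by simp
  from nn_integral_cmult[OF this, of C] show ?case
    by (simp only: ord_int.simps Suc mult.left_commute[of _ C])
qed

lemma cone_int_cmult:
  assumes [measurable]: "f \<in> borel_measurable state_space"
  shows "cone_int u n (\<lambda>y. C * f y) = C * cone_int u n f"
proof -
  have "ord_int u n 0 f \<in> borel_measurable state_space" by (rule borel_measurable_ord_int) fact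
  then have "(\<lambda>z. ord_int u n 0 f ((\<lambda>_. 0)(0 := z))) \<in> borel_measurable borel"
    by (rule measurable_compose[rotated]) measurable
  then show ?thesis unfolding cone_int_def ord_int_cmult[OF assms] by (intro nn_integral_cmult) simp
qed

lemma cone_int_mono:
  assumes "\<And>y. (\<And>i. i < n \<Longrightarrow> y i \<le> y (Suc i)) \<Longrightarrow> f y \<le> g y"
  shows "cone_int u n f \<le> cone_int u n g"
  unfolding cone_int_def by (intro nn_integral_mono ord_int_mono assms) simp

lemma cone_int_exp:
  assumes "u > 0" "v > 0" "\<theta> = u - v" "j \<le> n" and [measurable]: "g \<in> borel_measurable borel"
  shows "cone_int u n (\<lambda>y. g (y 0) * ennreal (exp (\<theta> * y j)))
     = (\<integral>\<^sup>+x. g x * ennreal (exp (- v * x)) \<partial>lborel) * ennreal (1 / (v ^ j * u ^ (n - j)))"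
proof -
  have "ord_int u n 0 (\<lambda>y. g (y 0) * ennreal (exp (\<theta> * y j))) ((\<lambda>_. 0)(0 := x))
      = g x * ennreal (exp (- v * x)) * ennreal (1 / (v ^ j * u ^ (n - j)))" for x
  proof -
    have "ord_int u n 0 (\<lambda>y. g (y 0) * ennreal (exp (\<theta> * y j))) ((\<lambda>_. 0)(0 := x))
       = ord_int u (j + (n - j)) 0 (\<lambda>y. g x * ennreal (exp (\<theta> * y (0 + j)))) ((\<lambda>_. 0)(0 := x))"
      using assms(4) by (simp only: add_0 le_add_diff_inverse) (rule ord_int_cong, simp)
    also have "\<dots> = g x * ennreal (exp (- v * x) / (v ^ j * u ^ (n - j)))"
      by (subst ord_int_exp[OF assms(1-3)]) simp
    also have "ennreal (exp (- v * x) / (v ^ j * u ^ (n - j))) = ennreal (exp (- v * x)) * ennreal (1 / (v ^ j * u ^ (n - j)))"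
      using assms by (subst ennreal_mult[symmetric]) auto
    finally show ?thesis by (simp only: mult.assoc)
  qed
  then show ?thesis unfolding cone_int_def by (simp add: nn_integral_multc)
qed

section \<open>Moments of passages, with the bottom label carrying the window\<close>

definition noise :: "real \<Rightarrow> nat \<Rightarrow> nat \<Rightarrow> (nat \<times> nat \<Rightarrow> real) measure" where
  "noise \<sigma> n N = PiM ({..n} \<times> {..<N}) (\<lambda>_. density lborel (gauss \<sigma>))"

lemma measurable_noise: "measurable (noise \<sigma> n N) L = measurable (PiM ({..n} \<times> {..<N}) (\<lambda>_. borel)) L"
  unfolding noise_def by (intro measurable_cong_sets sets_PiM_cong) auto

lemma prob_space_noise: "\<sigma> > 0 \<Longrightarrow> prob_space (noise \<sigma> n N)"
  unfolding noise_def by (intro prob_space_PiM prob_space_gauss)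

definition window_weight :: "real \<Rightarrow> ennreal" where "window_weight v = (\<integral>\<^sup>+x. indicator {0..1::real} x * ennreal (exp (- v * x)) \<partial>lborel)"

text \<open>Finite and nonzero, hence cancellable: the weight is a common factor of both sides of
  each comparison.\<close>

lemma window_weight: assumes "v > 0" shows "window_weight v \<noteq> 0" "window_weight v \<noteq> \<top>"
proof -
  have "(\<integral>\<^sup>+x. indicator {0..1::real} x * ennreal (exp (- v)) \<partial>lborel) \<le> window_weight v"
    unfolding window_weight_def using assms by (intro nn_integral_mono) (auto simp: indicator_def intro!: ennreal_leI)
  then show "window_weight v \<noteq> 0" by (auto simp: nn_integral_multc)
  have "window_weight v \<le> (\<integral>\<^sup>+x. indicator {0..1::real} x * 1 \<partial>lborel)"
    unfolding window_weight_def using assms by (intro nn_integral_mono) (auto simp: indicator_def)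
  then show "window_weight v \<noteq> \<top>" by (auto simp: nn_integral_multc top_unique)
qed

text \<open>A window on the final position x + S in place of the initial position x costs exactly
  the factor exp (v S), by translation.\<close>

lemma window_integral:
  assumes [measurable]: "h \<in> borel_measurable Q" "S \<in> borel_measurable Q" and "prob_space Q"
  shows "(\<integral>\<^sup>+x. (\<integral>\<^sup>+\<omega>. indicator {0..1::real} (x + S \<omega>) * h \<omega> \<partial>Q) * ennreal (exp (- v * x)) \<partial>lborel)
       = window_weight v * (\<integral>\<^sup>+\<omega>. ennreal (exp (v * S \<omega>)) * h \<omega> \<partial>Q)"
proof -
  interpret prob_space Q by fact
  interpret pair_sigma_finite Q "lborel :: real measure" ..
  have "(\<integral>\<^sup>+x. (\<integral>\<^sup>+\<omega>. indicator {0..1} (x + S \<omega>) * h \<omega> \<partial>Q) * ennreal (exp (- v * x)) \<partial>lborel)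
      = (\<integral>\<^sup>+x. (\<integral>\<^sup>+\<omega>. indicator {0..1} (x + S \<omega>) * h \<omega> * ennreal (exp (- v * x)) \<partial>Q) \<partial>lborel)"
    by (simp add: nn_integral_multc)
  also have "\<dots> = (\<integral>\<^sup>+\<omega>. (\<integral>\<^sup>+x. indicator {0..1} (x + S \<omega>) * h \<omega> * ennreal (exp (- v * x)) \<partial>lborel) \<partial>Q)"
    by (rule Fubini') measurable
  also have "\<dots> = (\<integral>\<^sup>+\<omega>. window_weight v * (ennreal (exp (v * S \<omega>)) * h \<omega>) \<partial>Q)"
  proof (rule nn_integral_cong)
    fix \<omega>
    have "(\<integral>\<^sup>+x. indicator {0..1} (x + S \<omega>) * h \<omega> * ennreal (exp (- v * x)) \<partial>lborel)
        = (\<integral>\<^sup>+x. indicator {0..1} x * h \<omega> * ennreal (exp (- v * (x - S \<omega>))) \<partial>lborel)"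
      by (subst nn_integral_real_affine[of _ 1 "- S \<omega>"]) simp_all
    also have "\<dots> = (\<integral>\<^sup>+x. (indicator {0..1} x * ennreal (exp (- v * x))) * (ennreal (exp (v * S \<omega>)) * h \<omega>) \<partial>lborel)"
    proof (rule nn_integral_cong)
      fix x
      have "ennreal (exp (- v * (x - S \<omega>))) = ennreal (exp (- v * x)) * ennreal (exp (v * S \<omega>))"
        by (simp add: algebra_simps flip: ennreal_mult exp_add)
      then show "indicator {0..1} x * h \<omega> * ennreal (exp (- v * (x - S \<omega>))) = (indicator {0..1} x * ennreal (exp (- v * x))) * (ennreal (exp (v * S \<omega>)) * h \<omega>)"
        by (simp only: mult_ac)
    qed
    also have "\<dots> = window_weight v * (ennreal (exp (v * S \<omega>)) * h \<omega>)"
      unfolding window_weight_def by (rule nn_integral_multc) simp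
    finally show "(\<integral>\<^sup>+x. indicator {0..1} (x + S \<omega>) * h \<omega> * ennreal (exp (- v * x)) \<partial>lborel) = window_weight v * (ennreal (exp (v * S \<omega>)) * h \<omega>)" .
  qed
  also have "\<dots> = window_weight v * (\<integral>\<^sup>+\<omega>. ennreal (exp (v * S \<omega>)) * h \<omega> \<partial>Q)"
    by (rule nn_integral_cmult) measurable
  finally show ?thesis .
qed

text \<open>Row 0 always enters through its total displacement, which the window tilts by v. For j =
  0 the passage uses row 0 as well, and the two factors are dependent.\<close>

definition mixed_mom :: "real \<Rightarrow> nat \<Rightarrow> nat \<Rightarrow> real \<Rightarrow> real \<Rightarrow> nat \<Rightarrow> ennreal" where
  "mixed_mom \<sigma> n N v \<theta> j = (\<integral>\<^sup>+\<omega>. ennreal (exp (v * row_sum \<omega> 0 0 N)) * ennreal (exp (\<theta> * path_max \<omega> j (n - j) N)) \<partial>noise \<sigma> n N)"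

lemma row_sum_noise_measurable: "(\<lambda>\<omega>. row_sum \<omega> 0 0 N) \<in> borel_measurable (noise \<sigma> n N)"
  unfolding measurable_noise row_sum_def by (intro borel_measurable_sum measurable_component_singleton) auto

lemma path_max_noise_measurable: "j \<le> n \<Longrightarrow> (\<lambda>\<omega>. path_max \<omega> j (n - j) N) \<in> borel_measurable (noise \<sigma> n N)"
  unfolding measurable_noise by (intro borel_measurable_path_max measurable_component_singleton) auto

lemma cone_int_mixed_moment:
  assumes "u > 0" "v > 0" "\<theta> = u - v" "j \<le> n" "\<sigma> > 0"
  shows "cone_int u n (\<lambda>y. (\<integral>\<^sup>+\<omega>. indicator {0..1} (y 0 + row_sum \<omega> 0 0 N) * ennreal (exp (\<theta> * path_max \<omega> j (n - j) N)) \<partial>noise \<sigma> n N)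
       * ennreal (exp (\<theta> * y j)))
     = window_weight v * mixed_mom \<sigma> n N v \<theta> j * ennreal (1 / (v ^ j * u ^ (n - j)))"
proof -
  note [measurable] = row_sum_noise_measurable path_max_noise_measurable[OF assms(4)]
  interpret prob_space "noise \<sigma> n N" by (rule prob_space_noise) fact
  have w: "(\<integral>\<^sup>+x. (\<integral>\<^sup>+\<omega>. indicator {0..1} (x + row_sum \<omega> 0 0 N) * ennreal (exp (\<theta> * path_max \<omega> j (n - j) N)) \<partial>noise \<sigma> n N)
      * ennreal (exp (- v * x)) \<partial>lborel) = window_weight v * mixed_mom \<sigma> n N v \<theta> j"
    unfolding mixed_mom_def by (rule window_integral[OF _ _ prob_space_axioms]) measurable
  show ?thesis unfolding w[symmetric] by (rule cone_int_exp[OF assms(1-4)]) measurable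
qed

lemma sweep_noise:
  assumes "\<sigma> > 0" "\<phi> \<in> borel_measurable state_space"
  shows "sweep (gauss \<sigma>) e (concat (replicate N [0..<Suc n])) \<phi> y
     = (\<integral>\<^sup>+\<omega>. \<phi> (run e (schedule n N) \<omega> y) \<partial>noise \<sigma> n N)"
  using run_integral[OF gauss_measurable assms(2) prob_space_gauss[OF assms(1)] distinct_schedule]
  by (simp only: map_fst_schedule noise_def set_schedule)

text \<open>Without the window the integral over coordinate 0 would diverge.\<close>

definition test_fun :: "real \<Rightarrow> nat \<Rightarrow> (nat \<Rightarrow> real) \<Rightarrow> ennreal" where
  "test_fun \<theta> n y = indicator {0..1} (y 0) * ennreal (exp (\<theta> * y n))"

lemma test_fun: "test_fun \<theta> n \<in> borel_measurable state_space" "0 < \<theta> \<Longrightarrow> incr_off_0 (test_fun \<theta> n)"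
  unfolding test_fun_def[abs_def] by (measurable, auto simp: incr_off_0_def intro!: mult_left_mono ennreal_leI)

lemma cone_int_test_fun:
  assumes "u > 0" "v > 0" "\<theta> = u - v"
  shows "cone_int u n (test_fun \<theta> n) = window_weight v * ennreal (1 / v ^ n)"
  unfolding test_fun_def[abs_def] by (subst cone_int_exp[OF assms]) (simp_all add: window_weight_def)

text \<open>The chain dominates the passage from label 1, and the closed forms evaluate both ends of
  the sub-invariance inequality. Starting at label 1 keeps the passage independent of row 0, so that
  \<open>row0_factor\<close> can later remove the tilt.\<close>

lemma mixed_mom_1_le:
  assumes "\<sigma> > 0" "v > 0" "u > v" "\<theta> = u - v" "n > 0"
  shows "mixed_mom \<sigma> n N v \<theta> 1 \<le> ennreal ((u / v) ^ (n - 1) * exp (real N * (u\<^sup>2 * \<sigma>\<^sup>2 / 2)))"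
proof -
  have u: "u > 0" using assms by simp
  interpret sweep_kernel "(\<le>)" "gauss \<sigma>" 0 1 u
    using sweep_kernel_le[OF gauss_measurable, of \<sigma>] unfolding nn_integral_gauss[OF assms(1)] .
  have "cone_int u n (sweep (gauss \<sigma>) 0 (concat (replicate N [0..<Suc n])) (test_fun \<theta> n)) \<le> (1 ^ n * mgf (gauss \<sigma>) u) ^ N * cone_int u n (test_fun \<theta> n)"
    by (rule cone_int_sweeps) (use assms test_fun in auto)
  moreover have "window_weight v * mixed_mom \<sigma> n N v \<theta> 1 * ennreal (1 / (v ^ 1 * u ^ (n - 1)))
     \<le> cone_int u n (sweep (gauss \<sigma>) 0 (concat (replicate N [0..<Suc n])) (test_fun \<theta> n))"
  proof (subst cone_int_mixed_moment[symmetric])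
    show "cone_int u n (\<lambda>y. (\<integral>\<^sup>+\<omega>. indicator {0..1} (y 0 + row_sum \<omega> 0 0 N) * ennreal (exp (\<theta> * path_max \<omega> 1 (n - 1) N)) \<partial>noise \<sigma> n N)
       * ennreal (exp (\<theta> * y 1))) \<le> cone_int u n (sweep (gauss \<sigma>) 0 (concat (replicate N [0..<Suc n])) (test_fun \<theta> n))"
    proof (rule cone_int_mono)
      fix y :: "nat \<Rightarrow> real" assume y: "\<And>i. i < n \<Longrightarrow> y i \<le> y (Suc i)"
      have [measurable]: "(\<lambda>\<omega>. path_max \<omega> 1 (n - 1) N) \<in> borel_measurable (noise \<sigma> n N)"
        "(\<lambda>\<omega>. row_sum \<omega> 0 0 N) \<in> borel_measurable (noise \<sigma> n N)"
        using \<open>n > 0\<close> by (auto intro!: path_max_noise_measurable row_sum_noise_measurable)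
      have "(\<integral>\<^sup>+\<omega>. indicator {0..1} (y 0 + row_sum \<omega> 0 0 N) * ennreal (exp (\<theta> * path_max \<omega> 1 (n - 1) N)) \<partial>noise \<sigma> n N) * ennreal (exp (\<theta> * y 1))
        = (\<integral>\<^sup>+\<omega>. indicator {0..1} (y 0 + row_sum \<omega> 0 0 N) * ennreal (exp (\<theta> * path_max \<omega> 1 (n - 1) N)) * ennreal (exp (\<theta> * y 1)) \<partial>noise \<sigma> n N)"
        by (rule nn_integral_multc[symmetric]) measurable
      also have "\<dots> \<le> (\<integral>\<^sup>+\<omega>. test_fun \<theta> n (run 0 (schedule n N) \<omega> y) \<partial>noise \<sigma> n N)"
      proof (rule nn_integral_mono)
        fix \<omega>
        have "y 1 + path_max \<omega> 1 (n - 1) N \<le> run 0 (schedule n N) \<omega> y n"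
          using chain_ge_path_max[of 1 "n - 1" y \<omega> N] y \<open>n > 0\<close> by (simp add: run_schedule)
        then have "\<theta> * path_max \<omega> 1 (n - 1) N + \<theta> * y 1 \<le> \<theta> * run 0 (schedule n N) \<omega> y n"
          unfolding distrib_left[symmetric] using assms by (intro mult_left_mono) auto
        then show "indicator {0..1} (y 0 + row_sum \<omega> 0 0 N) * ennreal (exp (\<theta> * path_max \<omega> 1 (n - 1) N)) * ennreal (exp (\<theta> * y 1))
          \<le> test_fun \<theta> n (run 0 (schedule n N) \<omega> y)"
          unfolding test_fun_def by (simp add: run_schedule chain_0 mult.assoc mult_left_mono ennreal_leI flip: ennreal_mult exp_add)
      qed
      also have "\<dots> = sweep (gauss \<sigma>) 0 (concat (replicate N [0..<Suc n])) (test_fun \<theta> n) y"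
        by (rule sweep_noise[symmetric]) (use assms test_fun in auto)
      finally show "(\<integral>\<^sup>+\<omega>. indicator {0..1} (y 0 + row_sum \<omega> 0 0 N) * ennreal (exp (\<theta> * path_max \<omega> 1 (n - 1) N)) \<partial>noise \<sigma> n N) * ennreal (exp (\<theta> * y 1))
        \<le> sweep (gauss \<sigma>) 0 (concat (replicate N [0..<Suc n])) (test_fun \<theta> n) y" .
    qed
  qed (use assms in auto)
  ultimately have "window_weight v * (mixed_mom \<sigma> n N v \<theta> 1 * ennreal (1 / (v * u ^ (n - 1)))) \<le> window_weight v * (mgf (gauss \<sigma>) u ^ N * ennreal (1 / v ^ n))"
    using cone_int_test_fun[OF u \<open>v > 0\<close> \<open>\<theta> = u - v\<close>, of n] by (simp add: mult_ac)
  then have "mixed_mom \<sigma> n N v \<theta> 1 * ennreal (1 / (v * u ^ (n - 1))) \<le> mgf (gauss \<sigma>) u ^ N * ennreal (1 / v ^ n)"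
    using window_weight[OF \<open>v > 0\<close>] by (simp add: ennreal_mult_le_mult_iff)
  then have "mixed_mom \<sigma> n N v \<theta> 1 * ennreal (1 / (v * u ^ (n - 1))) * ennreal (v * u ^ (n - 1))
      \<le> mgf (gauss \<sigma>) u ^ N * ennreal (1 / v ^ n) * ennreal (v * u ^ (n - 1))"
    by (rule mult_right_mono) simp
  also have "mixed_mom \<sigma> n N v \<theta> 1 * ennreal (1 / (v * u ^ (n - 1))) * ennreal (v * u ^ (n - 1)) = mixed_mom \<sigma> n N v \<theta> 1"
    using assms u by (simp add: mult.assoc flip: ennreal_mult)
  also have "mgf (gauss \<sigma>) u ^ N * ennreal (1 / v ^ n) * ennreal (v * u ^ (n - 1)) = ennreal ((u / v) ^ (n - 1) * exp (real N * (u\<^sup>2 * \<sigma>\<^sup>2 / 2)))"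
  proof -
    have "1 / v ^ n * (v * u ^ (n - 1)) = (u / v) ^ (n - 1)"
      using assms by (cases n) (auto simp: power_divide)
    moreover have "mgf (gauss \<sigma>) u ^ N = ennreal (exp (real N * (u\<^sup>2 * \<sigma>\<^sup>2 / 2)))"
      by (simp only: mgf_gauss[OF assms(1)] ennreal_power exp_ge_zero exp_of_nat_mult)
    moreover have "ennreal (1 / v ^ n) * ennreal (v * u ^ (n - 1)) = ennreal (1 / v ^ n * (v * u ^ (n - 1)))"
      using assms u by (intro ennreal_mult[symmetric]) auto
    ultimately have "mgf (gauss \<sigma>) u ^ N * ennreal (1 / v ^ n) * ennreal (v * u ^ (n - 1))
       = ennreal (exp (real N * (u\<^sup>2 * \<sigma>\<^sup>2 / 2))) * ennreal ((u / v) ^ (n - 1))"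
      by (simp only: mult.assoc)
    then show ?thesis using assms u by (simp only: ennreal_mult[symmetric] mult.commute exp_ge_zero zero_le_power divide_nonneg_nonneg less_imp_le)
  qed
  finally show ?thesis .
qed

text \<open>For j > 0 the passage reads only rows from j on. Row 0 can be integrated first and
  contributes N Gaussian exponential moments.\<close>

lemma row0_factor:
  assumes "\<sigma> > 0" "j > 0" "j \<le> n"
  shows "mixed_mom \<sigma> n N v \<theta> j = ennreal (exp (real N * (v\<^sup>2 * \<sigma>\<^sup>2 / 2))) *
    (\<integral>\<^sup>+\<omega>. ennreal (exp (\<theta> * path_max \<omega> j (n - j) N)) \<partial>noise \<sigma> n N)"
proof -
  let ?D = "\<lambda>_::nat \<times> nat. density lborel (gauss \<sigma>)"
  interpret product_sigma_finite ?D
    by (rule product_sigma_finite.intro) (rule prob_space_imp_sigma_finite[OF prob_space_gauss[OF assms(1)]])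
  let ?I = "{1..n} \<times> {..<N}" and ?J = "{0} \<times> {..<N}"
  have un: "{..n} \<times> {..<N} = ?I \<union> ?J" by auto
  have J: "?I \<inter> ?J = {}" "finite ?I" "finite ?J" by auto
  interpret PJ: prob_space "PiM ?J ?D" by (intro prob_space_PiM prob_space_gauss assms)
  let ?h = "\<lambda>\<omega>. ennreal (exp (\<theta> * path_max \<omega> j (n - j) N))"
  have gp: "noise \<sigma> n N = PiM (?I \<union> ?J) ?D" by (simp only: noise_def un)
  have hm: "?h \<in> borel_measurable (PiM (?I \<union> ?J) ?D)"
    using path_max_noise_measurable[OF assms(3), of N \<sigma>] unfolding gp by measurable
  have sm: "(\<lambda>\<omega>. row_sum \<omega> 0 0 N) \<in> borel_measurable (PiM (?I \<union> ?J) ?D)"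
    using row_sum_noise_measurable[of N \<sigma> n] unfolding gp .
  have h: "?h (merge ?I ?J (x, y)) = ?h x" for x y
  proof -
    have "path_max (merge ?I ?J (x, y)) j (n - j) N = path_max x j (n - j) N"
      by (rule path_max_cong) (use assms in \<open>auto simp: merge_def\<close>)
    then show ?thesis by simp
  qed
  have s: "row_sum (merge ?I ?J (x, y)) 0 0 N = (\<Sum>l\<in>?J. y l)" for x y
  proof -
    have "(\<Sum>l\<in>?J. y l) = (\<Sum>l<N. y (0, l))"
      by (subst sum.cartesian_product[symmetric, of "\<lambda>a b. y (a, b)", simplified]) simp
    then show ?thesis by (simp add: row_sum_def merge_def atLeast0LessThan)
  qed
  define E where "E = ennreal (exp (real N * (v\<^sup>2 * \<sigma>\<^sup>2 / 2)))"
  have E: "(\<integral>\<^sup>+y. ennreal (exp (v * (\<Sum>l\<in>?J. y l))) \<partial>PiM ?J ?D) = E"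
  proof -
    have "(\<integral>\<^sup>+y. ennreal (exp (v * (\<Sum>l\<in>?J. y l))) \<partial>PiM ?J ?D) = (\<integral>\<^sup>+y. (\<Prod>l\<in>?J. ennreal (exp (v * y l))) \<partial>PiM ?J ?D)"
      by (simp add: sum_distrib_left exp_sum prod_ennreal)
    also have "\<dots> = (\<Prod>l\<in>?J. \<integral>\<^sup>+w. ennreal (exp (v * w)) \<partial>density lborel (gauss \<sigma>))"
      using product_nn_integral_prod[of ?J "\<lambda>_ w. ennreal (exp (v * w))"] by simp
    also have "(\<integral>\<^sup>+w. ennreal (exp (v * w)) \<partial>density lborel (gauss \<sigma>)) = mgf (gauss \<sigma>) v"
      unfolding mgf_def by (rule nn_integral_density) auto
    finally show ?thesis
      by (simp add: mgf_gauss assms E_def ennreal_power card_cartesian_product flip: exp_of_nat_mult)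
  qed
  have fm: "(\<lambda>\<omega>. ennreal (exp (v * row_sum \<omega> 0 0 N)) * ?h \<omega>) \<in> borel_measurable (PiM (?I \<union> ?J) ?D)"
    by (intro borel_measurable_times_ennreal hm) (use sm in measurable)
  have "mixed_mom \<sigma> n N v \<theta> j = (\<integral>\<^sup>+x. \<integral>\<^sup>+y. ennreal (exp (v * (\<Sum>l\<in>?J. y l))) * ?h x \<partial>PiM ?J ?D \<partial>PiM ?I ?D)"
    unfolding mixed_mom_def gp
    unfolding product_nn_integral_fold[OF J fm] by (simp only: h s)
  also have "\<dots> = (\<integral>\<^sup>+x. E * ?h x \<partial>PiM ?I ?D)"
  proof (rule nn_integral_cong)
    fix x
    have "(\<lambda>y. \<Sum>l\<in>?J. y l :: real) \<in> borel_measurable (PiM ?J (\<lambda>_. borel))"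
      by (rule borel_measurable_sum[where f="\<lambda>l y. y l"], rule measurable_component_singleton)
    also have "borel_measurable (PiM ?J (\<lambda>_. borel)) = borel_measurable (PiM ?J ?D)"
      by (intro measurable_cong_sets sets_PiM_cong) auto
    finally have [measurable]: "(\<lambda>y. \<Sum>l\<in>?J. y l :: real) \<in> borel_measurable (PiM ?J ?D)" .
    show "(\<integral>\<^sup>+y. ennreal (exp (v * (\<Sum>l\<in>?J. y l))) * ?h x \<partial>PiM ?J ?D) = E * ?h x"
      unfolding E[symmetric] by (rule nn_integral_multc) measurable
  qed
  also have "\<dots> = E * (\<integral>\<^sup>+x. ?h x \<partial>PiM ?I ?D)"
  proof (rule nn_integral_cmult)
    have "(\<lambda>\<omega>. path_max \<omega> j (n - j) N) \<in> borel_measurable (PiM ?I (\<lambda>_. borel))"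
      by (intro borel_measurable_path_max measurable_component_singleton) (use assms in auto)
    also have "borel_measurable (PiM ?I (\<lambda>_. borel)) = borel_measurable (PiM ?I ?D)"
      by (intro measurable_cong_sets sets_PiM_cong) auto
    finally show "?h \<in> borel_measurable (PiM ?I ?D)" by measurable
  qed
  also have "(\<integral>\<^sup>+x. ?h x \<partial>PiM ?I ?D) = (\<integral>\<^sup>+\<omega>. ?h \<omega> \<partial>noise \<sigma> n N)"
    unfolding gp
    unfolding product_nn_integral_fold[OF J hm] by (simp only: h nn_integral_const PJ.emeasure_space_1 mult_1_right)
  finally show ?thesis by (simp add: E_def)
qed

text \<open>The chain with gap e is bounded by the best passage found in
  \<open>chain_le_path_max\<close>. Its exponential is at most the sum over all starting labels,
  which is why only a sum of moments is bounded from below.\<close>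

lemma truncated_lower_bound:
  fixes \<sigma> v u \<theta> e :: real
  defines "p \<equiv> \<lambda>w. gauss \<sigma> w * indicator {- e / 2..e / 2} w"
  assumes "\<sigma> > 0" "v > 0" "u > v" "\<theta> = u - v" "n > 0" "e > 0"
  shows "((\<integral>\<^sup>+w. p w \<partial>lborel) ^ n * mgf p u) ^ N * ennreal (1 / v ^ n)
    \<le> (\<Sum>j\<le>n. ennreal (exp (\<theta> * (real (n - j) * e)) / (v ^ j * u ^ (n - j))) * mixed_mom \<sigma> n N v \<theta> j)"
proof -
  let ?c = "\<integral>\<^sup>+w. p w \<partial>lborel" and ?L = "concat (replicate N [0..<Suc n])"
  have u: "u > 0" using assms by simp
  have pm [measurable]: "p \<in> borel_measurable borel" unfolding p_def by measurable
  interpret sweep_kernel "\<lambda>x y. y \<le> x" p e ?c u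
    by (rule sweep_kernel_ge[OF pm]) (auto simp: p_def indicator_def)
  have th: "\<theta> > 0" using assms by simp
  have "(?c ^ n * mgf p u) ^ N * cone_int u n (test_fun \<theta> n) \<le> cone_int u n (sweep p e ?L (test_fun \<theta> n))"
    by (rule cone_int_sweeps) (use th assms test_fun in auto)
  also have "\<dots> \<le> cone_int u n (\<lambda>y. \<Sum>j\<le>n. ennreal (exp (\<theta> * (real (n - j) * e))) *
     ((\<integral>\<^sup>+\<omega>. indicator {0..1} (y 0 + row_sum \<omega> 0 0 N) * ennreal (exp (\<theta> * path_max \<omega> j (n - j) N)) \<partial>noise \<sigma> n N) * ennreal (exp (\<theta> * y j))))"
  proof (rule cone_int_mono)
    fix y :: "nat \<Rightarrow> real"
    note [measurable] = row_sum_noise_measurable path_max_noise_measurable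
    \<comment> \<open>The comparison was made with truncated steps. Enlarging the kernel afterwards
      keeps the direction of the inequality and restores the Gaussian noise.\<close>
    have "sweep p e ?L (test_fun \<theta> n) y \<le> sweep (gauss \<sigma>) e ?L (test_fun \<theta> n) y"
      by (rule sweep_mono_kernel) (auto simp: p_def indicator_def)
    also have "\<dots> = (\<integral>\<^sup>+\<omega>. test_fun \<theta> n (run e (schedule n N) \<omega> y) \<partial>noise \<sigma> n N)"
      by (rule sweep_noise) (use assms test_fun in auto)
    also have "\<dots> \<le> (\<integral>\<^sup>+\<omega>. (\<Sum>j\<le>n. ennreal (exp (\<theta> * (real (n - j) * e))) *
        (indicator {0..1} (y 0 + row_sum \<omega> 0 0 N) * ennreal (exp (\<theta> * path_max \<omega> j (n - j) N)) * ennreal (exp (\<theta> * y j)))) \<partial>noise \<sigma> n N)"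
    proof (rule nn_integral_mono)
      fix \<omega>
      obtain j where j: "j \<le> n" "chain e \<omega> y n N \<le> y j + real (n - j) * e + path_max \<omega> j (n - j) N"
        using chain_le_path_max[of n e \<omega> y N] by auto
      have "\<theta> * chain e \<omega> y n N \<le> \<theta> * (real (n - j) * e) + (\<theta> * path_max \<omega> j (n - j) N + \<theta> * y j)"
        using mult_left_mono[OF j(2), of \<theta>] th by (simp add: algebra_simps)
      then have "test_fun \<theta> n (run e (schedule n N) \<omega> y) \<le> ennreal (exp (\<theta> * (real (n - j) * e))) *
        (indicator {0..1} (y 0 + row_sum \<omega> 0 0 N) * ennreal (exp (\<theta> * path_max \<omega> j (n - j) N)) * ennreal (exp (\<theta> * y j)))"
        unfolding test_fun_def by (auto simp: run_schedule chain_0 indicator_def intro!: ennreal_leI simp flip: ennreal_mult exp_add)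
      also have "\<dots> \<le> (\<Sum>j\<le>n. ennreal (exp (\<theta> * (real (n - j) * e))) *
        (indicator {0..1} (y 0 + row_sum \<omega> 0 0 N) * ennreal (exp (\<theta> * path_max \<omega> j (n - j) N)) * ennreal (exp (\<theta> * y j))))"
        by (rule member_le_sum) (use j in auto)
      finally show "test_fun \<theta> n (run e (schedule n N) \<omega> y) \<le> \<dots>" .
    qed
    also have "\<dots> = (\<Sum>j\<le>n. ennreal (exp (\<theta> * (real (n - j) * e))) *
     ((\<integral>\<^sup>+\<omega>. indicator {0..1} (y 0 + row_sum \<omega> 0 0 N) * ennreal (exp (\<theta> * path_max \<omega> j (n - j) N)) \<partial>noise \<sigma> n N) * ennreal (exp (\<theta> * y j))))"
      by (subst nn_integral_sum) (auto intro!: sum.cong simp: nn_integral_cmult nn_integral_multc)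
    finally show "sweep p e ?L (test_fun \<theta> n) y \<le> \<dots>" .
  qed
  also have "\<dots> = (\<Sum>j\<le>n. ennreal (exp (\<theta> * (real (n - j) * e))) * (window_weight v * mixed_mom \<sigma> n N v \<theta> j * ennreal (1 / (v ^ j * u ^ (n - j)))))"
  proof -
    interpret prob_space "noise \<sigma> n N" by (rule prob_space_noise) fact
    have m: "(\<lambda>y. (\<integral>\<^sup>+\<omega>. indicator {0..1} (y 0 + row_sum \<omega> 0 0 N) * ennreal (exp (\<theta> * path_max \<omega> j (n - j) N)) \<partial>noise \<sigma> n N) * ennreal (exp (\<theta> * y j))) \<in> borel_measurable state_space"
      if "j \<le> n" for j
    proof -
      note [measurable] = row_sum_noise_measurable path_max_noise_measurable[OF that]
      show ?thesis by measurable
    qed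
    show ?thesis
      by (subst cone_int_sum) (use m in \<open>auto intro!: sum.cong simp: cone_int_cmult cone_int_mixed_moment[OF u assms(3,5) _ assms(2)]\<close>)
  qed
  also have "\<dots> = window_weight v * (\<Sum>j\<le>n. ennreal (exp (\<theta> * (real (n - j) * e)) / (v ^ j * u ^ (n - j))) * mixed_mom \<sigma> n N v \<theta> j)"
    unfolding sum_distrib_left
  proof (rule sum.cong[OF refl])
    fix j
    have "ennreal (exp (\<theta> * (real (n - j) * e)) / (v ^ j * u ^ (n - j))) = ennreal (exp (\<theta> * (real (n - j) * e))) * ennreal (1 / (v ^ j * u ^ (n - j)))"
      using assms(3) u by (subst ennreal_mult[symmetric]) auto
    then show "ennreal (exp (\<theta> * (real (n - j) * e))) * (window_weight v * mixed_mom \<sigma> n N v \<theta> j * ennreal (1 / (v ^ j * u ^ (n - j))))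
      = window_weight v * (ennreal (exp (\<theta> * (real (n - j) * e)) / (v ^ j * u ^ (n - j))) * mixed_mom \<sigma> n N v \<theta> j)"
      by (simp only: mult_ac)
  qed
  finally have "window_weight v * ((?c ^ n * mgf p u) ^ N * ennreal (1 / v ^ n))
      \<le> window_weight v * (\<Sum>j\<le>n. ennreal (exp (\<theta> * (real (n - j) * e)) / (v ^ j * u ^ (n - j))) * mixed_mom \<sigma> n N v \<theta> j)"
    unfolding cone_int_test_fun[OF u assms(3,5)] by (simp only: mult.left_commute)
  then show ?thesis using window_weight[OF assms(3)] by (simp only: ennreal_mult_le_mult_iff not_False_eq_True)
qed

section \<open>Truncated Gaussian steps\<close>

declare measurable_const_state [measurable del] measurable_state_upd [measurable del]
  measurable_const_state_upd [measurable del] measurable_coord [measurable del] measurable_reflect_at [measurable del]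

text \<open>The Lagrange remainder of order four is nonnegative.\<close>

lemma exp_ge_cubic: "1 + x + x\<^sup>2 / 2 + x ^ 3 / 6 \<le> exp (x::real)"
proof -
  obtain t where "exp x = (\<Sum>m<4. x ^ m / fact m) + exp t / fact 4 * x ^ 4"
    using Maclaurin_exp_le[of x 4] by blast
  moreover have "exp t / fact 4 * x ^ 4 \<ge> 0" by simp
  moreover have "(\<Sum>m<4. x ^ m / fact m) = 1 + x + x\<^sup>2 / 2 + x ^ 3 / 6"
    by (simp add: eval_nat_numeral)
  ultimately show ?thesis by linarith
qed

context
  fixes \<sigma> e :: real and p :: "real \<Rightarrow> ennreal"
  assumes s: "\<sigma> > 0" and e: "e > 0"
    and p: "p = (\<lambda>w. gauss \<sigma> w * indicator {- e / 2..e / 2} w)"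
begin

text \<open>A minorant q that is nonpositive beyond the cut-off can be integrated against the whole
  Gaussian. For polynomial q this needs only exact moments, in place of tail estimates.\<close>

lemma truncated_ge:
  assumes q: "\<And>w. \<bar>w\<bar> \<le> e / 2 \<Longrightarrow> q w \<le> g w" and q': "\<And>w. \<bar>w\<bar> > e / 2 \<Longrightarrow> q w \<le> 0"
    and g: "\<And>w. 0 \<le> g w" "\<And>w. \<bar>w\<bar> \<le> e / 2 \<Longrightarrow> g w \<le> K" and [measurable]: "g \<in> borel_measurable borel"
    and int: "has_bochner_integral lborel (\<lambda>w. normal_density 0 \<sigma> w * q w) I"
  shows "ennreal I \<le> (\<integral>\<^sup>+w. p w * ennreal (g w) \<partial>lborel)"
proof -
  let ?f = "\<lambda>w. normal_density 0 \<sigma> w * (indicator {- e / 2..e / 2} w * g w)"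
  have K: "0 \<le> K" using g(1)[of 0] g(2)[of 0] e by simp
  have fi: "integrable lborel ?f"
  proof (rule Bochner_Integration.integrable_bound)
    show "integrable lborel (\<lambda>w. normal_density 0 \<sigma> w * K)" using s by simp
    show "AE x in lborel. norm (?f x) \<le> norm (normal_density 0 \<sigma> x * K)"
      using g K by (intro AE_I2) (auto simp: abs_mult indicator_def intro!: mult_left_mono)
  qed measurable
  have "I = (\<integral>w. normal_density 0 \<sigma> w * q w \<partial>lborel)" using int by (simp add: has_bochner_integral_iff)
  also have "\<dots> \<le> (\<integral>w. ?f w \<partial>lborel)"
  proof (rule integral_mono)
    show "integrable lborel (\<lambda>w. normal_density 0 \<sigma> w * q w)" using int by (simp add: has_bochner_integral_iff)
    fix w show "normal_density 0 \<sigma> w * q w \<le> ?f w"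
      using q[of w] q'[of w] by (intro mult_left_mono) (auto simp: indicator_def abs_le_iff not_le)
  qed (rule fi)
  finally have "ennreal I \<le> ennreal (\<integral>w. ?f w \<partial>lborel)" by (rule ennreal_leI)
  also have "\<dots> = (\<integral>\<^sup>+w. ennreal (?f w) \<partial>lborel)"
    by (rule nn_integral_eq_integral[symmetric, OF fi]) (auto simp: indicator_def g)
  also have "\<dots> = (\<integral>\<^sup>+w. p w * ennreal (g w) \<partial>lborel)"
    unfolding p gauss_def
    by (intro nn_integral_cong) (auto simp: indicator_def ennreal_mult g)
  finally show ?thesis .
qed

lemma moment4: "has_bochner_integral lborel (\<lambda>w. normal_density 0 \<sigma> w * w ^ 4) (3 * \<sigma> ^ 4)"
proof -
  have "fact (2 * 2) / ((2 / \<sigma>\<^sup>2) ^ 2 * fact 2) = 3 * \<sigma> ^ 4"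
    using s by (simp add: eval_nat_numeral)
  then show ?thesis using normal_moment_even[OF s, of 0 2] by simp
qed

text \<open>The minorant is 1 - (2 w / e) ^ 4. A fourth moment loses order \<sigma> ^ 4, that is 1 /
  N^2 for \<sigma>^2 = t / N, which vanishes over N sweeps of n labels; a second moment would leave
  a loss of order one.\<close>

lemma truncated_mass: "ennreal (1 - 48 * \<sigma> ^ 4 / e ^ 4) \<le> (\<integral>\<^sup>+w. p w \<partial>lborel)"
proof -
  have "ennreal (1 - 16 / e ^ 4 * (3 * \<sigma> ^ 4)) \<le> (\<integral>\<^sup>+w. p w * ennreal 1 \<partial>lborel)"
  proof (rule truncated_ge[where q="\<lambda>w. 1 - 16 / e ^ 4 * w ^ 4" and K=1])
    fix w :: real assume w: "\<bar>w\<bar> > e / 2"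
    have "(e / 2) ^ 4 \<le> \<bar>w\<bar> ^ 4" using w e by (intro power_mono) auto
    then have "e ^ 4 \<le> 16 * w ^ 4" by (simp add: power_divide power_even_abs)
    then show "1 - 16 / e ^ 4 * w ^ 4 \<le> 0" using e by (simp add: field_simps)
  next
    have "has_bochner_integral lborel (\<lambda>w. normal_density 0 \<sigma> w - 16 / e ^ 4 * (normal_density 0 \<sigma> w * w ^ 4)) (1 - 16 / e ^ 4 * (3 * \<sigma> ^ 4))"
      using s by (intro has_bochner_integral_diff has_bochner_integral_mult_right moment4) (simp add: has_bochner_integral_iff)
    then show "has_bochner_integral lborel (\<lambda>w. normal_density 0 \<sigma> w * (1 - 16 / e ^ 4 * w ^ 4)) (1 - 16 / e ^ 4 * (3 * \<sigma> ^ 4))"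
      by (simp add: algebra_simps)
  qed (use e in auto)
  then show ?thesis by simp
qed

text \<open>The minorant is the cubic Taylor polynomial of exp (u w) minus C (2 w / e) ^ 4, where C
  is the value of that polynomial at the cut-off w = e / 2.\<close>

lemma truncated_mgf:
  assumes u: "u > 0"
  defines "C \<equiv> 1 + u * e / 2 + (u * e / 2)\<^sup>2 / 2 + (u * e / 2) ^ 3 / 6"
  shows "ennreal (1 + u\<^sup>2 * \<sigma>\<^sup>2 / 2 - C * 48 * \<sigma> ^ 4 / e ^ 4) \<le> mgf p u"
proof -
  let ?T = "\<lambda>w. 1 + u * w + (u * w)\<^sup>2 / 2 + (u * w) ^ 3 / 6"
  have "ennreal (1 + u * 0 + u\<^sup>2 / 2 * \<sigma>\<^sup>2 + u ^ 3 / 6 * 0 - C * 16 / e ^ 4 * (3 * \<sigma> ^ 4)) \<le> (\<integral>\<^sup>+w. p w * ennreal (exp (u * w)) \<partial>lborel)"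
  proof (rule truncated_ge[where q="\<lambda>w. ?T w - C * 16 / e ^ 4 * w ^ 4" and K="exp (u * (e / 2))"])
    fix w :: real assume w: "\<bar>w\<bar> > e / 2"
    \<comment> \<open>In units of the cut-off, x \<ge> 1, so each lower power of x is at most x ^ 4
      and the polynomial is at most C x ^ 4.\<close>
    define x where "x = 2 * \<bar>w\<bar> / e"
    define b where "b = u * e / 2"
    have b: "b > 0" using u e by (simp add: b_def)
    have x: "x \<ge> 1" using w e by (simp add: x_def field_simps)
    have aw: "u * \<bar>w\<bar> = b * x" using e by (simp add: x_def b_def field_simps)
    have "y + y\<^sup>2 / 2 + y ^ 3 / 6 \<le> \<bar>y\<bar> + \<bar>y\<bar>\<^sup>2 / 2 + \<bar>y\<bar> ^ 3 / 6" for y :: real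
    proof -
      have "y ^ 3 \<le> \<bar>y\<bar> ^ 3" by (metis abs_ge_self power_abs)
      then show ?thesis using abs_ge_self[of y] by (simp only: power2_abs)
    qed
    from this[of "u * w"] have "?T w \<le> 1 + u * \<bar>w\<bar> + (u * \<bar>w\<bar>)\<^sup>2 / 2 + (u * \<bar>w\<bar>) ^ 3 / 6"
      using u by (simp only: abs_mult abs_of_pos)
    also have "\<dots> = 1 + b * x + b\<^sup>2 / 2 * x ^ 2 + b ^ 3 / 6 * x ^ 3" unfolding aw by (simp add: power_mult_distrib)
    also have "\<dots> \<le> 1 * x ^ 4 + b * x ^ 4 + b\<^sup>2 / 2 * x ^ 4 + b ^ 3 / 6 * x ^ 4"
    proof -
      have "x ^ 1 \<le> x ^ 4" "x ^ 2 \<le> x ^ 4" "x ^ 3 \<le> x ^ 4" "x ^ 0 \<le> x ^ 4" using x by (intro power_increasing; simp)+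
      then show ?thesis using b by (intro add_mono mult_left_mono) auto
    qed
    also have "\<dots> = C * x ^ 4" unfolding C_def b_def by (simp add: algebra_simps)
    also have "x ^ 4 = 16 / e ^ 4 * w ^ 4" by (simp add: x_def power_divide power_mult_distrib power_even_abs)
    finally show "?T w - C * 16 / e ^ 4 * w ^ 4 \<le> 0" by simp
  next
    fix w :: real assume "\<bar>w\<bar> \<le> e / 2"
    have "0 \<le> C * 16 / e ^ 4 * w ^ 4" using u e by (simp add: C_def add_nonneg_nonneg)
    then show "?T w - C * 16 / e ^ 4 * w ^ 4 \<le> exp (u * w)"
      using exp_ge_cubic[of "u * w"] by linarith
  next
    have "has_bochner_integral lborel (\<lambda>w. normal_density 0 \<sigma> w + u * (normal_density 0 \<sigma> w * w) + u\<^sup>2 / 2 * (normal_density 0 \<sigma> w * w\<^sup>2)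
        + u ^ 3 / 6 * (normal_density 0 \<sigma> w * w ^ 3) - C * 16 / e ^ 4 * (normal_density 0 \<sigma> w * w ^ 4))
       (1 + u * 0 + u\<^sup>2 / 2 * \<sigma>\<^sup>2 + u ^ 3 / 6 * 0 - C * 16 / e ^ 4 * (3 * \<sigma> ^ 4))"
    proof (intro has_bochner_integral_diff has_bochner_integral_add has_bochner_integral_mult_right moment4)
      show "has_bochner_integral lborel (normal_density 0 \<sigma>) 1" using s by (simp add: has_bochner_integral_iff)
      show "has_bochner_integral lborel (\<lambda>w. normal_density 0 \<sigma> w * w) 0"
        using normal_moment_odd[OF s, of 0 0] by simp
      show "has_bochner_integral lborel (\<lambda>w. normal_density 0 \<sigma> w * w\<^sup>2) (\<sigma>\<^sup>2)"
        using normal_moment_even[OF s, of 0 1] s by simp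
      show "has_bochner_integral lborel (\<lambda>w. normal_density 0 \<sigma> w * w ^ 3) 0"
        using normal_moment_odd[OF s, of 0 1] by (simp add: eval_nat_numeral)
    qed
    then show "has_bochner_integral lborel (\<lambda>w. normal_density 0 \<sigma> w * (?T w - C * 16 / e ^ 4 * w ^ 4))
       (1 + u * 0 + u\<^sup>2 / 2 * \<sigma>\<^sup>2 + u ^ 3 / 6 * 0 - C * 16 / e ^ 4 * (3 * \<sigma> ^ 4))"
      by (rule has_bochner_integral_cong[THEN iffD1, rotated -1]) (auto simp: field_simps power_mult_distrib)
  qed (use u in auto)
  then show ?thesis by (simp add: mgf_def mult.assoc)
qed

end

text \<open>Here n and e are fixed while the mesh is refined. With b = u^2 t / 2, the losses in mass
  and in moment are each at most 1 / (8 N) per sweep, so at worst the limit is exp (b - 1 / 4),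
  still above exp b / 2.\<close>

lemma truncated_product_eventually:
  fixes t u e :: real
  assumes "t > 0" "u > 0" "e > 0"
  shows "\<forall>\<^sub>F N in sequentially. ennreal (exp (u\<^sup>2 * t / 2) / 2) \<le>
     ((\<integral>\<^sup>+w. gauss (sqrt (t / real N)) w * indicator {- e / 2..e / 2} w \<partial>lborel) ^ n *
       mgf (\<lambda>w. gauss (sqrt (t / real N)) w * indicator {- e / 2..e / 2} w) u) ^ N"
proof -
  define A where "A = 48 * t\<^sup>2 / e ^ 4"
  define C where "C = 1 + u * e / 2 + (u * e / 2)\<^sup>2 / 2 + (u * e / 2) ^ 3 / 6"
  define b where "b = u\<^sup>2 * t / 2"
  have A: "A > 0" using assms by (simp add: A_def)
  have C: "C > 0" using assms by (simp add: C_def add_pos_nonneg)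
  have "(\<lambda>N. (1 + (b - 1 / 8) / real N) ^ N * (1 + (- 1 / 8) / real N) ^ N) \<longlonglongrightarrow> exp (b - 1 / 8) * exp (- 1 / 8)"
    by (intro tendsto_mult tendsto_exp_limit_sequentially)
  moreover have "exp b / 2 < exp (b - 1 / 8) * exp (- 1 / 8)"
  proof -
    have "exp (1 / 4 :: real) < 2" using exp_bound_lemma[of "1 / 4 :: real"] by simp
    then have "exp b < exp (b - 1 / 4) * 2"
      using mult_strict_left_mono[of "exp (1 / 4 :: real)" 2 "exp (b - 1 / 4)"] by (simp flip: exp_add)
    moreover have "exp (b - 1 / 8) * exp (- 1 / 8) = exp (b - 1 / 4)" by (simp flip: exp_add)
    ultimately show ?thesis by simp
  qed
  ultimately have "\<forall>\<^sub>F N in sequentially. exp b / 2 < (1 + (b - 1 / 8) / real N) ^ N * (1 + (- 1 / 8) / real N) ^ N"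
    by (rule order_tendstoD(1))
  \<comment> \<open>Large enough that n A / N^2 and C A / N^2 are at most 1 / (8 N) and that all
    bases of the powers are nonnegative.\<close>
  moreover have "\<forall>\<^sub>F N in sequentially. real N \<ge> 8 * C * A + 8 * real n * A + A + 1 + \<bar>b\<bar>"
    by (rule eventually_compose_filterlim[OF eventually_ge_at_top filterlim_real_sequentially])
  ultimately show ?thesis
  proof eventually_elim
    case (elim N)
    have CA: "0 < C * A" "0 \<le> real n * A" using C A by auto
    have CA': "8 * C * A \<le> real N" "8 * real n * A \<le> real N" using elim(2) CA A by linarith+
    have N: "real N \<ge> 1" using elim CA A by linarith
    then have N0: "real N > 0" by simp
    define \<sigma> where "\<sigma> = sqrt (t / real N)"
    have s: "\<sigma> > 0" using assms N0 by (simp add: \<sigma>_def)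
    have s2: "\<sigma>\<^sup>2 = t / real N" using assms N0 by (simp add: \<sigma>_def)
    have s4: "\<sigma> ^ 4 = t\<^sup>2 / (real N)\<^sup>2" using s2 by (metis power2_eq_square power4_eq_xxxx power_divide mult.assoc)
    define p where "p = (\<lambda>w. gauss \<sigma> w * indicator {- e / 2..e / 2} w)"
    have a: "48 * \<sigma> ^ 4 / e ^ 4 = A / (real N)\<^sup>2" unfolding s4 A_def by simp
    have AN: "A / (real N)\<^sup>2 \<le> 1"
    proof -
      have "A \<le> real N" using elim CA by linarith
      also have "real N \<le> (real N)\<^sup>2" using N by (simp add: power2_eq_square)
      finally show ?thesis using N0 by (simp add: field_simps)
    qed
    have m: "ennreal (1 - A / (real N)\<^sup>2) \<le> (\<integral>\<^sup>+w. p w \<partial>lborel)"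
      using truncated_mass[OF s assms(3) p_def] unfolding a .
    have g: "ennreal (1 + b / real N - C * (A / (real N)\<^sup>2)) \<le> mgf p u"
      using truncated_mgf[OF s assms(3) p_def assms(2)] unfolding C_def[symmetric] s2
      by (simp add: b_def s4 A_def mult_ac)
    have "1 + (- 1 / 8) / real N \<le> (1 - A / (real N)\<^sup>2) ^ n"
    proof -
      have "real n * (A / (real N)\<^sup>2) \<le> 1 / 8 / real N"
        using CA'(2) N0 by (simp add: field_simps power2_eq_square)
      then have "1 + (- 1 / 8) / real N \<le> 1 + real n * (- (A / (real N)\<^sup>2))" by simp
      also have "\<dots> \<le> (1 + (- (A / (real N)\<^sup>2))) ^ n" by (rule Bernoulli_inequality) (use AN in simp)
      finally show ?thesis by simp
    qed
    moreover have "1 + (b - 1 / 8) / real N \<le> 1 + b / real N - C * (A / (real N)\<^sup>2)"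
    proof -
      have "C * (A / (real N)\<^sup>2) \<le> 1 / 8 / real N"
        using CA'(1) N0 by (simp add: field_simps power2_eq_square)
      then show ?thesis by (simp add: diff_divide_distrib)
    qed
    moreover have p1: "0 \<le> 1 + (- 1 / 8) / real N" using N by (simp add: field_simps)
    moreover have p2: "0 \<le> 1 + (b - 1 / 8) / real N" 
    proof -
      have "0 \<le> real N + (b - 1 / 8)" using elim(2) CA A by linarith
      then show ?thesis using N0 by (simp add: field_simps)
    qed
    ultimately have "(1 + (- 1 / 8) / real N) * (1 + (b - 1 / 8) / real N)
        \<le> (1 - A / (real N)\<^sup>2) ^ n * (1 + b / real N - C * (A / (real N)\<^sup>2))"
      by (intro mult_mono) auto
    then have "((1 + (- 1 / 8) / real N) * (1 + (b - 1 / 8) / real N)) ^ N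
        \<le> ((1 - A / (real N)\<^sup>2) ^ n * (1 + b / real N - C * (A / (real N)\<^sup>2))) ^ N"
      using p1 p2 by (intro power_mono) auto
    then have "exp b / 2 \<le> ((1 - A / (real N)\<^sup>2) ^ n * (1 + b / real N - C * (A / (real N)\<^sup>2))) ^ N"
      using elim(1) by (simp add: power_mult_distrib mult.commute)
    then have "ennreal (exp b / 2) \<le> ennreal (((1 - A / (real N)\<^sup>2) ^ n * (1 + b / real N - C * (A / (real N)\<^sup>2))) ^ N)"
      by (rule ennreal_leI)
    also have "\<dots> = (ennreal (1 - A / (real N)\<^sup>2) ^ n * ennreal (1 + b / real N - C * (A / (real N)\<^sup>2))) ^ N"
    proof -
      have "ennreal ((x ^ n * y) ^ N) = (ennreal x ^ n * ennreal y) ^ N" if "0 \<le> x" "0 \<le> y" for x y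
        using that by (simp add: ennreal_mult flip: ennreal_power)
      then show ?thesis
        using AN p2 \<open>1 + (b - 1 / 8) / real N \<le> 1 + b / real N - C * (A / (real N)\<^sup>2)\<close> by simp
    qed
    also have "\<dots> \<le> ((\<integral>\<^sup>+w. p w \<partial>lborel) ^ n * mgf p u) ^ N"
      by (intro power_mono mult_mono m g) auto
    finally show ?case unfolding b_def p_def \<sigma>_def .
  qed
qed

section \<open>From Brownian increments to the chain\<close>

definition increments :: "(int \<Rightarrow> real \<Rightarrow> real) \<Rightarrow> int \<Rightarrow> real \<Rightarrow> nat \<times> nat \<Rightarrow> real" where
  "increments b k \<delta> x = b (k + int (fst x)) (real (Suc (snd x)) * \<delta>) - b (k + int (fst x)) (real (snd x) * \<delta>)"

definition grid_passage :: "(int \<Rightarrow> real \<Rightarrow> real) \<Rightarrow> int \<Rightarrow> nat \<Rightarrow> real \<Rightarrow> nat \<Rightarrow> real" where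
  "grid_passage b k d t N = path_max (increments b k (t / real N)) 0 d N"

lemma path_max_shift: "path_max \<omega> j d \<tau> = path_max (\<lambda>x. \<omega> (fst x + j, snd x)) 0 d \<tau>"
proof (induction d arbitrary: \<tau>)
  case 0 then show ?case by (simp add: row_sum_def)
next
  case (Suc d)
  show ?case unfolding path_max.simps
    by (intro arg_cong[where f=Max] image_cong refl arg_cong2[where f="(+)"] Suc)
       (simp add: row_sum_def add.commute)
qed

lemma grid_passage_eq_path_max: "grid_passage b (k + int j) d t N = path_max (increments b k (t / real N)) j d N"
  unfolding grid_passage_def
  by (subst (2) path_max_shift) (simp add: increments_def[abs_def] add.assoc add.commute add.left_commute)

lemma BM_measurable:
  "indep_standard_BMs M B \<Longrightarrow> 0 \<le> t \<Longrightarrow> B i t \<in> borel_measurable M"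
  by (simp add: indep_standard_BMs_def standard_BM_def)

lemma increments_measurable:
  "indep_standard_BMs M B \<Longrightarrow> 0 \<le> \<delta> \<Longrightarrow> (\<lambda>\<omega>. increments (\<lambda>i s. B i s \<omega>) k \<delta> x) \<in> borel_measurable M"
  unfolding increments_def by (intro borel_measurable_diff BM_measurable) auto

text \<open>Independence has two layers: between motions it comes from the independence of whole
  paths, within a motion from independent increments. A product event is therefore first grouped by
  rows.\<close>

lemma joint_increments:
  assumes BM: "indep_standard_BMs M B" and d: "\<delta> > 0" and N: "N > 0"
  shows "distr M (PiM ({..n} \<times> {..<N}) (\<lambda>_. borel)) (\<lambda>\<omega>. \<lambda>x\<in>{..n} \<times> {..<N}. increments (\<lambda>i s. B i s \<omega>) k \<delta> x)
     = noise (sqrt \<delta>) n N"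
proof -
  let ?J = "{..n} \<times> {..<N}"
  let ?X = "\<lambda>x \<omega>. increments (\<lambda>i s. B i s \<omega>) k \<delta> x"
  have std: "standard_BM M (B i)" for i using BM by (simp add: indep_standard_BMs_def)
  interpret prob_space M using std[of 0] by (simp add: standard_BM_def)
  have X: "?X x \<in> borel_measurable M" for x
    using increments_measurable[OF BM] d by simp
  have dist: "distr M borel (?X x) = density lborel (gauss (sqrt \<delta>))" for x
  proof -
    have "distributed M lborel (\<lambda>\<omega>. B (k + int (fst x)) (real (Suc (snd x)) * \<delta>) \<omega> - B (k + int (fst x)) (real (snd x) * \<delta>) \<omega>)
       (normal_density 0 (sqrt (real (Suc (snd x)) * \<delta> - real (snd x) * \<delta>)))"
      using std[of "k + int (fst x)"] d unfolding standard_BM_def by auto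
    moreover have "real (Suc (snd x)) * \<delta> - real (snd x) * \<delta> = \<delta>" by (simp add: algebra_simps)
    ultimately have "distr M lborel (?X x) = density lborel (gauss (sqrt \<delta>))"
      unfolding distributed_def increments_def gauss_def by simp
    then show ?thesis by (metis distr_cong sets_lborel)
  qed
  have ind: "indep_vars (\<lambda>_. borel) ?X ?J"
    unfolding indep_vars_def2
  proof (intro conjI ballI X)
    let ?F = "\<lambda>x. {?X x -` A \<inter> space M |A. A \<in> sets borel}"
    show "indep_sets ?F ?J"
    proof (subst indep_sets_finite)
      show "?J \<noteq> {}" "finite ?J" using N by auto
      show "?F x \<subseteq> events" for x using measurable_sets[OF X[of x]] by auto
      show "space M \<in> ?F x" for x by (auto intro!: exI[of _ UNIV])
      show "\<forall>A\<in>Pi ?J ?F. prob (\<Inter>x\<in>?J. A x) = (\<Prod>x\<in>?J. prob (A x))"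
      proof
        fix A assume "A \<in> Pi ?J ?F"
        then have "\<forall>x\<in>?J. \<exists>E. A x = ?X x -` E \<inter> space M \<and> E \<in> sets borel" by (auto simp: Pi_iff)
        from bchoice[OF this] obtain E where E': "\<forall>x\<in>?J. A x = ?X x -` E x \<inter> space M \<and> E x \<in> sets borel"
          by blast
        have E: "A x = ?X x -` E x \<inter> space M" "E x \<in> sets borel" if "x \<in> ?J" for x
          using E' that by blast+
        let ?P = "\<lambda>i \<omega>. \<lambda>t\<in>{0..}. B i t \<omega>"
        let ?PM = "PiM {0..} (\<lambda>_. borel) :: (real \<Rightarrow> real) measure"
        \<comment> \<open>The cylinder set of paths that describes the events of row i.\<close>
        define C where "C i = {f \<in> space ?PM. \<forall>l\<in>{..<N}. f (real (Suc l) * \<delta>) - f (real l * \<delta>) \<in> E (i, l)}" for i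
        have C: "C i \<in> sets ?PM" if "i \<le> n" for i
          unfolding C_def
        proof (intro sets.sets_Collect_finite_All)
          fix l assume l: "l \<in> {..<N}"
          have "(\<lambda>f. f (real (Suc l) * \<delta>) - f (real l * \<delta>)) \<in> borel_measurable ?PM"
            using d by (intro borel_measurable_diff measurable_component_singleton) auto
          from measurable_sets_Collect[OF this, of "\<lambda>z. z \<in> E (i, l)"] E(2)[of "(i, l)"] that l
          show "{f \<in> space ?PM. f (real (Suc l) * \<delta>) - f (real l * \<delta>) \<in> E (i, l)} \<in> sets ?PM" by simp
        qed simp
        have PC: "?P (k + int i) -` C i \<inter> space M = (\<Inter>l\<in>{..<N}. A (i, l))" if "i \<le> n" for i
          using E(1) that N d by (auto simp: C_def space_PiM increments_def)
        have row: "prob (\<Inter>l\<in>{..<N}. A (i, l)) = (\<Prod>l\<in>{..<N}. prob (A (i, l)))" if i: "i \<le> n" for i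
        proof -
          have "mono (\<lambda>l. real l * \<delta>)" using d by (auto simp: mono_def)
          then have "indep_vars (\<lambda>_. borel) (\<lambda>l \<omega>. B (k + int i) (real (Suc l) * \<delta>) \<omega> - B (k + int i) (real l * \<delta>) \<omega>) {..<N}"
            using std[of "k + int i"] unfolding standard_BM_def by (auto dest!: spec[of _ N] spec[of _ "\<lambda>l. real l * \<delta>"])
          then have "prob (\<Inter>l\<in>{..<N}. (\<lambda>\<omega>. B (k + int i) (real (Suc l) * \<delta>) \<omega> - B (k + int i) (real l * \<delta>) \<omega>) -` E (i, l) \<inter> space M)
            = (\<Prod>l\<in>{..<N}. prob ((\<lambda>\<omega>. B (k + int i) (real (Suc l) * \<delta>) \<omega> - B (k + int i) (real l * \<delta>) \<omega>) -` E (i, l) \<inter> space M))"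
            by (rule indep_varsD_finite) (use N E(2) i in auto)
          then show ?thesis using E(1) i by (simp add: increments_def)
        qed
        have inj: "inj_on (\<lambda>i. k + int i) {..n}" by (auto simp: inj_on_def)
        have "(\<Inter>x\<in>?J. A x) = (\<Inter>i\<in>{..n}. \<Inter>l\<in>{..<N}. A (i, l))" using N by auto
        also have "\<dots> = (\<Inter>i\<in>{..n}. ?P (k + int i) -` C i \<inter> space M)"
          using PC by (intro INF_cong) auto
        also have "\<dots> = (\<Inter>j\<in>(\<lambda>i. k + int i) ` {..n}. ?P j -` C (nat (j - k)) \<inter> space M)" by simp
        also have "prob \<dots> = (\<Prod>j\<in>(\<lambda>i. k + int i) ` {..n}. prob (?P j -` C (nat (j - k)) \<inter> space M))"
          by (rule indep_varsD[of "\<lambda>_. ?PM" _ UNIV]) (use BM C in \<open>auto simp: indep_standard_BMs_def\<close>)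
        also have "\<dots> = (\<Prod>i\<in>{..n}. prob (?P (k + int i) -` C i \<inter> space M))"
          by (subst prod.reindex[OF inj]) simp
        also have "\<dots> = (\<Prod>i\<in>{..n}. \<Prod>l\<in>{..<N}. prob (A (i, l)))"
          using PC row by (intro prod.cong) auto
        also have "\<dots> = (\<Prod>x\<in>?J. prob (A x))" by (simp add: prod.cartesian_product)
        finally show "prob (\<Inter>x\<in>?J. A x) = (\<Prod>x\<in>?J. prob (A x))" .
      qed
    qed
  qed
  have "distr M (PiM ?J (\<lambda>_. borel)) (\<lambda>\<omega>. \<lambda>x\<in>?J. ?X x \<omega>) = PiM ?J (\<lambda>x. distr M borel (?X x))"
    by (subst indep_vars_iff_distr_eq_PiM'[symmetric]) (use X ind N in auto)
  then show ?thesis unfolding noise_def dist by simp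
qed

lemma grid_moment:
  assumes BM: "indep_standard_BMs M B" and t: "t > 0" and N: "N > 0" and j: "j \<le> n"
  shows "(\<integral>\<^sup>+\<omega>. ennreal (exp (\<theta> * grid_passage (\<lambda>i s. B i s \<omega>) (k + int j) (n - j) t N)) \<partial>M)
     = (\<integral>\<^sup>+\<omega>. ennreal (exp (\<theta> * path_max \<omega> j (n - j) N)) \<partial>noise (sqrt (t / real N)) n N)"
proof -
  let ?J = "{..n} \<times> {..<N}" and ?\<delta> = "t / real N"
  have d: "?\<delta> > 0" using t N by simp
  let ?I = "\<lambda>\<omega>. \<lambda>x\<in>?J. increments (\<lambda>i s. B i s \<omega>) k ?\<delta> x"
  have std: "standard_BM M (B i)" for i using BM by (simp add: indep_standard_BMs_def)
  have m: "(\<lambda>\<omega>. ennreal (exp (\<theta> * path_max \<omega> j (n - j) N))) \<in> borel_measurable (PiM ?J (\<lambda>_. borel))"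
    using path_max_noise_measurable[OF j, of N 1] unfolding measurable_noise by measurable
  have I: "?I \<in> measurable M (PiM ?J (\<lambda>_. borel))"
    by (intro measurable_restrict increments_measurable[OF BM] less_imp_le d)
  have "(\<integral>\<^sup>+\<omega>. ennreal (exp (\<theta> * path_max \<omega> j (n - j) N)) \<partial>noise (sqrt ?\<delta>) n N)
     = (\<integral>\<^sup>+\<omega>. ennreal (exp (\<theta> * path_max (?I \<omega>) j (n - j) N)) \<partial>M)"
    unfolding joint_increments[OF BM d N, symmetric, of n k] by (rule nn_integral_distr[OF I]) (simp add: m)
  also have "\<dots> = (\<integral>\<^sup>+\<omega>. ennreal (exp (\<theta> * grid_passage (\<lambda>i s. B i s \<omega>) (k + int j) (n - j) t N)) \<partial>M)"
    unfolding grid_passage_eq_path_max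
    by (intro nn_integral_cong arg_cong[where f="\<lambda>z. ennreal (exp (\<theta> * z))"] path_max_cong) (use j in auto)
  finally show ?thesis by simp
qed

text \<open>An auxiliary motion k - 1 is placed below as label 0 of the chain. It carries the
  window, and its factor exp (t v^2 / 2) is divided out; the remaining bound is free of N.\<close>

lemma grid_moment_le:
  assumes BM: "indep_standard_BMs M B" and t: "t > 0" and N: "N > 0" and v: "v > 0" "u > v" "\<theta> = u - v"
  shows "(\<integral>\<^sup>+\<omega>. ennreal (exp (\<theta> * grid_passage (\<lambda>i s. B i s \<omega>) k d t N)) \<partial>M)
     \<le> ennreal ((u / v) ^ d * exp (t * (u\<^sup>2 - v\<^sup>2) / 2))"
proof -
  let ?\<sigma> = "sqrt (t / real N)"
  have s: "?\<sigma> > 0" using t N by simp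
  have s2: "?\<sigma>\<^sup>2 = t / real N" using t N by simp
  let ?m = "\<integral>\<^sup>+\<omega>. ennreal (exp (\<theta> * path_max \<omega> 1 (Suc d - 1) N)) \<partial>noise ?\<sigma> (Suc d) N"
  have "ennreal (exp (real N * (v\<^sup>2 * ?\<sigma>\<^sup>2 / 2))) * ?m \<le> ennreal ((u / v) ^ (Suc d - 1) * exp (real N * (u\<^sup>2 * ?\<sigma>\<^sup>2 / 2)))"
    using mixed_mom_1_le[OF s v, of "Suc d" N] row0_factor[OF s, of 1 "Suc d" N v \<theta>] by simp
  then have "ennreal (exp (t * v\<^sup>2 / 2)) * ?m \<le> ennreal ((u / v) ^ d * exp (t * u\<^sup>2 / 2))"
    unfolding s2 using N by (simp add: field_simps)
  then have "ennreal (exp (- (t * v\<^sup>2 / 2))) * (ennreal (exp (t * v\<^sup>2 / 2)) * ?m) \<le> ennreal (exp (- (t * v\<^sup>2 / 2))) * ennreal ((u / v) ^ d * exp (t * u\<^sup>2 / 2))"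
    by (rule mult_left_mono) simp
  also have "ennreal (exp (- (t * v\<^sup>2 / 2))) * (ennreal (exp (t * v\<^sup>2 / 2)) * ?m) = ?m"
    by (simp flip: mult.assoc ennreal_mult exp_add)
  also have "ennreal (exp (- (t * v\<^sup>2 / 2))) * ennreal ((u / v) ^ d * exp (t * u\<^sup>2 / 2)) = ennreal (exp (- (t * v\<^sup>2 / 2)) * ((u / v) ^ d * exp (t * u\<^sup>2 / 2)))"
    using v by (intro ennreal_mult[symmetric]) auto
  also have "exp (- (t * v\<^sup>2 / 2)) * ((u / v) ^ d * exp (t * u\<^sup>2 / 2)) = (u / v) ^ d * exp (t * (u\<^sup>2 - v\<^sup>2) / 2)"
    by (simp add: mult.left_commute diff_divide_distrib right_diff_distrib flip: exp_add)
  finally show ?thesis using grid_moment[OF BM t N, of 1 "Suc d" \<theta> "k - 1"] by simp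
qed

section \<open>Discretising the Brownian last passage times\<close>

lemma path_max_attained_path:
  "\<exists>g. g 0 = 0 \<and> g (Suc d) = \<tau> \<and> (\<forall>i\<le>d. g i \<le> g (Suc i)) \<and> path_max \<omega> 0 d \<tau> = (\<Sum>i\<le>d. row_sum \<omega> i (g i) (g (Suc i)))"
proof (induction d arbitrary: \<tau>)
  case 0
  show ?case by (intro exI[of _ "\<lambda>i. if i = 0 then 0 else \<tau>"]) simp
next
  case (Suc d)
  obtain \<sigma> where s: "\<sigma> \<le> \<tau>" "path_max \<omega> 0 (Suc d) \<tau> = path_max \<omega> 0 d \<sigma> + row_sum \<omega> (Suc d) \<sigma> \<tau>"
    using path_max_attained[of \<tau> \<omega> 0 d] by auto
  obtain g where g: "g 0 = 0" "g (Suc d) = \<sigma>" "\<forall>i\<le>d. g i \<le> g (Suc i)" "path_max \<omega> 0 d \<sigma> = (\<Sum>i\<le>d. row_sum \<omega> i (g i) (g (Suc i)))"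
    using Suc by blast
  have "(\<Sum>i\<le>d. row_sum \<omega> i ((g(Suc (Suc d) := \<tau>)) i) ((g(Suc (Suc d) := \<tau>)) (Suc i))) = (\<Sum>i\<le>d. row_sum \<omega> i (g i) (g (Suc i)))"
    by (intro sum.cong) auto
  then show ?case using s g by (intro exI[of _ "g(Suc (Suc d) := \<tau>)"]) (auto simp: le_Suc_eq)
qed

lemma path_max_ge_path:
  assumes "g 0 = 0" "g (Suc d) = \<tau>" "\<And>i. i \<le> d \<Longrightarrow> g i \<le> g (Suc i)"
  shows "(\<Sum>i\<le>d. row_sum \<omega> i (g i) (g (Suc i))) \<le> path_max \<omega> 0 d \<tau>"
  using assms
proof (induction d arbitrary: \<tau>)
  case 0 then show ?case by simp
next
  case (Suc d)
  have "(\<Sum>i\<le>d. row_sum \<omega> i (g i) (g (Suc i))) \<le> path_max \<omega> 0 d (g (Suc d))" using Suc by simp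
  moreover have "g (Suc d) \<le> \<tau>" using Suc.prems by blast
  ultimately show ?case using path_max_ge[of "g (Suc d)" \<tau> \<omega> 0 d] Suc.prems by simp
qed

lemma row_sum_increments:
  assumes "a \<le> c"
  shows "row_sum (increments b k \<delta>) i a c = b (k + int i) (real c * \<delta>) - b (k + int i) (real a * \<delta>)"
  using assms
proof (induction c rule: dec_induct)
  case base then show ?case by (simp add: row_sum_def)
next
  case (step c) then show ?case by (simp add: row_sum_Suc increments_def)
qed

lemma sum_labels:
  fixes f :: "int \<Rightarrow> real"
  shows "(\<Sum>i=k..k + int d. f i) = (\<Sum>j\<le>d. f (k + int j))"
proof -
  have "bij_betw (\<lambda>j. k + int j) {..d} {k..k + int d}"
    by (rule bij_betwI[of _ _ _ "\<lambda>i. nat (i - k)"]) auto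
  then show ?thesis by (rule sum.reindex_bij_betw[symmetric])
qed

lemma grid_passage_le_last_passage:
  assumes t: "t > 0" and N: "N > 0"
  shows "ereal (grid_passage b k d t N) \<le> last_passage b k (k + int d) t"
proof -
  let ?\<delta> = "t / real N"
  from path_max_attained_path[of d N "increments b k ?\<delta>"]
  obtain g where g: "g 0 = 0" "g (Suc d) = N" "\<forall>i\<le>d. g i \<le> g (Suc i)"
    "grid_passage b k d t N = (\<Sum>i\<le>d. row_sum (increments b k ?\<delta>) i (g i) (g (Suc i)))"
    unfolding grid_passage_def by auto
  \<comment> \<open>Time splits are indexed from k - 1 and \<open>g\<close> from 0, hence the shift
    by one.\<close>
  define s where "s i = real (g (nat (i - k + 1))) * ?\<delta>" for i
  have [simp]: "nat (1 + int j) = Suc j" for j by simp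
  have "s \<in> time_splits k (k + int d) t" unfolding time_splits_def
  proof (safe)
    show "s (k - 1) = 0" using g by (simp add: s_def)
    show "s (k + int d) = t" using g N by (simp add: s_def add.commute)
    fix i assume i: "i \<in> {k..k + int d}"
    then have "nat (i - k + 1) = Suc (nat (i - k))" "nat (i - k) \<le> d" by auto
    then show "s (i - 1) \<le> s i" using g(3) t unfolding s_def
      by (intro mult_right_mono) auto
  qed
  moreover have "(\<Sum>i=k..k + int d. b i (s i) - b i (s (i - 1))) = grid_passage b k d t N"
    unfolding g(4) sum_labels
  proof (rule sum.cong[OF refl])
    fix j assume "j \<in> {..d}"
    then show "b (k + int j) (s (k + int j)) - b (k + int j) (s (k + int j - 1)) = row_sum (increments b k ?\<delta>) j (g j) (g (Suc j))"
      using g(3) by (subst row_sum_increments) (auto simp: s_def add.commute)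
  qed
  ultimately show ?thesis unfolding last_passage_def by (intro SUP_upper2) auto
qed

text \<open>One time split already exceeds c. Rounding it down to the grid keeps its order and both
  endpoints, and path continuity makes the rounded values converge, so the strict inequality
  persists.\<close>

lemma grid_passage_eventually_gt:
  assumes t: "t > 0" and cont: "\<And>i. continuous_on {0..} (b i)"
    and c: "ereal c < last_passage b k (k + int d) t"
  shows "\<forall>\<^sub>F N in sequentially. c < grid_passage b k d t N"
proof -
  obtain s where s: "s \<in> time_splits k (k + int d) t" "c < (\<Sum>i=k..k + int d. b i (s i) - b i (s (i - 1)))"
    using c unfolding last_passage_def less_SUP_iff by auto
  define r where "r i = s (k - 1 + int i)" for i
  have r0: "r 0 = 0" and rd: "r (Suc d) = t" using s(1) by (auto simp: time_splits_def r_def)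
  have rm: "r i \<le> r (Suc i)" if "i \<le> d" for i
  proof -
    have "s (k + int i - 1) \<le> s (k + int i)" using s(1) that unfolding time_splits_def by auto
    then show ?thesis by (simp add: r_def algebra_simps)
  qed
  have rnn: "0 \<le> r i" if "i \<le> Suc d" for i
    using that by (induction i) (use r0 rm in \<open>auto intro: order_trans\<close>)
  define g where "g N i = nat \<lfloor>r i / (t / real N)\<rfloor>" for N i
  define x where "x N i = real (g N i) * (t / real N)" for N i
  have x: "(\<lambda>N. x N i) \<longlonglongrightarrow> r i" if i: "i \<le> Suc d" for i
  proof (rule tendsto_sandwich)
    show "\<forall>\<^sub>F N in sequentially. r i - t / real N \<le> x N i"
      using eventually_gt_at_top[of 0]
    proof eventually_elim
      case (elim N)
      have d: "t / real N > 0" using elim t by simp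
      have "r i / (t / real N) - 1 \<le> real (g N i)" using rnn[OF i] d unfolding g_def by linarith
      from mult_right_mono[OF this less_imp_le[OF d]]
      have "(r i / (t / real N) - 1) * (t / real N) \<le> x N i" unfolding x_def .
      moreover have "(z / h - 1) * h = z - h" if "h > 0" for z h :: real using that by (simp add: left_diff_distrib)
      ultimately show ?case using d by (simp only:)
    qed
    show "\<forall>\<^sub>F N in sequentially. x N i \<le> r i"
      using eventually_gt_at_top[of 0]
    proof eventually_elim
      case (elim N)
      have d: "t / real N > 0" using elim t by simp
      have "0 \<le> r i / (t / real N)" by (rule divide_nonneg_pos[OF rnn[OF i] d])
      then have "real (g N i) \<le> r i / (t / real N)" unfolding g_def by linarith
      from mult_right_mono[OF this less_imp_le[OF d]]
      have "x N i \<le> r i / (t / real N) * (t / real N)" unfolding x_def .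
      moreover have "z / h * h = z" if "h > 0" for z h :: real using that by simp
      ultimately show ?case using d by (simp only:)
    qed
    have "(\<lambda>N. t / real N) \<longlonglongrightarrow> 0" by (rule lim_const_over_n)
    from tendsto_diff[OF tendsto_const[of "r i"] this] show "(\<lambda>N. r i - t / real N) \<longlonglongrightarrow> r i" by simp
  qed simp
  have xnn: "0 \<le> x N i" for N i using t by (simp add: x_def)
  have lim: "(\<lambda>N. \<Sum>j\<le>d. b (k + int j) (x N (Suc j)) - b (k + int j) (x N j)) \<longlonglongrightarrow> (\<Sum>j\<le>d. b (k + int j) (r (Suc j)) - b (k + int j) (r j))"
  proof (intro tendsto_sum tendsto_diff)
    fix j assume "j \<in> {..d}"
    then have j: "j \<le> Suc d" "Suc j \<le> Suc d" by auto
    show "(\<lambda>N. b (k + int j) (x N (Suc j))) \<longlonglongrightarrow> b (k + int j) (r (Suc j))"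
      by (rule continuous_on_tendsto_compose[OF cont x]) (use j rnn xnn in auto)
    show "(\<lambda>N. b (k + int j) (x N j)) \<longlonglongrightarrow> b (k + int j) (r j)"
      by (rule continuous_on_tendsto_compose[OF cont x]) (use j rnn xnn in auto)
  qed
  have "(\<Sum>i=k..k + int d. b i (s i) - b i (s (i - 1))) = (\<Sum>j\<le>d. b (k + int j) (r (Suc j)) - b (k + int j) (r j))"
    unfolding sum_labels by (intro sum.cong) (auto simp: r_def algebra_simps)
  with s(2) have "\<forall>\<^sub>F N in sequentially. c < (\<Sum>j\<le>d. b (k + int j) (x N (Suc j)) - b (k + int j) (x N j))"
    by (intro order_tendstoD(1)[OF lim]) simp
  then show ?thesis using eventually_gt_at_top[of 0]
  proof eventually_elim
    case (elim N)
    have d: "t / real N > 0" using elim t by simp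
    have gm: "g N i \<le> g N (Suc i)" if "i \<le> d" for i
      unfolding g_def using rm[OF that] d by (intro nat_mono floor_mono divide_right_mono) auto
    have "(\<Sum>j\<le>d. b (k + int j) (x N (Suc j)) - b (k + int j) (x N j)) = (\<Sum>j\<le>d. row_sum (increments b k (t / real N)) j (g N j) (g N (Suc j)))"
      using gm by (intro sum.cong) (auto simp: row_sum_increments x_def)
    also have "\<dots> \<le> path_max (increments b k (t / real N)) 0 d N"
      by (rule path_max_ge_path) (use gm r0 rd t elim in \<open>auto simp: g_def\<close>)
    finally show ?case using elim unfolding grid_passage_def by simp
  qed
qed

section \<open>The flat process in terms of countably many grid values\<close>

lemma grid_passage_measurable:
  assumes "indep_standard_BMs M B" "t \<ge> 0"
  shows "(\<lambda>\<omega>. grid_passage (\<lambda>i s. B i s \<omega>) k d t N) \<in> borel_measurable M"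
  unfolding grid_passage_def
  by (intro borel_measurable_path_max increments_measurable[OF assms(1)]) (use assms(2) in auto)

lemma x_flat_gt_iff_last_passage:
  "ereal c < x_flat B n t \<omega> \<longleftrightarrow> (\<exists>d. ereal (c - real_of_int n + real d) < last_passage (\<lambda>i s. B i s \<omega>) (n - int d) n t)"
proof -
  let ?b = "\<lambda>i s. B i s \<omega>"
  have "ereal c < x_flat B n t \<omega> \<longleftrightarrow> (\<exists>k\<in>{..n}. ereal c < ereal (real_of_int k) + last_passage ?b k n t)"
    unfolding x_flat_def reflected_system_def by (rule less_SUP_iff)
  also have "\<dots> \<longleftrightarrow> (\<exists>d. ereal c < ereal (real_of_int (n - int d)) + last_passage ?b (n - int d) n t)"
  proof
    assume "\<exists>k\<in>{..n}. ereal c < ereal (real_of_int k) + last_passage ?b k n t"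
    then obtain k where "k \<le> n" "ereal c < ereal (real_of_int k) + last_passage ?b k n t" by auto
    then show "\<exists>d. ereal c < ereal (real_of_int (n - int d)) + last_passage ?b (n - int d) n t"
      by (intro exI[of _ "nat (n - k)"]) simp
  next
    assume "\<exists>d. ereal c < ereal (real_of_int (n - int d)) + last_passage ?b (n - int d) n t"
    then obtain d where "ereal c < ereal (real_of_int (n - int d)) + last_passage ?b (n - int d) n t" by blast
    then show "\<exists>k\<in>{..n}. ereal c < ereal (real_of_int k) + last_passage ?b k n t"
      by (intro bexI[of _ "n - int d"]) auto
  qed
  also have "\<dots> \<longleftrightarrow> (\<exists>d. ereal (c - real_of_int n + real d) < last_passage ?b (n - int d) n t)"
  proof -
    have "ereal c < ereal (real_of_int (n - int d)) + y \<longleftrightarrow> ereal (c - real_of_int n + real d) < y" for y d by (cases y) auto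
    then show ?thesis by simp
  qed
  finally show ?thesis .
qed

text \<open>The label is fixed before N. The union bound then runs over d alone, with a limit in N
  inside each event.\<close>

lemma x_flat_gt_eventually:
  assumes BM: "indep_standard_BMs M B" and t: "t > 0" and w: "\<omega> \<in> space M" and "ereal c < x_flat B n t \<omega>"
  shows "\<exists>d. \<forall>\<^sub>F N in sequentially. c - real_of_int n + real d < grid_passage (\<lambda>i s. B i s \<omega>) (n - int d) d t N"
proof -
  from iffD1[OF x_flat_gt_iff_last_passage assms(4)]
  obtain d where d: "ereal (c - real_of_int n + real d) < last_passage (\<lambda>i s. B i s \<omega>) (n - int d) n t" ..
  have cont: "continuous_on {0..} (\<lambda>s. B i s \<omega>)" for i
    using BM w by (simp add: indep_standard_BMs_def standard_BM_def)
  have "\<forall>\<^sub>F N in sequentially. c - real_of_int n + real d < grid_passage (\<lambda>i s. B i s \<omega>) (n - int d) d t N"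
    by (rule grid_passage_eventually_gt[OF t cont]) (use d in simp)
  then show ?thesis ..
qed

text \<open>Replaces the uncountable suprema by countably many measurable quantities.\<close>

lemma x_flat_gt_iff:
  assumes BM: "indep_standard_BMs M B" and t: "t > 0" and w: "\<omega> \<in> space M"
  shows "ereal c < x_flat B n t \<omega> \<longleftrightarrow> (\<exists>d. \<exists>N>0. c < real_of_int n - real d + grid_passage (\<lambda>i s. B i s \<omega>) (n - int d) d t N)"
proof
  assume "ereal c < x_flat B n t \<omega>"
  then obtain d where "\<forall>\<^sub>F N in sequentially. c - real_of_int n + real d < grid_passage (\<lambda>i s. B i s \<omega>) (n - int d) d t N"
    using x_flat_gt_eventually[OF assms] by blast
  from eventually_happens[OF eventually_conj[OF this eventually_gt_at_top[of 0]]]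
  obtain N where "c - real_of_int n + real d < grid_passage (\<lambda>i s. B i s \<omega>) (n - int d) d t N" "N > 0" by auto
  then show "\<exists>d. \<exists>N>0. c < real_of_int n - real d + grid_passage (\<lambda>i s. B i s \<omega>) (n - int d) d t N"
    by (intro exI[of _ d] exI[of _ N]) simp
next
  assume "\<exists>d. \<exists>N>0. c < real_of_int n - real d + grid_passage (\<lambda>i s. B i s \<omega>) (n - int d) d t N"
  then obtain d N where N: "N > 0" "c < real_of_int n - real d + grid_passage (\<lambda>i s. B i s \<omega>) (n - int d) d t N" by blast
  then have "ereal (c - real_of_int n + real d) < ereal (grid_passage (\<lambda>i s. B i s \<omega>) (n - int d) d t N)" by simp
  also have "\<dots> \<le> last_passage (\<lambda>i s. B i s \<omega>) (n - int d) n t"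
    using grid_passage_le_last_passage[OF t N(1), of "\<lambda>i s. B i s \<omega>" "n - int d" d] by simp
  finally show "ereal c < x_flat B n t \<omega>" unfolding x_flat_gt_iff_last_passage by blast
qed

text \<open>The weak inequality at c is the intersection of the strict ones at c - 1 / (q +
  1).\<close>

lemma x_flat_tail_measurable:
  assumes BM: "indep_standard_BMs M B" and t: "t > 0"
  shows "{\<omega> \<in> space M. x_flat B n t \<omega> \<ge> ereal c} \<in> sets M"
proof -
  have "{\<omega> \<in> space M. x_flat B n t \<omega> \<ge> ereal c}
     = {\<omega> \<in> space M. \<forall>q. \<exists>d. \<exists>N\<in>{0<..}. c - 1 / real (Suc q) < real_of_int n - real d + grid_passage (\<lambda>i s. B i s \<omega>) (n - int d) d t N}"
  proof (intro Collect_cong conj_cong refl)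
    fix \<omega> assume w: "\<omega> \<in> space M"
    have "ereal c \<le> y \<longleftrightarrow> (\<forall>q. ereal (c - 1 / real (Suc q)) < y)" for y :: ereal
    proof
      assume "ereal c \<le> y"
      then show "\<forall>q. ereal (c - 1 / real (Suc q)) < y" by (auto intro: less_le_trans[of _ "ereal c"])
    next
      assume *: "\<forall>q. ereal (c - 1 / real (Suc q)) < y"
      show "ereal c \<le> y"
      proof (rule ccontr)
        assume "\<not> ereal c \<le> y"
        then have "y < ereal c" by simp
        then obtain z where z: "y < ereal z" "z < c" using ereal_dense2[of y "ereal c"] by auto
        obtain q where "1 / real (Suc q) < c - z" using z nat_approx_posE[of "c - z"] by auto
        then have "ereal z \<le> ereal (c - 1 / real (Suc q))" by simp
        with * z show False by (metis less_le_not_le order.strict_trans2)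
      qed
    qed
    then show "ereal c \<le> x_flat B n t \<omega> \<longleftrightarrow> (\<forall>q. \<exists>d. \<exists>N\<in>{0<..}. c - 1 / real (Suc q) < real_of_int n - real d + grid_passage (\<lambda>i s. B i s \<omega>) (n - int d) d t N)"
      using x_flat_gt_iff[OF BM t w, where n = n] by (simp add: Bex_def)
  qed
  also have "\<dots> \<in> sets M"
  proof -
    note [measurable] = grid_passage_measurable[OF BM less_imp_le[OF t]]
    show ?thesis by measurable
  qed
  finally show ?thesis .
qed

lemma grid_passage_le_x_flat:
  assumes BM: "indep_standard_BMs M B" and t: "t > 0" and w: "\<omega> \<in> space M" and N: "N > 0"
  shows "ereal (real_of_int n - real d + grid_passage (\<lambda>i s. B i s \<omega>) (n - int d) d t N) \<le> x_flat B n t \<omega>"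
proof (rule ccontr)
  assume "\<not> ?thesis"
  then have "x_flat B n t \<omega> < ereal (real_of_int n - real d + grid_passage (\<lambda>i s. B i s \<omega>) (n - int d) d t N)" by simp
  then obtain z where "x_flat B n t \<omega> < ereal z" "z < real_of_int n - real d + grid_passage (\<lambda>i s. B i s \<omega>) (n - int d) d t N"
    using ereal_dense2 by (metis less_ereal.simps(1))
  then show False using x_flat_gt_iff[OF BM t w, of z n] N by auto
qed

lemma exp_Markov:
  assumes "prob_space M" and [measurable]: "X \<in> borel_measurable M" and "\<theta> > 0"
  shows "emeasure M {\<omega> \<in> space M. c < X \<omega>} \<le> ennreal (exp (- \<theta> * c)) * (\<integral>\<^sup>+\<omega>. ennreal (exp (\<theta> * X \<omega>)) \<partial>M)"
proof -
  have "emeasure M {\<omega> \<in> space M. c < X \<omega>} = (\<integral>\<^sup>+\<omega>. indicator {\<omega> \<in> space M. c < X \<omega>} \<omega> \<partial>M)" by simp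
  also have "\<dots> \<le> (\<integral>\<^sup>+\<omega>. ennreal (exp (- \<theta> * c)) * ennreal (exp (\<theta> * X \<omega>)) \<partial>M)"
    using assms(3)
    by (intro nn_integral_mono) (auto simp: indicator_def simp flip: ennreal_mult exp_add intro!: ennreal_leI)
  also have "\<dots> = ennreal (exp (- \<theta> * c)) * (\<integral>\<^sup>+\<omega>. ennreal (exp (\<theta> * X \<omega>)) \<partial>M)"
    by (rule nn_integral_cmult) measurable
  finally show ?thesis .
qed

text \<open>The event is an increasing union whose pieces each lie in a single grid event. As the
  moment bound is uniform in N, continuity from below gives the bound without summing over
  N.\<close>

lemma last_passage_tail:
  assumes BM: "indep_standard_BMs M B" and t: "t > 0" and v: "v > 0" "u > v" "\<theta> = u - v"
  shows "emeasure M {\<omega> \<in> space M. \<forall>\<^sub>F N in sequentially. c < grid_passage (\<lambda>i s. B i s \<omega>) k d t N}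
    \<le> ennreal (exp (- \<theta> * c) * ((u / v) ^ d * exp (t * (u\<^sup>2 - v\<^sup>2) / 2)))"
proof -
  have PM: "prob_space M" using BM by (simp add: indep_standard_BMs_def standard_BM_def)
  note [measurable] = grid_passage_measurable[OF BM less_imp_le[OF t]]
  define A where "A n0 = {\<omega> \<in> space M. \<forall>N\<ge>Suc n0. c < grid_passage (\<lambda>i s. B i s \<omega>) k d t N}" for n0
  have eq: "{\<omega> \<in> space M. \<forall>\<^sub>F N in sequentially. c < grid_passage (\<lambda>i s. B i s \<omega>) k d t N} = (\<Union>n0. A n0)"
  proof -
    have "(\<forall>\<^sub>F N in sequentially. P N) \<longleftrightarrow> (\<exists>n0. \<forall>N\<ge>Suc n0. P N)" for P
      unfolding eventually_sequentially by (metis Suc_leD le_SucI)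
    then show ?thesis by (auto simp: A_def)
  qed
  have "incseq A" unfolding A_def incseq_def by auto
  moreover have "range A \<subseteq> sets M" unfolding A_def by auto
  ultimately have "emeasure M (\<Union>n0. A n0) = (SUP n0. emeasure M (A n0))" by (intro SUP_emeasure_incseq[symmetric])
  also have "\<dots> \<le> ennreal (exp (- \<theta> * c) * ((u / v) ^ d * exp (t * (u\<^sup>2 - v\<^sup>2) / 2)))"
  proof (rule SUP_least)
    fix n0
    have "emeasure M (A n0) \<le> emeasure M {\<omega> \<in> space M. c < grid_passage (\<lambda>i s. B i s \<omega>) k d t (Suc n0)}"
      by (rule emeasure_mono) (auto simp: A_def)
    also have "\<dots> \<le> ennreal (exp (- \<theta> * c)) * (\<integral>\<^sup>+\<omega>. ennreal (exp (\<theta> * grid_passage (\<lambda>i s. B i s \<omega>) k d t (Suc n0))) \<partial>M)"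
      by (rule exp_Markov[OF PM]) (use v in auto)
    also have "\<dots> \<le> ennreal (exp (- \<theta> * c)) * ennreal ((u / v) ^ d * exp (t * (u\<^sup>2 - v\<^sup>2) / 2))"
      by (intro mult_left_mono grid_moment_le[OF BM t _ v]) auto
    also have "\<dots> = ennreal (exp (- \<theta> * c) * ((u / v) ^ d * exp (t * (u\<^sup>2 - v\<^sup>2) / 2)))"
      using v by (intro ennreal_mult[symmetric]) auto
    finally show "emeasure M (A n0) \<le> \<dots>" .
  qed
  finally show ?thesis unfolding eq .
qed

section \<open>Lower bound for the exponential moments\<close>

lemma ennreal_le_of_power2_le:
  assumes "x\<^sup>2 \<le> ennreal (r\<^sup>2)" "r \<ge> 0" shows "x \<le> ennreal r"
proof (cases x)
  case (real y)
  then have "y\<^sup>2 \<le> r\<^sup>2" using assms by (simp add: ennreal_power)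
  then show ?thesis using real assms(2) by (auto intro!: ennreal_leI power2_le_imp_le)
next
  case top
  then show ?thesis using assms(1) by (simp add: top_unique)
qed

text \<open>Cauchy-Schwarz separates the tilt of row 0 from the passage. Doubling \<theta> is
  matched by 2 u and 2 v, which keeps the ratio u / v, so only the square root of (u / v) ^ n
  appears. Against the weight (v / u) ^ n of the bottom label this leaves a factor that decays in
  n.\<close>

lemma mixed_mom_0_le:
  assumes BM: "indep_standard_BMs M B" and t: "t > 0" and N: "N > 0" and n: "n > 0" and v: "v > 0" "u > v" "\<theta> = u - v"
  shows "mixed_mom (sqrt (t / real N)) n N v \<theta> 0 \<le> ennreal (exp (t * v\<^sup>2) * sqrt ((u / v) ^ n) * exp (t * (u\<^sup>2 - v\<^sup>2)))"
proof (rule ennreal_le_of_power2_le)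
  let ?\<sigma> = "sqrt (t / real N)"
  have s: "?\<sigma> > 0" using t N by simp
  have s2: "?\<sigma>\<^sup>2 = t / real N" using t N by simp
  interpret prob_space "noise ?\<sigma> n N" by (rule prob_space_noise[OF s])
  note [measurable] = row_sum_noise_measurable[of N ?\<sigma> n] path_max_noise_measurable[of 0 n N ?\<sigma>, simplified]
  have "(mixed_mom ?\<sigma> n N v \<theta> 0)\<^sup>2 \<le> (\<integral>\<^sup>+\<omega>. (ennreal (exp (v * row_sum \<omega> 0 0 N)))\<^sup>2 \<partial>noise ?\<sigma> n N) *
     (\<integral>\<^sup>+\<omega>. (ennreal (exp (\<theta> * path_max \<omega> 0 n N)))\<^sup>2 \<partial>noise ?\<sigma> n N)"
    unfolding mixed_mom_def diff_zero by (rule Cauchy_Schwarz_nn_integral) measurable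
  \<comment> \<open>The squared tilt is a mixed moment with \<theta> = 0, so
    \<open>row0_factor\<close> gives its exact value.\<close>
  also have "(\<integral>\<^sup>+\<omega>. (ennreal (exp (v * row_sum \<omega> 0 0 N)))\<^sup>2 \<partial>noise ?\<sigma> n N) = mixed_mom ?\<sigma> n N (2 * v) 0 n"
    unfolding mixed_mom_def by (simp add: ennreal_power flip: exp_of_nat_mult) (simp add: mult.assoc)
  also have "\<dots> = ennreal (exp (2 * t * v\<^sup>2))"
    using row0_factor[OF s n order_refl, of N "2 * v" 0] N
    by (simp add: emeasure_space_1 s2 power_mult_distrib)
  also have "(\<integral>\<^sup>+\<omega>. (ennreal (exp (\<theta> * path_max \<omega> 0 n N)))\<^sup>2 \<partial>noise ?\<sigma> n N) = (\<integral>\<^sup>+\<omega>. ennreal (exp (2 * \<theta> * path_max \<omega> 0 (n - 0) N)) \<partial>noise ?\<sigma> n N)"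
    by (simp add: ennreal_power flip: exp_of_nat_mult) (simp add: mult.assoc)
  also have "\<dots> = (\<integral>\<^sup>+\<omega>. ennreal (exp (2 * \<theta> * grid_passage (\<lambda>i s. B i s \<omega>) (0 + int 0) (n - 0) t N)) \<partial>M)"
    by (rule grid_moment[OF BM t N, symmetric]) simp
  also have "\<dots> \<le> ennreal ((2 * u / (2 * v)) ^ (n - 0) * exp (t * ((2 * u)\<^sup>2 - (2 * v)\<^sup>2) / 2))"
    by (rule grid_moment_le[OF BM t N]) (use v in auto)
  also have "ennreal (exp (2 * t * v\<^sup>2)) * \<dots> = ennreal (exp (2 * t * v\<^sup>2) * ((2 * u / (2 * v)) ^ (n - 0) * exp (t * ((2 * u)\<^sup>2 - (2 * v)\<^sup>2) / 2)))"
    using v by (intro ennreal_mult[symmetric]) auto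
  also have "exp (2 * t * v\<^sup>2) * ((2 * u / (2 * v)) ^ (n - 0) * exp (t * ((2 * u)\<^sup>2 - (2 * v)\<^sup>2) / 2))
     = (exp (t * v\<^sup>2) * sqrt ((u / v) ^ n) * exp (t * (u\<^sup>2 - v\<^sup>2)))\<^sup>2"
  proof -
    have "(2 * u)\<^sup>2 - (2 * v)\<^sup>2 = 4 * (u\<^sup>2 - v\<^sup>2)" by (simp add: power_mult_distrib)
    then have 1: "exp (t * ((2 * u)\<^sup>2 - (2 * v)\<^sup>2) / 2) = (exp (t * (u\<^sup>2 - v\<^sup>2)))\<^sup>2"
      by (simp flip: exp_of_nat_mult)
    have 2: "exp (2 * t * v\<^sup>2) = (exp (t * v\<^sup>2))\<^sup>2" by (simp add: mult.assoc flip: exp_of_nat_mult)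
    have 3: "(sqrt ((u / v) ^ n))\<^sup>2 = (u / v) ^ n" using v by simp
    have 4: "2 * u / (2 * v) = u / v" by simp
    have 5: "(a * q * c)\<^sup>2 = a\<^sup>2 * (q\<^sup>2 * c\<^sup>2)" for a q c :: real by (simp add: power_mult_distrib)
    show ?thesis unfolding 5 3 4 diff_zero 1 2 ..
  qed
  finally show "(mixed_mom ?\<sigma> n N v \<theta> 0)\<^sup>2 \<le> ennreal ((exp (t * v\<^sup>2) * sqrt ((u / v) ^ n) * exp (t * (u\<^sup>2 - v\<^sup>2)))\<^sup>2)"
    by (simp add: mult_left_mono)
qed (use v in auto)

text \<open>The mesh N depends on n and e but is common to all labels d, so one discretisation
  serves the whole sum.\<close>

lemma moment_sum_lower:
  assumes BM: "indep_standard_BMs M B" and t: "t > 0" and n: "n > 0" and v: "v > 0" "u > v" "\<theta> = u - v" and e: "e > 0"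
  shows "\<exists>N>0. ennreal (exp (t * (u\<^sup>2 - v\<^sup>2) / 2) / 2) \<le> ennreal (exp (\<theta> * (real n * e))) *
    ((\<Sum>d<n. ennreal ((v / u) ^ d) * (\<integral>\<^sup>+\<omega>. ennreal (exp (\<theta> * grid_passage (\<lambda>i s. B i s \<omega>) (m - int d) d t N)) \<partial>M))
     + ennreal (sqrt ((v / u) ^ n) * exp (t * (u\<^sup>2 - v\<^sup>2 / 2))))"
proof -
  have u: "u > 0" using v by simp
  from eventually_happens[OF eventually_conj[OF truncated_product_eventually[OF t u e, of n] eventually_gt_at_top[of 0]]]
  obtain N where N: "N > 0" and big: "ennreal (exp (u\<^sup>2 * t / 2) / 2) \<le>
     ((\<integral>\<^sup>+w. gauss (sqrt (t / real N)) w * indicator {- e / 2..e / 2} w \<partial>lborel) ^ n *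
       mgf (\<lambda>w. gauss (sqrt (t / real N)) w * indicator {- e / 2..e / 2} w) u) ^ N" by auto
  define \<sigma> where "\<sigma> = sqrt (t / real N)"
  have s: "\<sigma> > 0" using t N by (simp add: \<sigma>_def)
  have s2: "real N * \<sigma>\<^sup>2 = t" using t N by (simp add: \<sigma>_def)
  define E where "E d = (\<integral>\<^sup>+\<omega>. ennreal (exp (\<theta> * grid_passage (\<lambda>i s. B i s \<omega>) (m - int d) d t N)) \<partial>M)" for d
  \<comment> \<open>Clears the factor 1 / v ^ n of the test function and the tilt exp (t v^2 / 2) of
    row 0. What remains for the label d below the top is (v / u) ^ d.\<close>
  define W where "W = v ^ n * exp (- (t * v\<^sup>2 / 2))"
  have W: "W > 0" using v by (simp add: W_def)
  define c where "c j = exp (\<theta> * (real (n - j) * e)) / (v ^ j * u ^ (n - j))" for j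
  have c: "c j > 0" for j using v u by (simp add: c_def)
  have "ennreal (exp (u\<^sup>2 * t / 2) / 2) * ennreal (1 / v ^ n) \<le> (\<Sum>j\<le>n. ennreal (c j) * mixed_mom \<sigma> n N v \<theta> j)"
    unfolding c_def
    by (rule order_trans[OF mult_right_mono[OF big[folded \<sigma>_def]] truncated_lower_bound[OF s v n e]]) simp
  then have "ennreal W * (ennreal (exp (u\<^sup>2 * t / 2) / 2) * ennreal (1 / v ^ n)) \<le> ennreal W * (\<Sum>j\<le>n. ennreal (c j) * mixed_mom \<sigma> n N v \<theta> j)"
    by (rule mult_left_mono) simp
  also have "ennreal W * (ennreal (exp (u\<^sup>2 * t / 2) / 2) * ennreal (1 / v ^ n)) = ennreal (exp (t * (u\<^sup>2 - v\<^sup>2) / 2) / 2)"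
  proof -
    have "ennreal W * (ennreal (exp (u\<^sup>2 * t / 2) / 2) * ennreal (1 / v ^ n)) = ennreal (W * (exp (u\<^sup>2 * t / 2) / 2 * (1 / v ^ n)))"
      using v W by (simp flip: ennreal_mult)
    also have "W * (exp (u\<^sup>2 * t / 2) / 2 * (1 / v ^ n)) = exp (- (t * v\<^sup>2 / 2)) * exp (u\<^sup>2 * t / 2) / 2"
      using v by (simp add: W_def)
    also have "exp (- (t * v\<^sup>2 / 2)) * exp (u\<^sup>2 * t / 2) = exp (t * (u\<^sup>2 - v\<^sup>2) / 2)"
      by (simp add: algebra_simps diff_divide_distrib flip: exp_add)
    finally show ?thesis .
  qed
  also have "(\<Sum>j\<le>n. ennreal (c j) * mixed_mom \<sigma> n N v \<theta> j) = (\<Sum>d\<le>n. ennreal (c (n - d)) * mixed_mom \<sigma> n N v \<theta> (n - d))"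
    by (rule sum.reindex_bij_witness[of _ "\<lambda>d. n - d" "\<lambda>d. n - d"]) auto
  also have "\<dots> = (\<Sum>d<n. ennreal (c (n - d)) * mixed_mom \<sigma> n N v \<theta> (n - d)) + ennreal (c 0) * mixed_mom \<sigma> n N v \<theta> 0"
    by (simp add: lessThan_Suc_atMost[symmetric])
  also have "ennreal W * \<dots> = (\<Sum>d<n. ennreal (W * c (n - d)) * mixed_mom \<sigma> n N v \<theta> (n - d)) + ennreal (W * c 0) * mixed_mom \<sigma> n N v \<theta> 0"
    using W c by (simp add: distrib_left sum_distrib_left mult.assoc ennreal_mult less_imp_le)
  also have "\<dots> \<le> (\<Sum>d<n. ennreal (exp (\<theta> * (real n * e))) * (ennreal ((v / u) ^ d) * E d))
      + ennreal (exp (\<theta> * (real n * e))) * ennreal (sqrt ((v / u) ^ n) * exp (t * (u\<^sup>2 - v\<^sup>2 / 2)))"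
  proof (intro add_mono sum_mono)
    fix d assume d: "d \<in> {..<n}"
    have "mixed_mom \<sigma> n N v \<theta> (n - d) = ennreal (exp (real N * (v\<^sup>2 * \<sigma>\<^sup>2 / 2))) * (\<integral>\<^sup>+\<omega>. ennreal (exp (\<theta> * path_max \<omega> (n - d) (n - (n - d)) N)) \<partial>noise \<sigma> n N)"
      by (rule row0_factor[OF s]) (use d in auto)
    also have "(\<integral>\<^sup>+\<omega>. ennreal (exp (\<theta> * path_max \<omega> (n - d) (n - (n - d)) N)) \<partial>noise \<sigma> n N) = E d"
      unfolding \<sigma>_def E_def using grid_moment[OF BM t N, of "n - d" n \<theta> "m - int n"] d by (simp add: of_nat_diff)
    also have "real N * (v\<^sup>2 * \<sigma>\<^sup>2 / 2) = t * v\<^sup>2 / 2" using s2 by (simp add: mult.left_commute mult.commute)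
    finally have mixed_mom: "mixed_mom \<sigma> n N v \<theta> (n - d) = ennreal (exp (t * v\<^sup>2 / 2)) * E d" .
    have "W * c (n - d) * exp (t * v\<^sup>2 / 2) = exp (\<theta> * (real d * e)) * (v / u) ^ d"
    proof -
      have "v ^ n = v ^ (n - d) * v ^ d" using d by (simp flip: power_add)
      moreover have "exp (- (t * v\<^sup>2 / 2)) * exp (t * v\<^sup>2 / 2) = 1" by (simp flip: exp_add)
      ultimately show ?thesis using d v u
        unfolding W_def c_def by (simp add: power_divide field_simps)
    qed
    also have "\<dots> \<le> exp (\<theta> * (real n * e)) * (v / u) ^ d"
      using d v u e by (intro mult_right_mono) (auto intro!: mult_left_mono mult_right_mono)
    finally have "ennreal (W * c (n - d) * exp (t * v\<^sup>2 / 2)) * E d \<le> ennreal (exp (\<theta> * (real n * e)) * (v / u) ^ d) * E d"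
      by (intro mult_right_mono ennreal_leI) auto
    then show "ennreal (W * c (n - d)) * mixed_mom \<sigma> n N v \<theta> (n - d) \<le> ennreal (exp (\<theta> * (real n * e))) * (ennreal ((v / u) ^ d) * E d)"
      unfolding mixed_mom using W c[of "n - d"] v u by (simp add: ennreal_mult less_imp_le mult.assoc)
  next
    have "ennreal (W * c 0) * mixed_mom \<sigma> n N v \<theta> 0 \<le> ennreal (W * c 0) * ennreal (exp (t * v\<^sup>2) * sqrt ((u / v) ^ n) * exp (t * (u\<^sup>2 - v\<^sup>2)))"
      using mixed_mom_0_le[OF BM t N n v] by (intro mult_left_mono) (auto simp: \<sigma>_def)
    also have "\<dots> = ennreal (W * c 0 * (exp (t * v\<^sup>2) * sqrt ((u / v) ^ n) * exp (t * (u\<^sup>2 - v\<^sup>2))))"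
      using W c[of 0] v by (intro ennreal_mult[symmetric]) auto
    also have "W * c 0 * (exp (t * v\<^sup>2) * sqrt ((u / v) ^ n) * exp (t * (u\<^sup>2 - v\<^sup>2)))
       = exp (\<theta> * (real n * e)) * (sqrt ((v / u) ^ n) * exp (t * (u\<^sup>2 - v\<^sup>2 / 2)))"
    proof -
      have 1: "v ^ n / u ^ n * sqrt ((u / v) ^ n) = sqrt ((v / u) ^ n)"
      proof -
        have "v ^ n / u ^ n = sqrt ((v / u) ^ n) * sqrt ((v / u) ^ n)" using v u by (simp add: power_divide)
        moreover have "sqrt ((v / u) ^ n) * sqrt ((u / v) ^ n) = 1"
          using v u by (simp add: power_divide flip: real_sqrt_mult)
        ultimately show ?thesis by (simp only: mult.assoc mult_1_right)
      qed
      have 2: "exp (- (t * v\<^sup>2 / 2)) * exp (t * v\<^sup>2) * exp (t * (u\<^sup>2 - v\<^sup>2)) = exp (t * (u\<^sup>2 - v\<^sup>2 / 2))"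
        by (simp add: algebra_simps flip: exp_add)
      have "W * c 0 * (exp (t * v\<^sup>2) * sqrt ((u / v) ^ n) * exp (t * (u\<^sup>2 - v\<^sup>2)))
        = exp (\<theta> * (real n * e)) * ((v ^ n / u ^ n * sqrt ((u / v) ^ n)) * (exp (- (t * v\<^sup>2 / 2)) * exp (t * v\<^sup>2) * exp (t * (u\<^sup>2 - v\<^sup>2))))"
        unfolding W_def c_def by simp
      then show ?thesis unfolding 1 2 .
    qed
    also have "ennreal \<dots> = ennreal (exp (\<theta> * (real n * e))) * ennreal (sqrt ((v / u) ^ n) * exp (t * (u\<^sup>2 - v\<^sup>2 / 2)))"
      using v u by (intro ennreal_mult) auto
    finally show "ennreal (W * c 0) * mixed_mom \<sigma> n N v \<theta> 0 \<le> ennreal (exp (\<theta> * (real n * e))) * ennreal (sqrt ((v / u) ^ n) * exp (t * (u\<^sup>2 - v\<^sup>2 / 2)))" .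
  qed
  finally have "ennreal (exp (t * (u\<^sup>2 - v\<^sup>2) / 2) / 2) \<le> ennreal (exp (\<theta> * (real n * e))) *
    ((\<Sum>d<n. ennreal ((v / u) ^ d) * E d) + ennreal (sqrt ((v / u) ^ n) * exp (t * (u\<^sup>2 - v\<^sup>2 / 2))))"
    by (simp only: sum_distrib_left distrib_left)
  then show ?thesis using N unfolding E_def by blast
qed

text \<open>The shift by \<open>d\<close> is the flat initial position \<open>t - d\<close> of the starting label, relative to \<open>t\<close>.\<close>
definition flat_moment :: "'a measure \<Rightarrow> (int \<Rightarrow> real \<Rightarrow> 'a \<Rightarrow> real) \<Rightarrow> real \<Rightarrow> nat \<Rightarrow> nat \<Rightarrow> nat \<Rightarrow> ennreal" where
  "flat_moment M B \<theta> t N d =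
     (\<integral>\<^sup>+\<omega>. ennreal (exp (\<theta> * (grid_passage (\<lambda>i s. B i s \<omega>) (int t - int d) d (real t) N - real d))) \<partial>M)"

lemma flat_moment_eq:
  assumes BM: "indep_standard_BMs M B"
  shows "flat_moment M B \<theta> t N d = ennreal (exp (- \<theta> * real d)) *
    (\<integral>\<^sup>+\<omega>. ennreal (exp (\<theta> * grid_passage (\<lambda>i s. B i s \<omega>) (int t - int d) d (real t) N)) \<partial>M)"
proof -
  note [measurable] = grid_passage_measurable[OF BM, of "real t"]
  have "flat_moment M B \<theta> t N d = (\<integral>\<^sup>+\<omega>. ennreal (exp (- \<theta> * real d)) * ennreal (exp (\<theta> * grid_passage (\<lambda>i s. B i s \<omega>) (int t - int d) d (real t) N)) \<partial>M)"
    unfolding flat_moment_def by (intro nn_integral_cong) (simp add: algebra_simps flip: ennreal_mult exp_add)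
  also have "\<dots> = ennreal (exp (- \<theta> * real d)) *
    (\<integral>\<^sup>+\<omega>. ennreal (exp (\<theta> * grid_passage (\<lambda>i s. B i s \<omega>) (int t - int d) d (real t) N)) \<partial>M)"
    by (rule nn_integral_cmult) simp
  finally show ?thesis .
qed

lemma flat_cgf_eq: assumes "v = small_root \<theta>" "u = v + \<theta>" shows "flat_cgf \<theta> = (u\<^sup>2 - v\<^sup>2) / 2"
  using assms by (simp add: flat_cgf_def power2_eq_square field_simps)

lemma flat_moment_le:
  assumes BM: "indep_standard_BMs M B" and t: "t > 0" and N: "N > 0" and th: "\<theta> > 0"
  shows "flat_moment M B \<theta> t N d \<le> ennreal (exp (real t * flat_cgf \<theta>))"
proof -
  define v where "v = small_root \<theta>"
  define u where "u = v + \<theta>"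
  have v: "v > 0" "u > v" "\<theta> = u - v" using small_root_pos[OF th] th by (simp_all add: v_def u_def)
  have uv: "u / v = exp \<theta>" using small_root_eq[OF th] v(1) by (simp add: v_def u_def field_simps)
  have "flat_moment M B \<theta> t N d \<le> ennreal (exp (- \<theta> * real d)) * ennreal ((u / v) ^ d * exp (real t * (u\<^sup>2 - v\<^sup>2) / 2))"
    unfolding flat_moment_eq[OF BM] by (intro mult_left_mono grid_moment_le[OF BM _ N v]) (use t in auto)
  also have "\<dots> = ennreal (exp (- \<theta> * real d) * (exp (real d * \<theta>) * exp (real t * (u\<^sup>2 - v\<^sup>2) / 2)))"
    unfolding uv by (simp flip: ennreal_mult exp_of_nat_mult)
  also have "exp (- \<theta> * real d) * (exp (real d * \<theta>) * exp (real t * (u\<^sup>2 - v\<^sup>2) / 2)) = exp (real t * flat_cgf \<theta>)"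
    using flat_cgf_eq[OF v_def u_def] by (simp add: mult.commute flip: exp_add)
  finally show ?thesis .
qed

lemma flat_moment_sum_ge:
  assumes BM: "indep_standard_BMs M B" and th: "\<theta> > 0"
  shows "\<exists>K>0. \<forall>\<eta>>0. \<forall>\<^sub>F t in sequentially. \<exists>N>0. ennreal (exp (real t * (flat_cgf \<theta> - \<eta>)) / 4) \<le> (\<Sum>d<K * t. flat_moment M B \<theta> t N d)"
proof -
  define v where "v = small_root \<theta>"
  define u where "u = v + \<theta>"
  have v: "v > 0" "u > v" "\<theta> = u - v" using small_root_pos[OF th] th by (simp_all add: v_def u_def)
  have u: "u > 0" using v by simp
  have uv: "v / u = exp (- \<theta>)" using small_root_eq[OF th] v(1) u by (simp add: v_def u_def exp_minus field_simps)
  \<comment> \<open>The decay exp (- \<theta> K t / 2) of the bottom-label term has to beat exp (t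
    u^2) with a margin exp (- t).\<close>
  obtain K :: nat where K: "real K > 2 * (u\<^sup>2 + 1) / \<theta>" using reals_Archimedean2 by blast
  have "2 * (u\<^sup>2 + 1) / \<theta> > 0" using th by (simp add: add_nonneg_pos)
  then have K0: "K > 0" using K by (cases K) auto
  have Lam0: "flat_cgf \<theta> > 0" unfolding flat_cgf_def using th small_root_pos[OF th] by (simp add: add_pos_pos)
  show ?thesis
  proof (intro exI[of _ K] conjI K0 allI impI)
    fix \<eta> :: real assume eta: "\<eta> > 0"
    \<comment> \<open>At most half of that margin is spent on the gap cost exp (\<eta>' t).\<close>
    define \<eta>' where "\<eta>' = min \<eta> (1 / 2)"
    have e1: "\<eta>' > 0" "\<eta>' \<le> \<eta>" "\<eta>' \<le> 1 / 2" using eta by (auto simp: \<eta>'_def)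
    \<comment> \<open>Makes the total gap cost \<theta> (K t) e equal to \<eta>' t.\<close>
    define e where "e = \<eta>' / (\<theta> * real K)"
    have e: "e > 0" using e1 th K0 by (simp add: e_def)
    show "\<forall>\<^sub>F t in sequentially. \<exists>N>0. ennreal (exp (real t * (flat_cgf \<theta> - \<eta>)) / 4) \<le> (\<Sum>d<K * t. flat_moment M B \<theta> t N d)"
      \<comment> \<open>From t = 4 on, exp (- t / 2) is at most exp (- 2) \<le> 1 / 4, so the
        bottom-label term takes at most half of the left side.\<close>
      using eventually_ge_at_top[of 4]
    proof eventually_elim
      case (elim t)
      then have t: "real t > 0" "t > 0" by auto
      have n: "K * t > 0" using K0 t by simp
      from moment_sum_lower[OF BM t(1) n v e, of "int t"]
      obtain N where N: "N > 0" and le: "ennreal (exp (real t * (u\<^sup>2 - v\<^sup>2) / 2) / 2) \<le> ennreal (exp (\<theta> * (real (K * t) * e))) *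
        ((\<Sum>d<K * t. ennreal ((v / u) ^ d) * (\<integral>\<^sup>+\<omega>. ennreal (exp (\<theta> * grid_passage (\<lambda>i s. B i s \<omega>) (int t - int d) d (real t) N)) \<partial>M))
         + ennreal (sqrt ((v / u) ^ (K * t)) * exp (real t * (u\<^sup>2 - v\<^sup>2 / 2))))" by auto
      define S where "S = (\<Sum>d<K * t. flat_moment M B \<theta> t N d)"
      have S: "(\<Sum>d<K * t. ennreal ((v / u) ^ d) * (\<integral>\<^sup>+\<omega>. ennreal (exp (\<theta> * grid_passage (\<lambda>i s. B i s \<omega>) (int t - int d) d (real t) N)) \<partial>M)) = S"
        unfolding S_def flat_moment_eq[OF BM] uv by (intro sum.cong refl) (simp add: mult.commute flip: exp_of_nat_mult)
      have te: "\<theta> * (real (K * t) * e) = \<eta>' * real t" using th K0 by (simp add: e_def)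
      have L: "real t * (u\<^sup>2 - v\<^sup>2) / 2 = real t * flat_cgf \<theta>" using flat_cgf_eq[OF v_def u_def] by simp
      have small: "exp (\<eta>' * real t) * (sqrt ((v / u) ^ (K * t)) * exp (real t * (u\<^sup>2 - v\<^sup>2 / 2))) \<le> exp (real t * flat_cgf \<theta>) / 4"
      proof -
        have "sqrt ((v / u) ^ (K * t)) = exp (- (\<theta> * real K / 2) * real t)"
        proof (rule real_sqrt_unique)
          show "(exp (- (\<theta> * real K / 2) * real t))\<^sup>2 = (v / u) ^ (K * t)"
            unfolding uv by (simp add: mult_ac flip: exp_of_nat_mult)
        qed simp
        then have "exp (\<eta>' * real t) * (sqrt ((v / u) ^ (K * t)) * exp (real t * (u\<^sup>2 - v\<^sup>2 / 2)))
          = exp (real t * (\<eta>' - \<theta> * real K / 2 + u\<^sup>2 - v\<^sup>2 / 2))"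
          by (simp add: algebra_simps flip: exp_add)
        also have "\<dots> \<le> exp (real t * (- (1 / 2)))"
        proof -
          have "\<theta> * real K / 2 \<ge> u\<^sup>2 + 1" using K th by (simp add: field_simps)
          moreover have "v\<^sup>2 / 2 \<ge> 0" by simp
          ultimately have "\<eta>' - \<theta> * real K / 2 + u\<^sup>2 - v\<^sup>2 / 2 \<le> - (1 / 2)" using e1 by linarith
          then show ?thesis by (simp only: exp_le_cancel_iff) (rule mult_left_mono, simp_all)
        qed
        also have "\<dots> \<le> exp (- 2)" using elim by simp
        also have "exp (- 2 :: real) \<le> 1 / 4"
        proof -
          have "(2::real) \<le> exp 1" using exp_ge_add_one_self[of "1::real"] by simp
          then have "2 * 2 \<le> exp 1 * exp (1::real)" by (intro mult_mono) auto
          then have "4 \<le> exp (2::real)" by (simp flip: exp_add)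
          then show ?thesis by (simp add: exp_minus field_simps)
        qed
        also have "\<dots> \<le> exp (real t * flat_cgf \<theta>) / 4" using Lam0 by simp
        finally show ?thesis .
      qed
      have "ennreal (exp (real t * (flat_cgf \<theta> - \<eta>)) / 4) \<le> S"
      proof (cases S)
        case (real x)
        have "ennreal (exp (real t * flat_cgf \<theta>) / 2) \<le> ennreal (exp (\<eta>' * real t) * (x + sqrt ((v / u) ^ (K * t)) * exp (real t * (u\<^sup>2 - v\<^sup>2 / 2))))"
        proof -
          have "ennreal (a * (b + c)) = ennreal a * (ennreal b + ennreal c)" if "0 \<le> a" "0 \<le> b" "0 \<le> c" for a b c :: real
            using that by (simp add: ennreal_mult)
          then show ?thesis using le real(1) v(1) u unfolding S te L real(2) by simp
        qed
        then have "exp (real t * flat_cgf \<theta>) / 2 \<le> exp (\<eta>' * real t) * (x + sqrt ((v / u) ^ (K * t)) * exp (real t * (u\<^sup>2 - v\<^sup>2 / 2)))"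
          using real v u by (subst (asm) ennreal_le_iff) auto
        then have "exp (real t * flat_cgf \<theta>) / 4 \<le> exp (\<eta>' * real t) * x" using small by (simp add: distrib_left)
        then have "exp (- (\<eta>' * real t)) * (exp (real t * flat_cgf \<theta>) / 4) \<le> exp (- (\<eta>' * real t)) * (exp (\<eta>' * real t) * x)"
          by (rule mult_left_mono) simp
        then have "exp (real t * (flat_cgf \<theta> - \<eta>')) / 4 \<le> x"
          by (simp add: algebra_simps flip: mult.assoc exp_add)
        moreover have "exp (real t * (flat_cgf \<theta> - \<eta>)) \<le> exp (real t * (flat_cgf \<theta> - \<eta>'))"
          using e1 t by simp
        ultimately have "exp (real t * (flat_cgf \<theta> - \<eta>)) / 4 \<le> x" by linarith
        then show ?thesis using real by (simp only: ennreal_leI)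
      qed simp
      then show ?case using N unfolding S_def by blast
    qed
  qed
qed

section \<open>The large deviation limit\<close>

definition flat_tail :: "'a measure \<Rightarrow> (int \<Rightarrow> real \<Rightarrow> 'a \<Rightarrow> real) \<Rightarrow> real \<Rightarrow> nat \<Rightarrow> 'a set" where
  "flat_tail M B a t = {\<omega> \<in> space M. x_flat B (int t) (real t) \<omega> \<ge> ereal (2 * real t + a * real t)}"

lemma flat_tail_sets: "indep_standard_BMs M B \<Longrightarrow> t > 0 \<Longrightarrow> flat_tail M B a t \<in> sets M"
  unfolding flat_tail_def by (rule x_flat_tail_measurable) auto

lemma linear_exp_small:
  assumes "c > 0" "A > 0" "b > 0"
  shows "\<forall>\<^sub>F t::nat in sequentially. A * real t * exp (- (c * real t)) \<le> b"
proof -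
  have "\<forall>\<^sub>F t::nat in sequentially. real t \<ge> 2 * A / (c\<^sup>2 * b) + 1"
    by (rule eventually_compose_filterlim[OF eventually_ge_at_top filterlim_real_sequentially])
  then show ?thesis
  proof eventually_elim
    case (elim t)
    have "0 < 2 * A / (c\<^sup>2 * b)" using assms by simp
    then have t: "real t > 0" "real t \<ge> 2 * A / (c\<^sup>2 * b)" using elim by auto
    have "(c * real t)\<^sup>2 / 2 \<le> exp (c * real t)"
    proof -
      have "0 \<le> c * real t" using assms(1) t by simp
      then show ?thesis using exp_lower_Taylor_quadratic[of "c * real t"] by linarith
    qed
    moreover have "A * real t \<le> b * ((c * real t)\<^sup>2 / 2)"
    proof -
      have "2 * A \<le> real t * (c\<^sup>2 * b)" using t(2) assms by (simp add: field_simps)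
      then have "2 * A * real t \<le> real t * (c\<^sup>2 * b) * real t" using t by (intro mult_right_mono) auto
      then show ?thesis by (simp add: power2_eq_square algebra_simps)
    qed
    ultimately have "A * real t \<le> b * exp (c * real t)"
      using assms(3) by (meson mult_left_mono less_imp_le order_trans)
    then show ?case by (simp add: exp_minus divide_inverse[symmetric] pos_divide_le_eq)
  qed
qed

text \<open>Exponential tilting: contributions of values outside \<open>[(1 + a) t, (1 + a') t]\<close> are charged to the
  moments at \<open>\<theta>1\<close> and \<open>\<theta>2\<close>.\<close>
lemma flat_moment_split:
  assumes BM: "indep_standard_BMs M B" and t: "t > 0" and N: "N > 0"
    and th: "0 < \<theta>1" "\<theta>1 < \<theta>" "\<theta> < \<theta>2"
  shows "flat_moment M B \<theta> t N d \<le> ennreal (exp (real t * ((\<theta> - \<theta>1) * (1 + a) + flat_cgf \<theta>1)))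
     + ennreal (exp (real t * (flat_cgf \<theta>2 - (\<theta>2 - \<theta>) * (1 + a')))) + ennreal (exp (real t * (\<theta> * (1 + a'))) * measure M (flat_tail M B a t))"
proof -
  interpret prob_space M using BM by (simp add: indep_standard_BMs_def standard_BM_def)
  define D where "D \<omega> = grid_passage (\<lambda>i s. B i s \<omega>) (int t - int d) d (real t) N - real d" for \<omega>
  have [measurable]: "D \<in> borel_measurable M" unfolding D_def[abs_def]
    by (intro borel_measurable_diff grid_passage_measurable[OF BM]) auto
  have [measurable]: "flat_tail M B a t \<in> sets M" by (rule flat_tail_sets[OF BM t])
  define L where "L = (1 + a) * real t"
  define L' where "L' = (1 + a') * real t"
  have "flat_moment M B \<theta> t N d = (\<integral>\<^sup>+\<omega>. ennreal (exp (\<theta> * D \<omega>)) \<partial>M)"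
    unfolding flat_moment_def D_def ..
  also have "\<dots> \<le> (\<integral>\<^sup>+\<omega>. ennreal (exp ((\<theta> - \<theta>1) * L)) * ennreal (exp (\<theta>1 * D \<omega>)) + ennreal (exp (- (\<theta>2 - \<theta>) * L')) * ennreal (exp (\<theta>2 * D \<omega>))
      + ennreal (exp (\<theta> * L')) * indicator (flat_tail M B a t) \<omega> \<partial>M)"
  proof (rule nn_integral_mono)
    fix \<omega> assume w: "\<omega> \<in> space M"
    consider "D \<omega> < L" | "D \<omega> > L'" | "L \<le> D \<omega>" "D \<omega> \<le> L'" by linarith
    then show "ennreal (exp (\<theta> * D \<omega>)) \<le> ennreal (exp ((\<theta> - \<theta>1) * L)) * ennreal (exp (\<theta>1 * D \<omega>)) + ennreal (exp (- (\<theta>2 - \<theta>) * L')) * ennreal (exp (\<theta>2 * D \<omega>))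
      + ennreal (exp (\<theta> * L')) * indicator (flat_tail M B a t) \<omega>"
    proof cases
      case 1
      have "(\<theta> - \<theta>1) * D \<omega> \<le> (\<theta> - \<theta>1) * L" using 1 th by (intro mult_left_mono) auto
      then have "\<theta> * D \<omega> \<le> (\<theta> - \<theta>1) * L + \<theta>1 * D \<omega>" by (simp add: algebra_simps)
      then have "ennreal (exp (\<theta> * D \<omega>)) \<le> ennreal (exp ((\<theta> - \<theta>1) * L)) * ennreal (exp (\<theta>1 * D \<omega>))"
        by (simp add: ennreal_leI flip: ennreal_mult exp_add)
      then show ?thesis by (simp add: add.assoc add_increasing2)
    next
      case 2
      have "(\<theta>2 - \<theta>) * L' \<le> (\<theta>2 - \<theta>) * D \<omega>" using 2 th by (intro mult_left_mono) auto
      then have "\<theta> * D \<omega> \<le> - (\<theta>2 - \<theta>) * L' + \<theta>2 * D \<omega>" by (simp add: algebra_simps)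
      then have "ennreal (exp (\<theta> * D \<omega>)) \<le> ennreal (exp (- (\<theta>2 - \<theta>) * L')) * ennreal (exp (\<theta>2 * D \<omega>))"
        by (simp add: ennreal_leI flip: ennreal_mult exp_add)
      then show ?thesis by (simp add: add.assoc add_increasing add_increasing2)
    next
      case 3
      \<comment> \<open>The starting label sits at t - d, so t + D is a lower bound for the flat
        process. At D \<ge> (1 + a) t it reaches the level (2 + a) t.\<close>
      have "ereal (2 * real t + a * real t) \<le> ereal (real_of_int (int t) - real d + grid_passage (\<lambda>i s. B i s \<omega>) (int t - int d) d (real t) N)"
        using 3(1) by (simp add: D_def L_def algebra_simps)
      also have "\<dots> \<le> x_flat B (int t) (real t) \<omega>"
        by (rule grid_passage_le_x_flat[OF BM _ w N]) (use t in simp)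
      finally have "\<omega> \<in> flat_tail M B a t" using w by (simp add: flat_tail_def)
      moreover have "\<theta> * D \<omega> \<le> \<theta> * L'" using 3 th by (intro mult_left_mono) auto
      ultimately show ?thesis by (simp add: ennreal_leI add_increasing)
    qed
  qed
  also have "\<dots> = ennreal (exp ((\<theta> - \<theta>1) * L)) * flat_moment M B \<theta>1 t N d + ennreal (exp (- (\<theta>2 - \<theta>) * L')) * flat_moment M B \<theta>2 t N d
      + ennreal (exp (\<theta> * L')) * emeasure M (flat_tail M B a t)"
    unfolding flat_moment_def D_def[symmetric] by (simp add: nn_integral_add nn_integral_cmult)
  also have "\<dots> \<le> ennreal (exp ((\<theta> - \<theta>1) * L)) * ennreal (exp (real t * flat_cgf \<theta>1)) + ennreal (exp (- (\<theta>2 - \<theta>) * L')) * ennreal (exp (real t * flat_cgf \<theta>2))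
      + ennreal (exp (\<theta> * L')) * ennreal (measure M (flat_tail M B a t))"
    unfolding emeasure_eq_measure using th by (intro add_mono mult_left_mono flat_moment_le[OF BM t N]) auto
  also have "\<dots> = ennreal (exp (real t * ((\<theta> - \<theta>1) * (1 + a) + flat_cgf \<theta>1)))
     + ennreal (exp (real t * (flat_cgf \<theta>2 - (\<theta>2 - \<theta>) * (1 + a')))) + ennreal (exp (real t * (\<theta> * (1 + a'))) * measure M (flat_tail M B a t))"
    unfolding L_def L'_def by (simp add: algebra_simps flip: ennreal_mult exp_add)
  finally show ?thesis .
qed

text \<open>The tangents of the strictly convex \<open>flat_cgf\<close> at \<theta>1 and \<theta>2
  lie below it at \<theta> by g1 and g2. These gaps make the two outer terms of
  \<open>flat_moment_split\<close> exponentially small compared with the whole sum, so the tail must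
  carry the rest.\<close>

lemma flat_tail_lower:
  assumes BM: "indep_standard_BMs M B" and th: "0 < \<theta>1" "\<theta>1 < \<theta>" "\<theta> < \<theta>2" and eta: "\<eta> > 0"
  shows "\<exists>K>0. \<forall>\<^sub>F t in sequentially.
    exp (real t * (flat_cgf \<theta> - \<eta> - \<theta> * (1 + flat_speed \<theta>2))) \<le> 8 * real K * real t * measure M (flat_tail M B (flat_speed \<theta>1) t)"
proof -
  let ?a = "flat_speed \<theta>1" and ?a' = "flat_speed \<theta>2"
  define g1 where "g1 = flat_cgf \<theta> - (\<theta> - \<theta>1) * (1 + ?a) - flat_cgf \<theta>1"
  define g2 where "g2 = flat_cgf \<theta> + (\<theta>2 - \<theta>) * (1 + ?a') - flat_cgf \<theta>2"
  have g1: "g1 > 0" using objective_strict_max[of \<theta>1 \<theta>] th by (simp add: g1_def algebra_simps)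
  have g2: "g2 > 0" using objective_strict_max[of \<theta>2 \<theta>] th by (simp add: g2_def algebra_simps)
  \<comment> \<open>After the loss \<eta>1 \<le> c in the moment bound, a gap of at least c remains
    on both sides.\<close>
  define c where "c = min g1 g2 / 2"
  have c: "c > 0" "c \<le> g1 / 2" "c \<le> g2 / 2" using g1 g2 by (auto simp: c_def)
  define \<eta>1 where "\<eta>1 = min \<eta> c"
  have eta1: "\<eta>1 > 0" "\<eta>1 \<le> \<eta>" "\<eta>1 \<le> c" using eta c by (auto simp: \<eta>1_def)
  have "\<theta> > 0" using th by simp
  from flat_moment_sum_ge[OF BM this] obtain K where K: "K > 0"
    and ev: "\<forall>\<^sub>F t in sequentially. \<exists>N>0. ennreal (exp (real t * (flat_cgf \<theta> - \<eta>1)) / 4) \<le> (\<Sum>d<K * t. flat_moment M B \<theta> t N d)"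
    using eta1(1) by blast
  \<comment> \<open>The outer terms then take at most E / 16 each out of E / 4, where E is the
    tilted growth; E / 8 is left for the tail.\<close>
  have "\<forall>\<^sub>F t::nat in sequentially. real K * real t * exp (- (c * real t)) \<le> 1 / 16"
    by (rule linear_exp_small) (use c K in auto)
  from ev this eventually_gt_at_top[of 0]
  have "\<forall>\<^sub>F t in sequentially. exp (real t * (flat_cgf \<theta> - \<eta> - \<theta> * (1 + ?a'))) \<le> 8 * real K * real t * measure M (flat_tail M B ?a t)"
  proof eventually_elim
    case (elim t)
    then obtain N where N: "N > 0" and le: "ennreal (exp (real t * (flat_cgf \<theta> - \<eta>1)) / 4) \<le> (\<Sum>d<K * t. flat_moment M B \<theta> t N d)" by blast
    define P where "P = measure M (flat_tail M B ?a t)"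
    define k where "k = real K * real t"
    have k: "k \<ge> 0" by (simp add: k_def)
    define E where "E = exp (real t * (flat_cgf \<theta> - \<eta>1))"
    define E1 where "E1 = exp (real t * ((\<theta> - \<theta>1) * (1 + ?a) + flat_cgf \<theta>1))"
    define E2 where "E2 = exp (real t * (flat_cgf \<theta>2 - (\<theta>2 - \<theta>) * (1 + ?a')))"
    define E3 where "E3 = exp (real t * (\<theta> * (1 + ?a')))"
    have P0: "P \<ge> 0" by (simp add: P_def)
    have "ennreal (E / 4) \<le> (\<Sum>d<K * t. ennreal E1 + ennreal E2 + ennreal (E3 * P))"
      unfolding E_def E1_def E2_def E3_def P_def
      by (rule order_trans[OF le sum_mono]) (rule flat_moment_split[OF BM elim(3) N th])
    also have "\<dots> = ennreal (k * (E1 + E2 + E3 * P))"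
    proof -
      have "ennreal E1 + ennreal E2 + ennreal (E3 * P) = ennreal (E1 + E2 + E3 * P)"
        using P0 by (simp add: E1_def E2_def E3_def ennreal_plus)
      moreover have "of_nat (K * t) = ennreal k" by (simp only: k_def ennreal_of_nat_eq_real_of_nat of_nat_mult)
      moreover have "0 \<le> E1 + E2 + E3 * P" using P0 by (simp add: E1_def E2_def E3_def)
      ultimately show ?thesis by (simp only: sum_constant card_lessThan ennreal_mult[OF k])
    qed
    finally have "ennreal (E / 4) \<le> ennreal (k * (E1 + E2 + E3 * P))" .
    moreover have "0 \<le> k * (E1 + E2 + E3 * P)"
      using k P0 unfolding E1_def E2_def E3_def by (intro mult_nonneg_nonneg add_nonneg_nonneg) simp_all
    ultimately have "E / 4 \<le> k * (E1 + E2 + E3 * P)" by (rule iffD1[OF ennreal_le_iff, rotated])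
    moreover have bnd: "k * exp (real t * (flat_cgf \<theta> - g)) \<le> E / 16" if "c \<le> g / 2" for g
    proof -
      have "k * exp (real t * (flat_cgf \<theta> - g)) \<le> k * (exp (- (c * real t)) * E)"
      proof (rule mult_left_mono)
        have "flat_cgf \<theta> - g \<le> - c + (flat_cgf \<theta> - \<eta>1)" using that eta1 by linarith
        then have "real t * (flat_cgf \<theta> - g) \<le> real t * (- c + (flat_cgf \<theta> - \<eta>1))" by (rule mult_left_mono) simp
        then show "exp (real t * (flat_cgf \<theta> - g)) \<le> exp (- (c * real t)) * E"
          unfolding E_def exp_add[symmetric] by (simp add: algebra_simps)
      qed (rule k)
      also have "\<dots> = (k * exp (- (c * real t))) * E" by simp
      also have "\<dots> \<le> 1 / 16 * E" using elim(2) by (intro mult_right_mono) (auto simp: k_def E_def)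
      finally show ?thesis by simp
    qed
    moreover have "E1 = exp (real t * (flat_cgf \<theta> - g1))" "E2 = exp (real t * (flat_cgf \<theta> - g2))"
      unfolding E1_def E2_def g1_def g2_def by (simp_all add: algebra_simps)
    ultimately have "E / 8 \<le> k * (E3 * P)"
      using bnd[OF c(2)] bnd[OF c(3)] by (simp add: distrib_left)
    then have "E \<le> 8 * k * P * E3" by (simp add: mult_ac)
    then have "E * exp (- (real t * (\<theta> * (1 + ?a')))) \<le> 8 * k * P * E3 * exp (- (real t * (\<theta> * (1 + ?a'))))"
      by (rule mult_right_mono) simp
    also have "8 * k * P * E3 * exp (- (real t * (\<theta> * (1 + ?a')))) = 8 * k * P"
      unfolding E3_def by (simp add: mult.assoc flip: exp_add)
    also have "E * exp (- (real t * (\<theta> * (1 + ?a')))) = exp (real t * (flat_cgf \<theta> - \<eta>1 - \<theta> * (1 + ?a')))"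
      unfolding E_def by (simp add: algebra_simps flip: exp_add)
    finally have "exp (real t * (flat_cgf \<theta> - \<eta>1 - \<theta> * (1 + ?a'))) \<le> 8 * k * P" .
    moreover have "exp (real t * (flat_cgf \<theta> - \<eta> - \<theta> * (1 + ?a'))) \<le> exp (real t * (flat_cgf \<theta> - \<eta>1 - \<theta> * (1 + ?a')))"
      using eta1(2) by (simp add: mult_left_mono)
    ultimately have "exp (real t * (flat_cgf \<theta> - \<eta> - \<theta> * (1 + ?a'))) \<le> 8 * k * P" by linarith
    then show ?case unfolding k_def P_def by (simp only: mult.assoc)
  qed
  then show ?thesis using K by blast
qed

text \<open>A union bound over the starting labels. The optimal exponents give each of the nearest K
  t labels the same bound, and farther labels contribute a geometric series.\<close>

lemma flat_tail_upper:
  assumes BM: "indep_standard_BMs M B" and th: "\<theta> > 0" and a: "a > 0"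
  shows "\<exists>K C. C > 0 \<and> (\<forall>t>0. measure M (flat_tail M B a t)
      \<le> (real K * real t * exp \<theta> + C) * exp (- (real t * (\<theta> * (1 + a) - flat_cgf \<theta>))))"
proof -
  interpret prob_space M using BM by (simp add: indep_standard_BMs_def standard_BM_def)
  define r where "r = \<theta> * (1 + a) - flat_cgf \<theta>"
  \<comment> \<open>For labels far behind, the exponents \<open>u = 2\<close>, \<open>v = 1\<close> suffice, since \<open>u / v < exp (u - v)\<close>.\<close>
  define q where "q = 2 * exp (- 1 :: real)"
  have e2: "(2::real) < exp 1" using exp_gt_one_plus[of 1] by simp
  have q: "0 < q" "q < 1" using e2 by (auto simp: q_def exp_minus field_simps)
  \<comment> \<open>For u = 2 and v = 1 the moment factor is exp (3 t / 2). This K makes q ^ (K t)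
    absorb it and still supply exp (- r t).\<close>
  obtain K where K: "q ^ K < exp (- r - 3 / 2)" using real_arch_pow_inv[OF _ q(2), of "exp (- r - 3 / 2)"] by auto
  define C where "C = exp 1 / (1 - q)"
  have C: "C > 0" using q by (simp add: C_def)
  define v where "v = small_root \<theta>"
  define u where "u = v + \<theta>"
  have v: "v > 0" "u > v" "\<theta> = u - v" using small_root_pos[OF th] th by (simp_all add: v_def u_def)
  have uv: "u / v = exp \<theta>" using small_root_eq[OF th] v(1) by (simp add: v_def u_def field_simps)
  have bound: "measure M (flat_tail M B a t) \<le> (real K * real t * exp \<theta> + C) * exp (- (real t * r))" if t: "t > 0" for t :: nat
  proof -
    \<comment> \<open>The slack 1 turns the weak inequality into a strict one, at the price of the
      constants exp \<theta> and exp 1.\<close>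
    define c where "c = 2 * real t + a * real t - 1"
    define A where "A d = {\<omega> \<in> space M. \<forall>\<^sub>F N in sequentially. c - real t + real d < grid_passage (\<lambda>i s. B i s \<omega>) (int t - int d) d (real t) N}" for d
    have A: "A d \<in> sets M" for d
    proof -
      note [measurable] = grid_passage_measurable[OF BM, of "real t"]
      show ?thesis unfolding A_def eventually_sequentially by measurable
    qed
    define f where "f d = (if d < K * t then exp \<theta> * exp (- (real t * r)) else exp 1 * exp (- (real t * r)) * q ^ (d - K * t))" for d
    have f0: "f d \<ge> 0" for d using q by (simp add: f_def)
    have Af: "emeasure M (A d) \<le> ennreal (f d)" for d
    proof (cases "d < K * t")
      case True
      have "emeasure M (A d) \<le> ennreal (exp (- \<theta> * (c - real t + real d)) * ((u / v) ^ d * exp (real t * (u\<^sup>2 - v\<^sup>2) / 2)))"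
        unfolding A_def by (rule last_passage_tail[OF BM _ v]) (use t in simp)
      also have "exp (- \<theta> * (c - real t + real d)) * ((u / v) ^ d * exp (real t * (u\<^sup>2 - v\<^sup>2) / 2)) = f d"
      proof -
        have "real t * (u\<^sup>2 - v\<^sup>2) / 2 = real t * flat_cgf \<theta>" using flat_cgf_eq[OF v_def u_def] by simp
        moreover have "(u / v) ^ d = exp (real d * \<theta>)" unfolding uv by (simp add: exp_of_nat_mult)
        moreover have "- \<theta> * (c - real t + real d) + (real d * \<theta> + real t * flat_cgf \<theta>) = \<theta> + - (real t * r)"
          by (simp add: c_def r_def algebra_simps)
        ultimately show ?thesis using True unfolding f_def by (simp only: exp_add[symmetric] if_True)
      qed
      finally show ?thesis .
    next
      case False
      have "emeasure M (A d) \<le> ennreal (exp (- 1 * (c - real t + real d)) * ((2 / 1) ^ d * exp (real t * (2\<^sup>2 - 1\<^sup>2) / 2)))"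
        unfolding A_def by (rule last_passage_tail[OF BM]) (use t in auto)
      also have "\<dots> \<le> ennreal (f d)"
      proof (rule ennreal_leI)
        have qd: "q ^ d = 2 ^ d * exp (- real d)" unfolding q_def by (simp add: power_mult_distrib flip: exp_of_nat_mult)
        have "exp (- 1 * (c - real t + real d)) * ((2 / 1) ^ d * exp (real t * (2\<^sup>2 - 1\<^sup>2) / 2))
          = exp 1 * exp (real t * (3 / 2 - 1 - a)) * q ^ d"
          unfolding qd by (simp add: c_def algebra_simps flip: exp_add)
        also have "\<dots> \<le> exp 1 * exp (real t * (3 / 2)) * q ^ d"
        proof -
          have "real t * (3 / 2 - 1 - a) \<le> real t * (3 / 2)" using a by (intro mult_left_mono) auto
          then show ?thesis using q by (intro mult_right_mono mult_left_mono iffD2[OF exp_le_cancel_iff]) (use q a in simp_all)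
        qed
        also have "q ^ d = (q ^ K) ^ t * q ^ (d - K * t)"
          using False by (simp flip: power_mult power_add)
        also have "exp 1 * exp (real t * (3 / 2)) * ((q ^ K) ^ t * q ^ (d - K * t))
           \<le> exp 1 * exp (real t * (3 / 2)) * (exp (- r - 3 / 2) ^ t * q ^ (d - K * t))"
          using K q by (intro mult_left_mono mult_right_mono power_mono) auto
        also have "\<dots> = exp 1 * (exp (real t * (3 / 2)) * exp (- r - 3 / 2) ^ t) * q ^ (d - K * t)" by simp
        also have "exp (real t * (3 / 2)) * exp (- r - 3 / 2) ^ t = exp (- (real t * r))"
          by (simp add: algebra_simps flip: exp_of_nat_mult exp_add)
        finally show "exp (- 1 * (c - real t + real d)) * ((2 / 1) ^ d * exp (real t * (2\<^sup>2 - 1\<^sup>2) / 2)) \<le> f d"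
          using False by (simp add: f_def)
      qed
      finally show ?thesis .
    qed
    have sub: "flat_tail M B a t \<subseteq> (\<Union>d. A d)"
    proof
      fix \<omega> assume "\<omega> \<in> flat_tail M B a t"
      then have w: "\<omega> \<in> space M" and x: "ereal (2 * real t + a * real t) \<le> x_flat B (int t) (real t) \<omega>" by (auto simp: flat_tail_def)
      have "ereal c < ereal (2 * real t + a * real t)" by (simp add: c_def)
      from x_flat_gt_eventually[OF BM _ w less_le_trans[OF this x]] t
      show "\<omega> \<in> (\<Union>d. A d)" using w by (auto simp: A_def)
    qed
    have fs: "f sums (real (K * t) * (exp \<theta> * exp (- (real t * r))) + exp 1 * exp (- (real t * r)) * (1 / (1 - q)))"
    proof -
      have "(\<lambda>i. f (i + K * t)) sums (exp 1 * exp (- (real t * r)) * (1 / (1 - q)))"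
        unfolding f_def using sums_mult[OF geometric_sums[of q], of "exp 1 * exp (- (real t * r))"] q by simp
      moreover have "(\<Sum>d<K * t. f d) = real (K * t) * (exp \<theta> * exp (- (real t * r)))" by (simp add: f_def)
      ultimately show ?thesis using sums_iff_shift[of f "K * t"] by (simp add: add.commute)
    qed
    have "emeasure M (flat_tail M B a t) \<le> emeasure M (\<Union>d. A d)" using A by (intro emeasure_mono sub) auto
    also have "\<dots> \<le> (\<Sum>d. emeasure M (A d))" by (rule emeasure_subadditive_countably) (use A in auto)
    also have "\<dots> \<le> (\<Sum>d. ennreal (f d))" by (intro suminf_le Af) auto
    also have "\<dots> = ennreal (\<Sum>d. f d)" by (rule suminf_ennreal2) (use f0 fs in \<open>auto simp: sums_iff\<close>)
    finally have "measure M (flat_tail M B a t) \<le> (\<Sum>d. f d)"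
      using suminf_nonneg[of f] f0 fs by (simp add: emeasure_eq_measure sums_iff)
    also have "\<dots> = (real K * real t * exp \<theta> + C) * exp (- (real t * r))"
      using fs by (simp add: sums_iff C_def algebra_simps)
    finally show ?thesis .
  qed
  then show ?thesis using C unfolding r_def by (intro exI[of _ K] exI[of _ C]) auto
qed

theorem theorem2:
  fixes M :: "'a measure" and B :: "int \<Rightarrow> real \<Rightarrow> 'a \<Rightarrow> real" and a :: real
  assumes "indep_standard_BMs M B"
    and "a > 0"
  shows "((\<lambda>t::nat. ln (measure M {\<omega> \<in> space M.
              x_flat B (int t) (real t) \<omega> \<ge> ereal (2 * real t + a * real t)}) / real t)
            \<longlonglongrightarrow> - r_flat a) \<and>
         (\<exists>za\<in>{..<-1}.
            (za + 1) * (phi za + 1) + a = 0 \<and>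
            (\<forall>z\<in>{..<-1}. (z + 1) * (phi z + 1) + a = 0 \<longrightarrow> z = za) \<and>
            r_flat a = flat_objective a za \<and>
            (\<forall>z\<in>{..<-1}. flat_objective a z \<le> flat_objective a za))"
proof -
  \<comment> \<open>This \<theta> parametrises the maximiser, z_a = - (v + \<theta>) with v its
    small root.\<close>
  obtain \<theta> where th: "\<theta> > 0" "flat_speed \<theta> = a" using ex_flat_speed[OF assms(2)] .
  define r where "r = r_flat a"
  have r: "r = \<theta> * (1 + a) - flat_cgf \<theta>" unfolding r_def by (rule flat_rate_eq(1)[OF th])
  define P where "P t = measure M (flat_tail M B a t)" for t
  have ln0: "(\<lambda>t::nat. ln (k * real t + b) / real t) \<longlonglongrightarrow> 0" if "k \<ge> 0" "b > 0" for k b :: real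
  proof (rule tendsto_sandwich)
    have "(\<lambda>t::nat. ln b / real t) \<longlonglongrightarrow> 0" by (rule lim_const_over_n)
    then show "(\<lambda>t::nat. ln b / real t) \<longlonglongrightarrow> 0" .
    have "(\<lambda>t::nat. ln (k + b) / real t + ln (real t) / real t) \<longlonglongrightarrow> 0 + 0"
      by (intro tendsto_add lim_const_over_n lim_ln_over_n)
    then show "(\<lambda>t::nat. ln (k + b) / real t + ln (real t) / real t) \<longlonglongrightarrow> 0" by simp
    show "\<forall>\<^sub>F t::nat in sequentially. ln b / real t \<le> ln (k * real t + b) / real t"
      using that by (intro always_eventually allI divide_right_mono) (auto simp: add_nonneg_pos)
    show "\<forall>\<^sub>F t::nat in sequentially. ln (k * real t + b) / real t \<le> ln (k + b) / real t + ln (real t) / real t"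
      using eventually_gt_at_top[of 0]
    proof eventually_elim
      case (elim t)
      have "k * real t + b \<le> (k + b) * real t" using elim that by (simp add: distrib_right)
      then have "ln (k * real t + b) \<le> ln ((k + b) * real t)" using that elim by (intro ln_mono) (auto simp: add_nonneg_pos)
      also have "\<dots> = ln (k + b) + ln (real t)" using that elim by (intro ln_mult_pos) auto
      finally have "ln (k * real t + b) / real t \<le> (ln (k + b) + ln (real t)) / real t" by (rule divide_right_mono) simp
      then show ?case by (simp add: add_divide_distrib)
    qed
  qed
  have "(\<lambda>t. ln (P t) / real t) \<longlonglongrightarrow> - r"
  proof (rule LIMSEQ_I)
    fix \<epsilon> :: real assume eps: "\<epsilon> > 0"
    \<comment> \<open>Bounds the price of letting the upper speed in the tilting argument exceed a;
      it vanishes at \<theta> and is continuous there.\<close>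
    define h where "h x = x * (flat_speed x - a)" for x
    have "isCont flat_speed \<theta>" using flat_speed_DERIV[OF th(1)] DERIV_isCont by blast
    then have "isCont h \<theta>" unfolding h_def[abs_def] by (intro continuous_intros) auto
    then have "h \<midarrow>\<theta>\<rightarrow> h \<theta>" by (simp add: isCont_def)
    moreover have "h \<theta> = 0" using th by (simp add: h_def)
    ultimately have "\<forall>\<^sub>F x in at_right \<theta>. h x < \<epsilon> / 4"
      using eps by (intro order_tendstoD(2)[of h 0]) (auto simp: filterlim_at_split)
    from eventually_happens[OF eventually_conj[OF this eventually_at_right_less[of \<theta>]]]
    obtain \<theta>2 where th2: "h \<theta>2 < \<epsilon> / 4" "\<theta> < \<theta>2" by (auto simp: trivial_limit_at_right_real)
    \<comment> \<open>Tilting by an intermediate \<theta>' makes the lower speed exactly a, as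
      \<open>flat_speed \<theta>\<close> = a. Since \<theta> maximises the Legendre expression,
      replacing it by \<theta>' loses nothing in that part of the rate.\<close>
    define \<theta>' where "\<theta>' = (\<theta> + \<theta>2) / 2"
    have th': "\<theta> < \<theta>'" "\<theta>' < \<theta>2" using th2 by (auto simp: \<theta>'_def)
    have am: "a < flat_speed \<theta>2" using flat_speed_strict_mono[OF th(1) th2(2)] th(2) by simp
    have rate: "flat_cgf \<theta>' - \<epsilon> / 4 - \<theta>' * (1 + flat_speed \<theta>2) \<ge> - r - \<epsilon> / 2"
    proof -
      have "\<theta>' * (1 + a) - flat_cgf \<theta>' \<le> r" using objective_strict_max[of \<theta> \<theta>'] th th' r by simp
      moreover have "\<theta>' * (flat_speed \<theta>2 - a) \<le> \<theta>2 * (flat_speed \<theta>2 - a)" using th' am by (intro mult_right_mono) auto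
      ultimately show ?thesis using th2(1) by (simp add: h_def algebra_simps)
    qed
    obtain K where K: "K > 0" and low: "\<forall>\<^sub>F t in sequentially. exp (real t * (flat_cgf \<theta>' - \<epsilon> / 4 - \<theta>' * (1 + flat_speed \<theta>2))) \<le> 8 * real K * real t * P t"
      using flat_tail_lower[OF assms(1) th(1) th', of "\<epsilon> / 4"] eps unfolding P_def th(2) by auto
    obtain K' C where C: "C > 0" and up: "\<And>t. t > 0 \<Longrightarrow> P t \<le> (real K' * real t * exp \<theta> + C) * exp (- (real t * r))"
      using flat_tail_upper[OF assms(1) th(1) assms(2)] unfolding P_def r by blast
    have "\<forall>\<^sub>F t::nat in sequentially. ln ((real K' * exp \<theta>) * real t + C) / real t < \<epsilon>"
      using ln0[of "real K' * exp \<theta>" C] C eps by (intro order_tendstoD(2)[where y=0]) auto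
    moreover have "\<forall>\<^sub>F t::nat in sequentially. ln (8 * real K * real t + 1) / real t < \<epsilon> / 2"
      using ln0[of "8 * real K" 1] eps by (intro order_tendstoD(2)[where y=0]) auto
    moreover note low eventually_gt_at_top[of 0]
    ultimately have "\<forall>\<^sub>F t in sequentially. norm (ln (P t) / real t - - r) < \<epsilon>"
    proof eventually_elim
      case (elim t)
      have t: "real t > 0" using elim by simp
      \<comment> \<open>At 0 the value of \<open>ln\<close> would be a mere convention; the lower
        bound itself shows that the probability is positive.\<close>
      have pos: "P t > 0"
      proof -
        have "0 < 8 * real K * real t * P t" using elim(3) exp_gt_zero by (rule less_le_trans[rotated])
        then have "P t \<noteq> 0" by auto
        moreover have "P t \<ge> 0" by (simp add: P_def)
        ultimately show ?thesis by simp
      qed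
      have "ln (P t) \<le> ln ((real K' * real t * exp \<theta> + C) * exp (- (real t * r)))"
        using up[of t] elim(4) pos by (intro ln_mono) (auto simp: C add_nonneg_pos)
      also have "\<dots> = ln ((real K' * exp \<theta>) * real t + C) - real t * r"
        using C by (subst ln_mult_pos) (auto simp: add_nonneg_pos mult_ac)
      finally have "ln (P t) / real t \<le> (ln ((real K' * exp \<theta>) * real t + C) - real t * r) / real t"
        using t by (intro divide_right_mono) auto
      also have "\<dots> = ln ((real K' * exp \<theta>) * real t + C) / real t - r" using t by (simp add: diff_divide_distrib)
      finally have 1: "ln (P t) / real t + r < \<epsilon>" using elim(1) by linarith
      have "real t * (- r - \<epsilon> / 2) \<le> real t * (flat_cgf \<theta>' - \<epsilon> / 4 - \<theta>' * (1 + flat_speed \<theta>2))"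
        using rate t by (intro mult_left_mono) auto
      also have "\<dots> \<le> ln (8 * real K * real t * P t)"
        using elim(3) pos t K by (subst ln_ge_iff) auto
      \<comment> \<open>The added 1 gives the form k t + b with b > 0 that \<open>ln0\<close>
        covers.\<close>
      also have "\<dots> \<le> ln ((8 * real K * real t + 1) * P t)"
        using pos t K by (intro ln_mono mult_right_mono) auto
      also have "\<dots> = ln (8 * real K * real t + 1) + ln (P t)" using pos t by (intro ln_mult_pos) (auto simp: add_nonneg_pos)
      finally have "real t * (- r - \<epsilon> / 2) / real t \<le> (ln (8 * real K * real t + 1) + ln (P t)) / real t"
        using t by (intro divide_right_mono) auto
      then have "- r - \<epsilon> / 2 \<le> ln (8 * real K * real t + 1) / real t + ln (P t) / real t" using t by (simp add: add_divide_distrib)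
      then have 2: "- \<epsilon> < ln (P t) / real t + r" using elim(2) by linarith
      show ?case using 1 2 by (simp add: abs_less_iff)
    qed
    then show "\<exists>no. \<forall>t\<ge>no. norm (ln (P t) / real t - - r) < \<epsilon>" by (simp add: eventually_sequentially)
  qed
  then show ?thesis using flat_rate_eq(2)[OF th] unfolding P_def flat_tail_def r_def by blast
qed

end
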